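(* Let $A\in\mathbb R$ and let $(H_e)_{e\in\mathcal E_1}$ satisfy (H'0)–(H'3) (listed in the context). Let $u_0:\mathbb R^d\to\mathbb R$ be Lipschitz continuous and, for $\varepsilon>0$, let $u^\varepsilon$ be the solution of $$\begin{cases}u^\varepsilon_t+H_{e/\varepsilon}(u^\varepsilon_x)=0,& t>0,\ x\in e^*,\ e\in\mathcal E_\varepsilon,\\ u^\varepsilon_t+F_A(\tfrac x\varepsilon,u^\varepsilon_x)=0,& t>0,\ x\in\mathcal V_\varepsilon,\end{cases}\qquad u^\varepsilon(0,x)=u_0(x),\ x\in\mathcal N_\varepsilon.$$ Then there exists a continuous function $\bar H:\mathbb R^d\to\mathbb R$ such that $u^\varepsilon$ converges locally uniformly, as $\varepsilon\to0$, towards the unique solution $u^0$ of $$u^0_t+\bar H(\nabla_xu^0)=0\ \text{ for } t>0,\ x\in\mathbb R^d,\qquad u^0(0,x)=u_0(x)\ \text{ for }x\in\mathbb R^d,$$ in the sense that $\lim_{\varepsilon\to 0,\ (s,y)\to(t,x),\ y\in\mathcal N_\varepsilon}u^\varepsilon(s,y)=u^0(t,x)$.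
   Context: Network: for $k,l\in\mathbb Z^d$ with $|k-l|=1$, $e_{k,l}=\{\theta k+(1-\theta)l:\theta\in[0,1]\}$; if $l=k+b_i$, with $(b_1,\dots,b_d)$ the canonical basis, $e_{k,l}$ is oriented in the direction $b_i$. For $\varepsilon>0$, $\mathcal N_\varepsilon$ is the network embedded in $\mathbb R^d$ with edges $\mathcal E_\varepsilon=\{\varepsilon e_{k,l}\}$ and vertices $\mathcal V_\varepsilon=\varepsilon\mathbb Z^d$; each edge has the Euclidean length as coordinate, increasing in the orientation. $e^*$ is the edge without endpoints. For $m\in\mathbb Z^d$, $e_{k,l}+m=e_{k+m,l+m}$. Assumptions on $H_e:\mathbb R\to\mathbb R$, $e\in\mathcal E_1$. (H'0) $H_e$ is continuous. (H'1) $\liminf_{|q|\to+\infty}H_e(q)=+\infty$. (H'2) There is $p_e^0\in\mathbb R$ such that $H_e$ is nonincreasing on $(-\infty,p_e^0]$ and nondecreasing on $[p_e^0,+\infty)$. (H'3) $H_{e+m}=H_e$ for all $m\in\mathbb Z^d$. $H_e^-(q)=H_e(q)$ for $q\le p_e^0$, $=H_e(p_e^0)$ for $q>p_e^0$; $H_e^+(q)=H_e(p_e^0)$ for $q\le p_e^0$, $=H_e(q)$ for $q>p_e^0$. For $y\in\mathcal V_1$, $\mathcal E_y^-$ (resp. $\mathcal E_y^+$) is the set of edges of $\mathcal E_1$ starting (resp. ending) at $y$, and for $p=(p_e)_{e\in\mathcal E_y^-\cup\mathcal E_y^+}$, $F_A(y,p)=\max\big(A,\max_{e\in\mathcal E_y^-}H_e^-(p_e),\max_{e\in\mathcal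 E_y^+}H_e^+(p_e)\big)$. Gradient: $u_x(x)$ is the derivative $\partial_eu(x)$ along the oriented edge if $x\in e^*$, and the vector of derivatives $(\partial_eu(x))$ over edges $e$ containing $x$ if $x$ is a vertex. Solutions on $\mathcal N_\varepsilon$ are viscosity solutions: test functions are continuous on $(0,\infty)\times\mathcal N_\varepsilon$ with $C^1$ restriction to $(0,\infty)\times e$ for each edge $e$; the inequality $\le0$ (resp. $\ge0$) of the equation (the vertex equation at vertices) is required at points where a test function touches the upper (resp. lower) semi-continuous envelope of $u$ from above (resp. below), and $u^*(0,\cdot)\le u_0\le u_*(0,\cdot)$. $u^\varepsilon$ is the unique such solution for which, for every $T>0$, $|u^\varepsilon-u_0|$ is bounded on $[0,T)\times\mathcal N_\varepsilon$. The equation in $\mathbb R^d$ is understood in the usual viscosity sense. *)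

theory Defs
  imports "HOL-Analysis.Analysis"
begin

text \<open>
  The pair \<open>(k, i)\<close> encodes the segment between \<open>k\<close> and \<open>k + b\<^sub>i\<close>, oriented in the
  direction \<open>b\<^sub>i\<close>.  The same index stands for this edge of the unit network and for its image
  under scaling by \<open>\<epsilon>\<close> in the network of mesh size \<open>\<epsilon>\<close>; likewise \<open>y :: int^'d\<close> stands for the
  vertex \<open>y\<close> and for the vertex \<open>\<epsilon> y\<close>.  Hence a Hamiltonian written with the subscript
  \<open>e / \<epsilon>\<close>, or a vertex function evaluated at \<open>x / \<epsilon>\<close>, is here taken at the index itself.
\<close>

type_synonym 'd edge = "(int, 'd) vec \<times> 'd"

definition edge_start :: "'d::finite edge \<Rightarrow> int^'d" where
  "edge_start e = fst e"

definition edge_end :: "'d::finite edge \<Rightarrow> int^'d" where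
  "edge_end e = fst e + axis (snd e) 1"

definition edge_dir :: "'d::finite edge \<Rightarrow> real^'d" where
  "edge_dir e = axis (snd e) 1"

definition shift_edge :: "int^'d \<Rightarrow> 'd::finite edge \<Rightarrow> 'd edge" where
  "shift_edge m e = (fst e + m, snd e)"

definition vertex_pt :: "real \<Rightarrow> int^'d::finite \<Rightarrow> real^'d" where
  "vertex_pt \<epsilon> k = (\<chi> j. \<epsilon> * of_int (k $ j))"

definition edge_seg :: "real \<Rightarrow> 'd::finite edge \<Rightarrow> (real^'d) set" where
  "edge_seg \<epsilon> e = closed_segment (vertex_pt \<epsilon> (edge_start e)) (vertex_pt \<epsilon> (edge_end e))"

definition open_edge_seg :: "real \<Rightarrow> 'd::finite edge \<Rightarrow> (real^'d) set" where
  "open_edge_seg \<epsilon> e = open_segment (vertex_pt \<epsilon> (edge_start e)) (vertex_pt \<epsilon> (edge_end e))"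

definition network :: "real \<Rightarrow> (real^'d::finite) set" where
  "network \<epsilon> = (\<Union>e. edge_seg \<epsilon> e)"

text \<open>Arc length coordinate on an edge, ranging over \<open>[0, \<epsilon>]\<close>.\<close>

definition edge_pt :: "real \<Rightarrow> 'd::finite edge \<Rightarrow> real \<Rightarrow> real^'d" where
  "edge_pt \<epsilon> e s = vertex_pt \<epsilon> (edge_start e) + s *\<^sub>R edge_dir e"

definition edge_coord :: "real \<Rightarrow> 'd::finite edge \<Rightarrow> real^'d \<Rightarrow> real" where
  "edge_coord \<epsilon> e x = (x - vertex_pt \<epsilon> (edge_start e)) \<bullet> edge_dir e"

text \<open>For \<open>x\<close> on the edge \<open>e\<close>; one-sided when \<open>x\<close> is an endpoint of \<open>e\<close>.\<close>

definition edge_deriv :: "real \<Rightarrow> 'd::finite edge \<Rightarrow> (real^'d \<Rightarrow> real) \<Rightarrow> real^'d \<Rightarrow> real" where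
  "edge_deriv \<epsilon> e f x =
     vector_derivative (\<lambda>s. f (edge_pt \<epsilon> e s)) (at (edge_coord \<epsilon> e x) within {0..\<epsilon>})"

definition edges_starting :: "int^'d \<Rightarrow> 'd::finite edge set" where
  "edges_starting y = {e. edge_start e = y}"

definition edges_ending :: "int^'d \<Rightarrow> 'd::finite edge set" where
  "edges_ending y = {e. edge_end e = y}"

definition H_minus :: "(real \<Rightarrow> real) \<Rightarrow> real \<Rightarrow> real \<Rightarrow> real" where
  "H_minus h p0 q = (if q \<le> p0 then h q else h p0)"

definition H_plus :: "(real \<Rightarrow> real) \<Rightarrow> real \<Rightarrow> real \<Rightarrow> real" where
  "H_plus h p0 q = (if q \<le> p0 then h p0 else h q)"

definition F_lim :: "real \<Rightarrow> ('d::finite edge \<Rightarrow> real \<Rightarrow> real) \<Rightarrow> ('d edge \<Rightarrow> real) \<Rightarrow>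
    int^'d \<Rightarrow> ('d edge \<Rightarrow> real) \<Rightarrow> real" where
  "F_lim A H p0 y p =
     Max ({A} \<union> (\<lambda>e. H_minus (H e) (p0 e) (p e)) ` edges_starting y
              \<union> (\<lambda>e. H_plus (H e) (p0 e) (p e)) ` edges_ending y)"

text \<open>
  Functions of time and space are only relevant on \<open>{0..} \<times> X\<close>, where \<open>X\<close> is a network or the
  whole space.  The envelopes are extended real valued and relative to this domain; the point
  itself is not excluded in the limit superior and inferior.
\<close>

definition usc_env :: "'a::topological_space set \<Rightarrow> ('a \<Rightarrow> real) \<Rightarrow> 'a \<Rightarrow> ereal" where
  "usc_env D u z = Limsup (inf (nhds z) (principal D)) (\<lambda>w. ereal (u w))"

definition lsc_env :: "'a::topological_space set \<Rightarrow> ('a \<Rightarrow> real) \<Rightarrow> 'a \<Rightarrow> ereal" where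
  "lsc_env D u z = Liminf (inf (nhds z) (principal D)) (\<lambda>w. ereal (u w))"

definition touches_from_above :: "'a::topological_space set \<Rightarrow> (real \<times> 'a \<Rightarrow> real) \<Rightarrow>
    (real \<times> 'a \<Rightarrow> real) \<Rightarrow> real \<times> 'a \<Rightarrow> bool" where
  "touches_from_above X \<phi> u z \<longleftrightarrow>
     usc_env ({0..} \<times> X) u z = ereal (\<phi> z) \<and>
     (\<forall>\<^sub>F w in at z within {0<..} \<times> X. usc_env ({0..} \<times> X) u w \<le> ereal (\<phi> w))"

definition touches_from_below :: "'a::topological_space set \<Rightarrow> (real \<times> 'a \<Rightarrow> real) \<Rightarrow>
    (real \<times> 'a \<Rightarrow> real) \<Rightarrow> real \<times> 'a \<Rightarrow> bool" where
  "touches_from_below X \<phi> u z \<longleftrightarrow>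
     lsc_env ({0..} \<times> X) u z = ereal (\<phi> z) \<and>
     (\<forall>\<^sub>F w in at z within {0<..} \<times> X. ereal (\<phi> w) \<le> lsc_env ({0..} \<times> X) u w)"

definition attains_initial :: "'a::topological_space set \<Rightarrow> ('a \<Rightarrow> real) \<Rightarrow>
    (real \<times> 'a \<Rightarrow> real) \<Rightarrow> bool" where
  "attains_initial X u0 u \<longleftrightarrow>
     (\<forall>x\<in>X. usc_env ({0..} \<times> X) u (0, x) \<le> ereal (u0 x) \<and>
             ereal (u0 x) \<le> lsc_env ({0..} \<times> X) u (0, x))"

definition bounded_gap :: "'a set \<Rightarrow> ('a \<Rightarrow> real) \<Rightarrow> (real \<times> 'a \<Rightarrow> real) \<Rightarrow> bool" where
  "bounded_gap X u0 u \<longleftrightarrow>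
     (\<forall>T>0. \<exists>C. \<forall>t\<in>{0..<T}. \<forall>x\<in>X. \<bar>u (t, x) - u0 x\<bar> \<le> C)"

text \<open>Used only for convex \<open>S\<close> with nonempty interior, where the derivative within \<open>S\<close> is unique.\<close>

definition C1_on :: "'a::real_normed_vector set \<Rightarrow> ('a \<Rightarrow> real) \<Rightarrow> bool" where
  "C1_on S f \<longleftrightarrow>
     (\<exists>f' :: 'a \<Rightarrow> 'a \<Rightarrow>\<^sub>L real. continuous_on S f' \<and>
        (\<forall>z\<in>S. (f has_derivative blinfun_apply (f' z)) (at z within S)))"

definition time_deriv :: "(real \<times> 'a \<Rightarrow> real) \<Rightarrow> real \<Rightarrow> 'a \<Rightarrow> real" where
  "time_deriv \<phi> t x = deriv (\<lambda>s. \<phi> (s, x)) t"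

definition network_test :: "real \<Rightarrow> (real \<times> (real^'d::finite) \<Rightarrow> real) \<Rightarrow> bool" where
  "network_test \<epsilon> \<phi> \<longleftrightarrow>
     continuous_on ({0<..} \<times> network \<epsilon>) \<phi> \<and>
     (\<forall>e. C1_on ({0<..} \<times> {0..\<epsilon>}) (\<lambda>(t, s). \<phi> (t, edge_pt \<epsilon> e s)))"

definition network_subsolution :: "real \<Rightarrow> ('d::finite edge \<Rightarrow> real \<Rightarrow> real) \<Rightarrow>
    (int^'d \<Rightarrow> ('d edge \<Rightarrow> real) \<Rightarrow> real) \<Rightarrow> (real \<times> (real^'d) \<Rightarrow> real) \<Rightarrow> bool" where
  "network_subsolution \<epsilon> H F u \<longleftrightarrow>
     (\<forall>\<phi> t. network_test \<epsilon> \<phi> \<and> 0 < t \<longrightarrow>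
        (\<forall>e. \<forall>x\<in>open_edge_seg \<epsilon> e. touches_from_above (network \<epsilon>) \<phi> u (t, x) \<longrightarrow>
           time_deriv \<phi> t x + H e (edge_deriv \<epsilon> e (\<lambda>y. \<phi> (t, y)) x) \<le> 0) \<and>
        (\<forall>y. touches_from_above (network \<epsilon>) \<phi> u (t, vertex_pt \<epsilon> y) \<longrightarrow>
           time_deriv \<phi> t (vertex_pt \<epsilon> y)
             + F y (\<lambda>e. edge_deriv \<epsilon> e (\<lambda>x. \<phi> (t, x)) (vertex_pt \<epsilon> y)) \<le> 0))"

definition network_supersolution :: "real \<Rightarrow> ('d::finite edge \<Rightarrow> real \<Rightarrow> real) \<Rightarrow>
    (int^'d \<Rightarrow> ('d edge \<Rightarrow> real) \<Rightarrow> real) \<Rightarrow> (real \<times> (real^'d) \<Rightarrow> real) \<Rightarrow> bool" where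
  "network_supersolution \<epsilon> H F u \<longleftrightarrow>
     (\<forall>\<phi> t. network_test \<epsilon> \<phi> \<and> 0 < t \<longrightarrow>
        (\<forall>e. \<forall>x\<in>open_edge_seg \<epsilon> e. touches_from_below (network \<epsilon>) \<phi> u (t, x) \<longrightarrow>
           time_deriv \<phi> t x + H e (edge_deriv \<epsilon> e (\<lambda>y. \<phi> (t, y)) x) \<ge> 0) \<and>
        (\<forall>y. touches_from_below (network \<epsilon>) \<phi> u (t, vertex_pt \<epsilon> y) \<longrightarrow>
           time_deriv \<phi> t (vertex_pt \<epsilon> y)
             + F y (\<lambda>e. edge_deriv \<epsilon> e (\<lambda>x. \<phi> (t, x)) (vertex_pt \<epsilon> y)) \<ge> 0))"

definition network_solution :: "real \<Rightarrow> ('d::finite edge \<Rightarrow> real \<Rightarrow> real) \<Rightarrow>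
    (int^'d \<Rightarrow> ('d edge \<Rightarrow> real) \<Rightarrow> real) \<Rightarrow> (real^'d \<Rightarrow> real) \<Rightarrow> (real \<times> (real^'d) \<Rightarrow> real) \<Rightarrow> bool" where
  "network_solution \<epsilon> H F u0 u \<longleftrightarrow>
     network_subsolution \<epsilon> H F u \<and> network_supersolution \<epsilon> H F u \<and>
     attains_initial (network \<epsilon>) u0 u \<and> bounded_gap (network \<epsilon>) u0 u"

definition gradient :: "('a::real_inner \<Rightarrow> real) \<Rightarrow> 'a \<Rightarrow> 'a" where
  "gradient f x = (THE q. GDERIV f x :> q)"

definition space_subsolution ::
    "('a::euclidean_space \<Rightarrow> real) \<Rightarrow> (real \<times> 'a \<Rightarrow> real) \<Rightarrow> bool" where
  "space_subsolution Hbar u \<longleftrightarrow>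
     (\<forall>\<phi> t x. C1_on ({0<..} \<times> UNIV) \<phi> \<and> 0 < t \<and> touches_from_above UNIV \<phi> u (t, x) \<longrightarrow>
        time_deriv \<phi> t x + Hbar (gradient (\<lambda>y. \<phi> (t, y)) x) \<le> 0)"

definition space_supersolution ::
    "('a::euclidean_space \<Rightarrow> real) \<Rightarrow> (real \<times> 'a \<Rightarrow> real) \<Rightarrow> bool" where
  "space_supersolution Hbar u \<longleftrightarrow>
     (\<forall>\<phi> t x. C1_on ({0<..} \<times> UNIV) \<phi> \<and> 0 < t \<and> touches_from_below UNIV \<phi> u (t, x) \<longrightarrow>
        time_deriv \<phi> t x + Hbar (gradient (\<lambda>y. \<phi> (t, y)) x) \<ge> 0)"

text \<open>The growth class, in which uniqueness is understood, is the same as on the network.\<close>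

definition space_solution ::
    "('a::euclidean_space \<Rightarrow> real) \<Rightarrow> ('a \<Rightarrow> real) \<Rightarrow> (real \<times> 'a \<Rightarrow> real) \<Rightarrow> bool" where
  "space_solution Hbar u0 u \<longleftrightarrow>
     space_subsolution Hbar u \<and> space_supersolution Hbar u \<and>
     attains_initial UNIV u0 u \<and> bounded_gap UNIV u0 u"

definition unique_space_solution ::
    "('a::euclidean_space \<Rightarrow> real) \<Rightarrow> ('a \<Rightarrow> real) \<Rightarrow> (real \<times> 'a \<Rightarrow> real) \<Rightarrow> bool" where
  "unique_space_solution Hbar u0 u \<longleftrightarrow>
     space_solution Hbar u0 u \<and>
     (\<forall>v. space_solution Hbar u0 v \<longrightarrow> (\<forall>t\<ge>0. \<forall>x. v (t, x) = u (t, x)))"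

end

theory Submission
  imports Defs
begin

text \<open>
  By periodicity the Hamiltonian of an edge depends only on its direction \<open>i\<close>; call it \<open>h i\<close>.  The
  effective Hamiltonian is \<open>Hbar p = max A (max\<^sub>i h i (p $ i))\<close>.  The reason is that a
  smooth function of \<open>\<real>\<^sup>d\<close> with gradient \<open>p\<close> has the slope \<open>p $ i\<close> on both edges of direction \<open>i\<close> at a
  vertex, and for equal slopes the larger of \<open>H\<^sup>-\<close> and \<open>H\<^sup>+\<close> is \<open>h i\<close>; the vertex
  condition is then \<open>\<phi>\<^sub>t + Hbar p = 0\<close>, while an edge of direction \<open>i\<close> only sees \<open>h i (p $ i) \<le> Hbar p\<close>.

  The proof uses half-relaxed limits of \<open>u \<epsilon>\<close>.  The lower limit is a supersolution because both
  the edges and the vertices see at most \<open>Hbar p\<close> (\<open>relaxed_liminf_supersolution\<close>).  For the upper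
  limit, contact points in the interior of an edge with \<open>h j (p $ j) < Hbar p\<close> have to be excluded.
  This is done with a penalty of size \<open>O(\<epsilon>)\<close>, namely a large multiple of the distance of \<open>x $ j\<close> to
  \<open>\<epsilon> \<int>\<close>: along those edges it produces slopes at which the coercive \<open>h j\<close> is too large, and at vertices
  it leaves the slopes in the remaining directions unchanged (\<open>relaxed_limsup_subsolution\<close>).  The penalty plays
  the role of a corrector.

  Smooth barriers give \<open>\<bar>u \<epsilon> (t, x) - u0 x\<bar> \<le> C * t\<close> with a constant independent of \<open>\<epsilon>\<close>
  (\<open>barrier_above\<close>, \<open>barrier_below\<close>), so that the half-relaxed limits are finite and attain the initial
  datum.  The comparison principle in \<open>\<real>\<^sup>d\<close> (\<open>comparison_principle\<close>) makes the upper limit lie below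
  the lower one.  Equality of the two gives the solution \<open>ubar\<close> and the convergence at the same
  time, and comparison with any other solution gives uniqueness.
\<close>

section \<open>Semicontinuous envelopes\<close>

lemma usc_env_lessD:
  assumes "usc_env D u z < ereal c"
  shows "\<forall>\<^sub>F w in nhds z. w \<in> D \<longrightarrow> u w < c"
  using Limsup_lessD[OF assms[unfolded usc_env_def]]
  by (simp add: eventually_inf_principal)

lemma usc_env_le:
  assumes "\<forall>\<^sub>F w in nhds z. w \<in> D \<longrightarrow> u w \<le> c"
  shows "usc_env D u z \<le> ereal c"
  unfolding usc_env_def
  by (rule Limsup_bounded) (use assms in \<open>simp add: eventually_inf_principal\<close>)

lemma usc_env_upper:
  assumes "z \<in> D"
  shows "ereal (u z) \<le> usc_env D u z"
proof (rule ccontr)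
  assume "\<not> ?thesis"
  then have "usc_env D u z < ereal (u z)" by simp
  from usc_env_lessD[OF this] have "z \<in> D \<longrightarrow> u z < u z"
    by (rule eventually_nhds_x_imp_x)
  with assms show False by simp
qed

lemma eventually_usc_env_less:
  assumes "usc_env D u z < c"
  shows "\<forall>\<^sub>F w in nhds z. usc_env D u w < c"
proof -
  obtain b where b: "usc_env D u z < ereal b" "ereal b < c"
    using assms ereal_dense2 by blast
  from usc_env_lessD[OF b(1)]
  have "\<forall>\<^sub>F w in nhds z. \<forall>\<^sub>F w' in nhds w. w' \<in> D \<longrightarrow> u w' < b"
    by (simp add: eventually_eventually)
  then show ?thesis
  proof eventually_elim
    case (elim w)
    have "usc_env D u w \<le> ereal b"
      by (rule usc_env_le) (use elim in \<open>auto elim: eventually_mono\<close>)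
    then show ?case using b(2) by (rule le_less_trans)
  qed
qed

lemma usc_env_frequently:
  assumes "ereal c < usc_env D u z"
  shows "\<exists>\<^sub>F w in nhds z. w \<in> D \<and> c < u w"
proof (rule ccontr)
  assume "\<not> ?thesis"
  then have "\<forall>\<^sub>F w in nhds z. w \<in> D \<longrightarrow> u w \<le> c"
    by (simp add: not_frequently not_less)
  from usc_env_le[OF this] assms show False by simp
qed

text \<open>
  Through the following identities every statement about a lower envelope is a statement about the
  upper envelope of the negated function; only upper envelopes are studied directly.
\<close>

lemma lsc_env_uminus: "lsc_env D u z = - usc_env D (\<lambda>w. - u w) z"
  unfolding lsc_env_def usc_env_def
  using ereal_Limsup_uminus[of _ "\<lambda>w. ereal (u w)"] by simp

lemma usc_env_uminus: "usc_env D (\<lambda>w. - u w) z = - lsc_env D u z"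
  by (simp add: lsc_env_uminus)

lemma lsc_env_lower: "z \<in> D \<Longrightarrow> lsc_env D u z \<le> ereal (u z)"
  using usc_env_upper[of z D "\<lambda>w. - u w"]
  by (simp add: lsc_env_uminus ereal_uminus_le_reorder)

lemma touches_from_above_uminus:
  "touches_from_above X \<phi> (\<lambda>w. - u w) z \<longleftrightarrow> touches_from_below X (\<lambda>w. - \<phi> w) u z"
  by (simp add: touches_from_above_def touches_from_below_def usc_env_uminus
      ereal_uminus_eq_reorder ereal_uminus_le_reorder flip: uminus_ereal.simps(1))

text \<open>
  Since \<open>c\<close> exceeds the value at \<open>z\<close>, the punctured filter says the same as the full one, and it
  is the filter in which continuity on \<open>D\<close> is expressed.
\<close>

definition usc_on :: "'a::topological_space set \<Rightarrow> ('a \<Rightarrow> real) \<Rightarrow> bool" where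
  "usc_on D f \<longleftrightarrow> (\<forall>z\<in>D. \<forall>c>f z. \<forall>\<^sub>F w in at z within D. f w < c)"

lemma usc_on_continuous: "continuous_on D f \<Longrightarrow> usc_on D f"
  unfolding usc_on_def continuous_on_def by (auto intro: order_tendstoD)

lemma usc_on_add:
  assumes "usc_on D f" "usc_on D g"
  shows "usc_on D (\<lambda>z. f z + g z)"
  unfolding usc_on_def
proof (intro ballI allI impI)
  fix z c assume z: "z \<in> D" and c: "f z + g z < c"
  define h where "h = (c - f z - g z) / 2"
  have h: "h > 0" using c by (simp add: h_def)
  have "\<forall>\<^sub>F w in at z within D. f w < f z + h" "\<forall>\<^sub>F w in at z within D. g w < g z + h"
    using assms z h unfolding usc_on_def by auto
  then show "\<forall>\<^sub>F w in at z within D. f w + g w < c"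
    by eventually_elim (auto simp: h_def field_simps)
qed

lemma usc_on_compose:
  assumes "usc_on D f" "continuous_on E h" "h ` E \<subseteq> D"
  shows "usc_on E (\<lambda>z. f (h z))"
  unfolding usc_on_def
proof (intro ballI allI impI)
  fix z c assume z: "z \<in> E" and c: "f (h z) < c"
  have hz: "h z \<in> D" using z assms(3) by auto
  have "\<forall>\<^sub>F w in at (h z) within D. f w < c"
    using assms(1) hz c unfolding usc_on_def by auto
  then have "\<forall>\<^sub>F w in nhds (h z). w \<in> D \<longrightarrow> f w < c"
    unfolding eventually_at_filter by (rule eventually_mono) (use c in auto)
  moreover have "filterlim h (nhds (h z)) (at z within E)"
    using assms(2) z by (auto simp: continuous_on_def)
  ultimately have "\<forall>\<^sub>F w in at z within E. h w \<in> D \<longrightarrow> f (h w) < c"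
    by (rule eventually_compose_filterlim)
  moreover have "\<forall>\<^sub>F w in at z within E. w \<in> E"
    by (simp add: eventually_at_filter)
  ultimately show "\<forall>\<^sub>F w in at z within E. f (h w) < c"
    by eventually_elim (use assms(3) in auto)
qed

text \<open>
  If every value were exceeded by another one, then near each \<open>z\<close> the function would stay below some
  larger value \<open>f (s z)\<close>.  By compactness finitely many of these values bound \<open>f\<close> strictly on all of
  \<open>D\<close>, including at the point where the largest of them is taken.
\<close>

lemma usc_on_attains_max:
  assumes "compact D" "D \<noteq> {}" "usc_on D f"
  shows "\<exists>z\<in>D. \<forall>w\<in>D. f w \<le> f z"
proof (rule ccontr)
  assume "\<not> ?thesis"
  then have "\<forall>z\<in>D. \<exists>w\<in>D. f z < f w" by force
  then obtain s where s: "\<And>z. z \<in> D \<Longrightarrow> s z \<in> D \<and> f z < f (s z)" by metis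
  have "\<exists>U. open U \<and> z \<in> U \<and> (\<forall>w\<in>U \<inter> D. f w < f (s z))" if "z \<in> D" for z
  proof -
    have "\<forall>\<^sub>F w in at z within D. f w < f (s z)"
      using assms(3) s[OF that] that unfolding usc_on_def by auto
    then have "\<forall>\<^sub>F w in nhds z. w \<in> D \<longrightarrow> f w < f (s z)"
      unfolding eventually_at_filter by (rule eventually_mono) (use s[OF that] in auto)
    then show ?thesis unfolding eventually_nhds by blast
  qed
  then obtain U where U: "\<And>z. z \<in> D \<Longrightarrow> open (U z) \<and> z \<in> U z \<and> (\<forall>w\<in>U z \<inter> D. f w < f (s z))"
    by metis
  obtain C where C: "C \<subseteq> D" "finite C" "D \<subseteq> (\<Union>z\<in>C. U z)"
    using compactE_image[OF assms(1), of D U] U by blast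
  have "C \<noteq> {}" using C assms(2) by auto
  have "finite ((\<lambda>z. f (s z)) ` C)" "(\<lambda>z. f (s z)) ` C \<noteq> {}" using C \<open>C \<noteq> {}\<close> by auto
  then obtain z where z: "z \<in> C" "f (s z) = Max ((\<lambda>z. f (s z)) ` C)"
    by (metis (no_types, lifting) Max_in imageE)
  have "s z \<in> D" using s C z by auto
  then obtain y where y: "y \<in> C" "s z \<in> U y" using C by auto
  then have "f (s z) < f (s y)" using U[of y] C \<open>s z \<in> D\<close> by auto
  moreover have "f (s y) \<le> Max ((\<lambda>z. f (s z)) ` C)" using C y by auto
  ultimately show False using z(2) by simp
qed

lemma usc_on_env:
  assumes "\<And>z. z \<in> D \<Longrightarrow> usc_env E u z = ereal (f z)"
  shows "usc_on D f"
  unfolding usc_on_def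
proof (intro ballI allI impI)
  fix z c assume z: "z \<in> D" and c: "f z < c"
  have "\<forall>\<^sub>F w in nhds z. usc_env E u w < ereal c"
    by (rule eventually_usc_env_less) (use assms[OF z] c in simp)
  then have "\<forall>\<^sub>F w in nhds z. w \<in> D \<longrightarrow> f w < c"
    by eventually_elim (use assms in auto)
  then show "\<forall>\<^sub>F w in at z within D. f w < c"
    unfolding eventually_at_filter by eventually_elim auto
qed

lemma usc_env_of_usc_on:
  assumes "usc_on D f" "z \<in> D"
  shows "usc_env D f z = ereal (f z)"
proof (rule antisym)
  have "usc_env D f z \<le> ereal (f z) + ereal e" if "0 < e" for e
  proof -
    note \<open>0 < e\<close>
    then have "\<forall>\<^sub>F w in at z within D. f w < f z + e"
      using assms unfolding usc_on_def by auto
    then have "\<forall>\<^sub>F w in nhds z. w \<in> D \<longrightarrow> f w \<le> f z + e"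
      unfolding eventually_at_filter by (rule eventually_mono) (use \<open>0 < e\<close> in auto)
    from usc_env_le[OF this] show ?thesis by simp
  qed
  then show "usc_env D f z \<le> ereal (f z)" by (rule ereal_le_epsilon2)
qed (rule usc_env_upper[OF assms(2)])

text \<open>
  The point \<open>z\<close> may lie outside \<open>D\<close>: half-relaxed limits are envelopes at such points.
\<close>

lemma usc_env_le_of_bound:
  assumes "\<forall>\<^sub>F w in nhds z. w \<in> D \<longrightarrow> u w \<le> b w"
    and "continuous_on E b" "D \<subseteq> E" "z \<in> E"
  shows "usc_env D u z \<le> ereal (b z)"
proof (rule ereal_le_epsilon2)
  fix e :: real assume "0 < e"
  then have "usc_env E b z < ereal (b z + e)"
    using usc_env_of_usc_on[OF usc_on_continuous[OF assms(2)] assms(4)] by simp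
  from usc_env_lessD[OF this] assms(1)
  have "\<forall>\<^sub>F w in nhds z. w \<in> D \<longrightarrow> u w \<le> b z + e"
    by eventually_elim (use assms(3) in force)
  from usc_env_le[OF this] show "usc_env D u z \<le> ereal (b z) + ereal e" by simp
qed

section \<open>Smooth test functions\<close>

text \<open>
  Continuously differentiable test functions, with the time derivative \<open>\<tau>\<close> and the spatial gradient
  \<open>g\<close> carried along as data.  The viscosity inequalities can then be read off from the formula by
  which a test function was built.
\<close>

definition smooth_test ::
  "(real \<times> 'a::euclidean_space \<Rightarrow> real) \<Rightarrow> (real \<times> 'a \<Rightarrow> real) \<Rightarrow> (real \<times> 'a \<Rightarrow> 'a) \<Rightarrow> bool" where
  "smooth_test \<phi> \<tau> g \<longleftrightarrow>
     continuous_on ({0<..} \<times> UNIV) \<tau> \<and> continuous_on ({0<..} \<times> UNIV) g \<and>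
     (\<forall>z\<in>{0<..} \<times> UNIV. (\<phi> has_derivative (\<lambda>(a, h). \<tau> z * a + g z \<bullet> h)) (at z))"

lemma open_future: "open ({0::real<..} \<times> (UNIV :: 'a::topological_space set))"
  by (intro open_Times) auto

lemma smooth_test_derivative:
  assumes "smooth_test \<phi> \<tau> g" "0 < t"
  shows "(\<phi> has_derivative (\<lambda>(a, h). \<tau> (t, x) * a + g (t, x) \<bullet> h)) (at (t, x))"
  using assms unfolding smooth_test_def by (auto simp: case_prod_unfold)

lemma smooth_test_continuous_on:
  assumes "smooth_test \<phi> \<tau> g" "S \<subseteq> {0<..} \<times> UNIV"
  shows "continuous_on S \<phi>" "continuous_on S \<tau>" "continuous_on S g"
proof -
  have "continuous_on ({0<..} \<times> UNIV) \<phi>"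
    using assms(1) unfolding smooth_test_def
    by (meson continuous_at_imp_continuous_on has_derivative_continuous)
  then show "continuous_on S \<phi>" "continuous_on S \<tau>" "continuous_on S g"
    using assms continuous_on_subset unfolding smooth_test_def by blast+
qed

lemma smooth_test_blinfun:
  obtains f' :: "real \<times> 'a::euclidean_space \<Rightarrow> (real \<times> 'a) \<Rightarrow>\<^sub>L real"
  where "\<And>z. blinfun_apply (f' z) = (\<lambda>(a, h). \<tau> z * a + g z \<bullet> h)"
    and "\<And>S. continuous_on S \<tau> \<Longrightarrow> continuous_on S g \<Longrightarrow> continuous_on S f'"
proof
  let ?f = "\<lambda>z. \<tau> z *\<^sub>R fst_blinfun + (blinfun_inner_right (g z) o\<^sub>L snd_blinfun)"
  show "blinfun_apply (?f z) = (\<lambda>(a, h). \<tau> z * a + g z \<bullet> h)" for z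
    by (auto simp: fun_eq_iff blinfun.add_left blinfun.scaleR_left)
  show "continuous_on S ?f" if "continuous_on S \<tau>" "continuous_on S g" for S
    by (intro continuous_intros that
        bounded_linear.continuous_on[OF bounded_linear_blinfun_inner_right])
qed

lemma smooth_test_C1_on:
  assumes "smooth_test \<phi> \<tau> g"
  shows "C1_on ({0<..} \<times> UNIV) \<phi>"
proof -
  obtain f' :: "real \<times> 'a \<Rightarrow> (real \<times> 'a) \<Rightarrow>\<^sub>L real"
    where f': "\<And>z. blinfun_apply (f' z) = (\<lambda>(a, h). \<tau> z * a + g z \<bullet> h)"
      "\<And>S. continuous_on S \<tau> \<Longrightarrow> continuous_on S g \<Longrightarrow> continuous_on S f'"
    using smooth_test_blinfun[of \<tau> g] by blast
  show ?thesis unfolding C1_on_def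
    using assms f' unfolding smooth_test_def
    by (intro exI[of _ f']) (auto intro: has_derivative_at_withinI)
qed

lemma C1_on_smooth_test:
  fixes \<phi> :: "real \<times> 'a::euclidean_space \<Rightarrow> real"
  assumes "C1_on ({0<..} \<times> UNIV) \<phi>"
  obtains \<tau> g where "smooth_test \<phi> \<tau> g"
proof -
  let ?S = "{0<..} \<times> (UNIV :: 'a set)"
  obtain f' :: "real \<times> 'a \<Rightarrow> (real \<times> 'a) \<Rightarrow>\<^sub>L real" where f': "continuous_on ?S f'"
    "\<And>z. z \<in> ?S \<Longrightarrow> (\<phi> has_derivative blinfun_apply (f' z)) (at z within ?S)"
    using assms unfolding C1_on_def by auto
  define \<tau> where "\<tau> z = f' z (1, 0)" for z
  define g where "g z = (\<Sum>b\<in>Basis. f' z (0, b) *\<^sub>R b)" for z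
  have rep: "blinfun_apply (f' z) = (\<lambda>(a, h). \<tau> z * a + g z \<bullet> h)" for z
  proof (intro ext, clarify)
    fix a :: real and h :: 'a
    have "(a, h) = a *\<^sub>R (1, 0) + (\<Sum>b\<in>Basis. (h \<bullet> b) *\<^sub>R (0, b))"
      by (simp add: prod_eq_iff fst_sum snd_sum euclidean_representation)
    then have "f' z (a, h) = a * \<tau> z + (\<Sum>b\<in>Basis. (h \<bullet> b) * f' z (0, b))"
      by (simp only: \<tau>_def blinfun.add_right blinfun.scaleR_right blinfun.sum_right real_scaleR_def)
    also have "(\<Sum>b\<in>Basis. (h \<bullet> b) * f' z (0, b)) = g z \<bullet> h"
      unfolding g_def inner_sum_left by (intro sum.cong refl) (simp add: inner_commute[of h] mult.commute)
    finally show "f' z (a, h) = \<tau> z * a + g z \<bullet> h" by (simp add: mult.commute)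
  qed
  have "smooth_test \<phi> \<tau> g" unfolding smooth_test_def
  proof (intro conjI ballI)
    show "continuous_on ?S \<tau>" unfolding \<tau>_def by (intro continuous_intros f')
    show "continuous_on ?S g" unfolding g_def by (intro continuous_intros f')
    fix z :: "real \<times> 'a" assume z: "z \<in> ?S"
    show "(\<phi> has_derivative (\<lambda>(a, h). \<tau> z * a + g z \<bullet> h)) (at z)"
      using f'(2)[OF z] at_within_open[OF z open_future] by (simp add: rep)
  qed
  then show thesis by (rule that)
qed

lemma smooth_test_time_deriv:
  assumes "smooth_test \<phi> \<tau> g" "0 < t"
  shows "time_deriv \<phi> t x = \<tau> (t, x)"
proof -
  have "((\<lambda>s. \<phi> (s, x)) has_derivative (\<lambda>a. (\<lambda>(a, h). \<tau> (t, x) * a + g (t, x) \<bullet> h) (a, 0))) (at t)"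
    by (rule has_derivative_compose[where f = "\<lambda>s. (s, x)", OF _ smooth_test_derivative[OF assms]])
       (auto intro!: derivative_eq_intros)
  then have "((\<lambda>s. \<phi> (s, x)) has_real_derivative \<tau> (t, x)) (at t)"
    by (simp add: has_field_derivative_def)
  then show ?thesis unfolding time_deriv_def by (rule DERIV_imp_deriv)
qed

lemma gradient_unique:
  assumes "GDERIV f x :> q"
  shows "gradient f x = q"
  unfolding gradient_def
proof (rule the_equality[where P = "\<lambda>q. GDERIV f x :> q"], rule assms)
  fix r assume "GDERIV f x :> r"
  then have "(\<lambda>h. h \<bullet> r) = (\<lambda>h. h \<bullet> q)"
    unfolding gderiv_def by (rule has_derivative_unique) (use assms in \<open>simp add: gderiv_def\<close>)
  then have "(r - q) \<bullet> r = (r - q) \<bullet> q" by (rule fun_cong)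
  then have "(r - q) \<bullet> (r - q) = 0" by (simp add: inner_diff_right)
  then show "r = q" by simp
qed

lemma smooth_test_gradient:
  assumes "smooth_test \<phi> \<tau> g" "0 < t"
  shows "gradient (\<lambda>y. \<phi> (t, y)) x = g (t, x)"
proof -
  have "((\<lambda>y. \<phi> (t, y)) has_derivative (\<lambda>h. (\<lambda>(a, h). \<tau> (t, x) * a + g (t, x) \<bullet> h) (0, h))) (at x)"
    by (rule has_derivative_compose[where f = "\<lambda>y. (t, y)", OF _ smooth_test_derivative[OF assms]])
       (auto intro!: derivative_eq_intros)
  then have "GDERIV (\<lambda>y. \<phi> (t, y)) x :> g (t, x)"
    by (simp add: gderiv_def inner_commute)
  then show ?thesis by (rule gradient_unique)
qed

lemma smooth_test_uminus:
  assumes "smooth_test \<phi> \<tau> g"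
  shows "smooth_test (\<lambda>z. - \<phi> z) (\<lambda>z. - \<tau> z) (\<lambda>z. - g z)"
  unfolding smooth_test_def
proof (intro conjI ballI)
  fix z :: "real \<times> 'a" assume "z \<in> {0<..} \<times> UNIV"
  then have "(\<phi> has_derivative (\<lambda>(a, h). \<tau> z * a + g z \<bullet> h)) (at z)"
    using assms unfolding smooth_test_def by blast
  from has_derivative_minus[OF this]
  show "((\<lambda>z. - \<phi> z) has_derivative (\<lambda>(a, h). - \<tau> z * a + (- g z) \<bullet> h)) (at z)"
    by (simp add: case_prod_unfold)
qed (use assms in \<open>auto simp: smooth_test_def intro!: continuous_intros\<close>)

lemma smooth_test_add:
  assumes "smooth_test \<phi> \<tau> g" "smooth_test \<phi>' \<tau>' g'"
  shows "smooth_test (\<lambda>z. \<phi> z + \<phi>' z) (\<lambda>z. \<tau> z + \<tau>' z) (\<lambda>z. g z + g' z)"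
  unfolding smooth_test_def
proof (intro conjI ballI)
  fix z :: "real \<times> 'a" assume "z \<in> {0<..} \<times> UNIV"
  then have "(\<phi> has_derivative (\<lambda>(a, h). \<tau> z * a + g z \<bullet> h)) (at z)"
    "(\<phi>' has_derivative (\<lambda>(a, h). \<tau>' z * a + g' z \<bullet> h)) (at z)"
    using assms unfolding smooth_test_def by blast+
  from has_derivative_add[OF this]
  show "((\<lambda>z. \<phi> z + \<phi>' z) has_derivative (\<lambda>(a, h). (\<tau> z + \<tau>' z) * a + (g z + g' z) \<bullet> h)) (at z)"
    by (simp add: case_prod_unfold algebra_simps inner_add_left)
qed (use assms in \<open>auto simp: smooth_test_def intro!: continuous_intros\<close>)

text \<open>
  Barriers and penalties are sums of a function of time and a function of space.
\<close>

lemma smooth_test_separated: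
  assumes a: "\<And>t. (a has_real_derivative a' t) (at t)" "continuous_on UNIV a'"
    and b: "\<And>x. GDERIV b x :> b' x" "continuous_on UNIV b'"
  shows "smooth_test (\<lambda>(t, x). a t + b x) (\<lambda>(t, x). a' t) (\<lambda>(t, x). b' x)"
  unfolding smooth_test_def
proof (intro conjI ballI)
  have "continuous_on ({0<..} \<times> UNIV) (\<lambda>z. a' (fst z))" "continuous_on ({0<..} \<times> UNIV) (\<lambda>z. b' (snd z))"
    by (auto intro!: continuous_on_compose2[OF a(2)] continuous_on_compose2[OF b(2)] continuous_intros)
  then show "continuous_on ({0<..} \<times> UNIV) (\<lambda>(t, x). a' t)"
    "continuous_on ({0<..} \<times> UNIV) (\<lambda>(t, x). b' x)"
    by (simp_all add: case_prod_unfold)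
  fix z :: "real \<times> 'a"
  obtain t x where z: "z = (t, x)" by (cases z)
  have "((\<lambda>z. a (fst z)) has_derivative (\<lambda>h. a' t * fst h)) (at z)"
    by (rule has_derivative_compose[of fst fst z UNIV a "\<lambda>h. a' t * h"])
       (use a(1)[of t] in \<open>auto intro!: derivative_eq_intros simp: has_field_derivative_def z\<close>)
  moreover have "((\<lambda>z. b (snd z)) has_derivative (\<lambda>h. snd h \<bullet> b' x)) (at z)"
    by (rule has_derivative_compose[of snd snd z UNIV b "\<lambda>h. h \<bullet> b' x"])
       (use b(1)[of x] in \<open>auto intro!: derivative_eq_intros simp: gderiv_def z\<close>)
  ultimately have "((\<lambda>z. a (fst z) + b (snd z)) has_derivative (\<lambda>h. a' t * fst h + snd h \<bullet> b' x)) (at z)"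
    by (rule has_derivative_add)
  then show "((\<lambda>(t, x). a t + b x) has_derivative
      (\<lambda>(c, h). (\<lambda>(t, x). a' t) z * c + (\<lambda>(t, x). b' x) z \<bullet> h)) (at z)"
    by (simp add: case_prod_unfold z inner_commute)
qed

lemma smooth_test_const: "smooth_test (\<lambda>_. c) (\<lambda>_. 0) (\<lambda>_. 0)"
  unfolding smooth_test_def by (auto intro!: continuous_intros derivative_eq_intros)

text \<open>
  \<open>c * sqrt ((norm (x - y))\<^sup>2 + b\<^sup>2)\<close> is a smooth substitute for the cone \<open>c * norm (x - y)\<close>: it lies
  above the cone, its slope is at most \<open>c\<close>, and at the tip it exceeds the cone by \<open>c * b\<close> only.
\<close>

lemma GDERIV_soft_norm:
  fixes x y :: "'a::euclidean_space"
  assumes "0 < b"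
  shows "GDERIV (\<lambda>x. c * sqrt ((norm (x - y))\<^sup>2 + b\<^sup>2)) x :>
     (c / sqrt ((norm (x - y))\<^sup>2 + b\<^sup>2)) *\<^sub>R (x - y)"
proof -
  have pos: "0 < (x - y) \<bullet> (x - y) + b\<^sup>2" using assms by (simp add: add_nonneg_pos)
  show ?thesis
    unfolding gderiv_def power2_norm_eq_inner
    using pos
    by (auto intro!: derivative_eq_intros simp: field_simps inner_commute inner_diff_left inner_diff_right)
qed

lemma continuous_soft_norm_gradient:
  fixes y :: "'a::euclidean_space"
  assumes "0 < b"
  shows "continuous_on UNIV (\<lambda>x. (c / sqrt ((norm (x - y))\<^sup>2 + b\<^sup>2)) *\<^sub>R (x - y))"
proof -
  have "(norm (x - y))\<^sup>2 + b\<^sup>2 \<noteq> 0" for x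
    using assms by (simp add: sum_power2_eq_zero_iff)
  then show ?thesis by (intro continuous_intros) auto
qed

lemma norm_soft_norm_gradient_le:
  fixes x y :: "'a::euclidean_space"
  assumes "0 < b" "0 \<le> c"
  shows "norm ((c / sqrt ((norm (x - y))\<^sup>2 + b\<^sup>2)) *\<^sub>R (x - y)) \<le> c"
proof -
  let ?r = "sqrt ((norm (x - y))\<^sup>2 + b\<^sup>2)"
  have r: "0 < ?r" "norm (x - y) \<le> ?r"
    using assms by (auto simp: real_le_rsqrt add_nonneg_pos)
  have "norm ((c / ?r) *\<^sub>R (x - y)) = c * (norm (x - y) / ?r)"
    using assms r by (simp del: real_sqrt_gt_0_iff add: abs_of_pos)
  also have "\<dots> \<le> c * 1"
    using r assms by (intro mult_left_mono) (auto simp: divide_le_eq)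
  finally show ?thesis by simp
qed

lemma GDERIV_quadratic:
  fixes x y :: "'a::euclidean_space"
  shows "GDERIV (\<lambda>x. c * (norm (x - y))\<^sup>2) x :> (2 * c) *\<^sub>R (x - y)"
  unfolding gderiv_def power2_norm_eq_inner
  by (auto intro!: derivative_eq_intros simp: inner_commute inner_diff_left inner_diff_right algebra_simps)

section \<open>Barriers for solutions with Lipschitz initial datum\<close>

lemma touches_from_aboveI:
  assumes "usc_env ({0..} \<times> X) u z = ereal (\<phi> z)" "open O'" "z \<in> O'"
    and "\<And>w. w \<in> O' \<Longrightarrow> w \<in> {0<..} \<times> X \<Longrightarrow> usc_env ({0..} \<times> X) u w \<le> ereal (\<phi> w)"
  shows "touches_from_above X \<phi> u z"
  unfolding touches_from_above_def eventually_at_filter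
  using assms eventually_nhds_in_open[OF assms(2,3)] by (auto elim: eventually_mono)

lemma real_env_between:
  assumes "usc_env D u z \<le> ereal b" "z \<in> D"
  shows "usc_env D u z = ereal (real_of_ereal (usc_env D u z))"
  using assms usc_env_upper[of z D u] by (cases "usc_env D u z") auto

lemma bounded_gap_usc_env:
  fixes X :: "'a::topological_space set"
  assumes gap: "bounded_gap X u0 u" and u0: "continuous_on X u0" and T: "0 < T"
  obtains B where "\<And>t x. 0 \<le> t \<Longrightarrow> t < T \<Longrightarrow> x \<in> X \<Longrightarrow>
    usc_env ({0..} \<times> X) u (t, x) \<le> ereal (u0 x + B)"
proof -
  obtain B where B: "\<forall>t\<in>{0..<T}. \<forall>x\<in>X. \<bar>u (t, x) - u0 x\<bar> \<le> B"
    using gap T unfolding bounded_gap_def by blast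
  show thesis
  proof (rule that)
    fix t x assume t: "0 \<le> t" "t < T" and x: "x \<in> X"
    have "\<forall>\<^sub>F w in nhds (t, x). w \<in> {..<T} \<times> (UNIV :: 'a set)"
      by (rule eventually_nhds_in_open) (use t in \<open>auto intro: open_Times\<close>)
    then have "\<forall>\<^sub>F w in nhds (t, x). w \<in> {0..} \<times> X \<longrightarrow> u w \<le> u0 (snd w) + B"
      by eventually_elim (use B in force)
    then have "usc_env ({0..} \<times> X) u (t, x) \<le> ereal ((\<lambda>w. u0 (snd w) + B) (t, x))"
      by (rule usc_env_le_of_bound[OF _ _ order_refl])
         (use t x in \<open>auto intro!: continuous_intros continuous_on_compose2[OF u0]\<close>)
    then show "usc_env ({0..} \<times> X) u (t, x) \<le> ereal (u0 x + B)" by simp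
  qed
qed

text \<open>
  For a fixed \<open>x1\<close>, the function \<open>u0 x1 + L * norm (x - x1) + C * t\<close> lies above \<open>u0\<close> at time \<open>0\<close>, has
  slope \<open>L\<close>, and equals the claimed bound at \<open>(t1, x1)\<close>.  It is compared with \<open>u\<close> after smoothing
  the cone and adding two penalties.  The term \<open>\<eta> * exp (k * (t - t1))\<close> makes the time derivative
  exceed \<open>C\<close>, and for large \<open>k\<close> it keeps a maximum point of the difference away from time
  \<open>t1 + 1\<close>.  The term with \<open>\<delta>\<close> keeps the maximum point in a bounded set and raises the slope by at
  most \<open>1\<close>.  The barrier is smooth on the whole space, so that the same argument
  serves the networks and \<open>\<real>\<^sup>d\<close>, and it yields a bound that is uniform in the mesh size.
\<close>

lemma barrier_above:
  fixes X :: "'a::euclidean_space set"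
  assumes X: "closed X" and lip: "L-lipschitz_on UNIV u0"
    and gap: "bounded_gap X u0 u"
    and init: "\<And>x. x \<in> X \<Longrightarrow> usc_env ({0..} \<times> X) u (0, x) \<le> ereal (u0 x)"
    and sub: "\<And>\<phi> \<tau> g t x. smooth_test \<phi> \<tau> g \<Longrightarrow> 0 < t \<Longrightarrow> x \<in> X \<Longrightarrow>
      touches_from_above X \<phi> u (t, x) \<Longrightarrow> norm (g (t, x)) \<le> L + 1 \<Longrightarrow> \<tau> (t, x) \<le> C"
    and t1: "0 \<le> t1" and x1: "x1 \<in> X"
  shows "usc_env ({0..} \<times> X) u (t1, x1) \<le> ereal (u0 x1 + C * t1)"
proof (rule ccontr)
  assume contra: "\<not> ?thesis"
  let ?D = "{0..} \<times> X"
  define U where "U z = real_of_ereal (usc_env ?D u z)" for z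
  have L: "0 \<le> L" using lip by (rule lipschitz_on_nonneg)
  have u0_le: "u0 x \<le> u0 y + L * norm (x - y)" for x y
    using lipschitz_onD[OF lip, of x y] by (auto simp: dist_norm)
  have u0_cont: "continuous_on X u0"
    using lipschitz_on_continuous_on[OF lip] continuous_on_subset by blast
  have U: "usc_env ?D u z = ereal (U z)" if zD: "z \<in> ?D" for z
  proof -
    obtain t x where z: "z = (t, x)" "0 \<le> t" "x \<in> X" using zD by (elim SigmaE) auto
    have "0 < t + 1" using z by simp
    from bounded_gap_usc_env[OF gap u0_cont this] obtain B
      where "\<And>s y. 0 \<le> s \<Longrightarrow> s < t + 1 \<Longrightarrow> y \<in> X \<Longrightarrow> usc_env ?D u (s, y) \<le> ereal (u0 y + B)"
      by blast
    from this[of t x] have "usc_env ?D u (t, x) \<le> ereal (u0 x + B)" using z by simp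
    from real_env_between[OF this] zD show ?thesis by (simp add: z U_def)
  qed
  obtain B0 where B0: "\<And>t x. 0 \<le> t \<Longrightarrow> t < t1 + 2 \<Longrightarrow> x \<in> X \<Longrightarrow> usc_env ?D u (t, x) \<le> ereal (u0 x + B0)"
  proof -
    have "0 < t1 + 2" using t1 by simp
    from bounded_gap_usc_env[OF gap u0_cont this] show thesis using that by blast
  qed
  have UB: "U (t, x) \<le> u0 x + B0" if "0 \<le> t" "t < t1 + 2" "x \<in> X" for t x
    using B0[OF that] U[of "(t, x)"] that by simp
  have Uinit: "U (0, x) \<le> u0 x" if "x \<in> X" for x
    using init[OF that] U[of "(0, x)"] that by simp
  \<comment> \<open>The three errors at \<open>(t1, x1)\<close>, from smoothing the cone and from the two penalties, amount to
     at most a quarter of the violation \<open>m\<close> each.\<close>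
  define m where "m = U (t1, x1) - (u0 x1 + C * t1)"
  have m: "0 < m" using contra U[of "(t1, x1)"] t1 x1 by (simp add: m_def)
  define b where "b = m / (4 * (L + 1))"
  have b: "0 < b" "L * b \<le> m / 4"
    using m L by (auto simp: b_def field_simps)
  define \<delta> where "\<delta> = min 1 (m / 4)"
  have \<delta>: "0 < \<delta>" "\<delta> \<le> 1" "\<delta> \<le> m / 4" using m by (auto simp: \<delta>_def)
  define \<eta> where "\<eta> = m / 4"
  have \<eta>: "0 < \<eta>" using m by (simp add: \<eta>_def)
  define B where "B = \<bar>B0\<bar> + \<bar>C\<bar> * (t1 + 1) + 1"
  have B: "0 < B" "B0 + \<bar>C\<bar> * (t1 + 1) < B" using t1 by (auto simp: B_def intro!: add_nonneg_pos)
  \<comment> \<open>Up to time \<open>t1 + 1\<close> the function \<open>U - u0 - C * t\<close> stays below \<open>B\<close>; \<open>k\<close> and \<open>R\<close> are such that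
     either penalty alone reaches \<open>B\<close> on the part of the boundary that it has to exclude.\<close>
  define k where "k = ln (B / \<eta> + 1)"
  have k: "0 < k" "\<eta> * exp k = B + \<eta>"
    using B \<eta> by (auto simp: k_def add_pos_pos field_simps)
  define R where "R = B / \<delta>"
  have R: "0 < R" "\<delta> * R = B" using B \<delta> by (auto simp: R_def)
  have Ct: "- (C * t) \<le> \<bar>C\<bar> * (t1 + 1)" if "0 \<le> t" "t \<le> t1 + 1" for t
  proof -
    have "(- C) * t \<le> \<bar>C\<bar> * t" using that by (intro mult_right_mono) auto
    then have "- (C * t) \<le> \<bar>C\<bar> * t" by simp
    also have "\<dots> \<le> \<bar>C\<bar> * (t1 + 1)" using that by (intro mult_left_mono) auto
    finally show ?thesis .
  qed
  define sn where "sn c x = sqrt ((norm (x - x1))\<^sup>2 + c\<^sup>2)" for c :: real and x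
  have sn: "norm (x - x1) \<le> sn c x" "0 \<le> sn c x" for c x
    by (auto simp: sn_def real_le_rsqrt)
  define \<phi> where "\<phi> c = (\<lambda>(t, x). (C * t + \<eta> * exp (k * (t - t1)) + (u0 x1 + c)) + (L * sn b x + \<delta> * sn 1 x))"
    for c :: real
  define \<tau> where "\<tau> = (\<lambda>(t, x :: 'a). C + \<eta> * k * exp (k * (t - t1)))"
  define g where "g = (\<lambda>(t :: real, x). (L / sn b x) *\<^sub>R (x - x1) + (\<delta> / sn 1 x) *\<^sub>R (x - x1))"
  have smooth: "smooth_test (\<phi> c) \<tau> g" for c
    unfolding \<phi>_def \<tau>_def g_def
  proof (rule smooth_test_separated)
    show "GDERIV (\<lambda>x. L * sn b x + \<delta> * sn 1 x) x :>
      (L / sn b x) *\<^sub>R (x - x1) + (\<delta> / sn 1 x) *\<^sub>R (x - x1)" for x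
      unfolding sn_def by (intro GDERIV_add GDERIV_soft_norm) (use b in auto)
    show "continuous_on UNIV (\<lambda>x. (L / sn b x) *\<^sub>R (x - x1) + (\<delta> / sn 1 x) *\<^sub>R (x - x1))"
      unfolding sn_def by (intro continuous_on_add continuous_soft_norm_gradient) (use b in auto)
  qed (auto intro!: derivative_eq_intros continuous_intros)
  let ?Q = "{0..t1 + 1} \<times> (X \<inter> cball x1 R)"
  have compact_Q: "compact ?Q"
    using X by (intro compact_Times compact_Icc closed_Int_compact compact_cball)
  have base: "(t1, x1) \<in> ?Q" using t1 x1 R by auto
  have usc_f: "usc_on ?Q (\<lambda>z. U z + - \<phi> 0 z)"
  proof (rule usc_on_add[OF _ usc_on_continuous])
    show "usc_on ?Q U" by (rule usc_on_env[where E = ?D and u = u]) (use U in auto)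
    have "continuous_on ?Q (\<lambda>z. - ((C * fst z + \<eta> * exp (k * (fst z - t1)) + (u0 x1 + 0)) + (L * sn b (snd z) + \<delta> * sn 1 (snd z))))"
      unfolding sn_def by (intro continuous_intros)
    then show "continuous_on ?Q (\<lambda>z. - \<phi> 0 z)" unfolding \<phi>_def by (simp add: case_prod_unfold)
  qed
  have "?Q \<noteq> {}" using base by (rule ex_in_conv[THEN iffD1, OF exI])
  from usc_on_attains_max[OF compact_Q this usc_f]
  obtain z where z: "z \<in> ?Q" "\<And>w. w \<in> ?Q \<Longrightarrow> U w + - \<phi> 0 w \<le> U z + - \<phi> 0 z"
    by (elim bexE) (rule that, assumption, erule bspec, assumption)
  obtain t x where zt: "z = (t, x)" by (cases z)
  have tx: "0 \<le> t" "t \<le> t1 + 1" "x \<in> X" "norm (x - x1) \<le> R"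
    using z(1) by (auto simp: zt dist_norm norm_minus_commute)
  have "U (t1, x1) - \<phi> 0 (t1, x1) = m - \<eta> - L * b - \<delta>"
    using b by (simp add: \<phi>_def m_def sn_def)
  with z(2)[OF base] b \<delta> m have max_pos: "0 < U z - \<phi> 0 z" by (simp add: \<eta>_def)
  have \<phi>_ge: "\<phi> 0 (t, x) \<ge> C * t + \<eta> * exp (k * (t - t1)) + u0 x + \<delta> * norm (x - x1)"
  proof -
    have "L * norm (x - x1) \<le> L * sn b x" "\<delta> * norm (x - x1) \<le> \<delta> * sn 1 x"
      using sn L \<delta> by (auto intro: mult_left_mono)
    then show ?thesis using u0_le[of x x1] by (simp add: \<phi>_def)
  qed
  have upper: "C * t + \<eta> * exp (k * (t - t1)) + \<delta> * norm (x - x1) < U (t, x) - u0 x"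
    using \<phi>_ge max_pos by (simp add: zt)
  have exp_pos: "0 < \<eta> * exp (k * (t - t1))" and norm_pos: "0 \<le> \<delta> * norm (x - x1)"
    using \<eta> \<delta> by auto
  have "t \<noteq> 0" using upper exp_pos norm_pos Uinit[OF tx(3)] by auto
  with tx have t: "0 < t" by simp
  have UB': "U (t, x) - u0 x - C * t < B"
    using UB[of t x] Ct[of t] tx B by auto
  have "t \<noteq> t1 + 1"
  proof
    assume "t = t1 + 1"
    then have "\<eta> * exp (k * (t - t1)) = B + \<eta>" using k by simp
    with upper norm_pos UB' \<eta> show False by linarith
  qed
  with tx have t': "t < t1 + 1" by simp
  have "norm (x - x1) < R"
  proof -
    have "\<delta> * norm (x - x1) < \<delta> * R" using upper exp_pos UB' R by linarith
    then show ?thesis using \<delta> by simp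
  qed
  then have z_in: "z \<in> {0<..<t1 + 1} \<times> ball x1 R"
    using t t' by (auto simp: zt dist_norm norm_minus_commute)
  have "touches_from_above X (\<phi> (U z - \<phi> 0 z)) u z"
  proof (rule touches_from_aboveI[of _ _ _ _ "{0<..<t1 + 1} \<times> ball x1 R"])
    show "usc_env ?D u z = ereal (\<phi> (U z - \<phi> 0 z) z)"
      using U[of z] tx by (simp add: zt \<phi>_def)
    fix w assume w: "w \<in> {0<..<t1 + 1} \<times> ball x1 R" "w \<in> {0<..} \<times> X"
    then have "w \<in> ?Q" by auto
    from z(2)[OF this] have "U w \<le> \<phi> (U z - \<phi> 0 z) w" by (simp add: \<phi>_def case_prod_unfold)
    then show "usc_env ?D u w \<le> ereal (\<phi> (U z - \<phi> 0 z) w)" using U[of w] w by auto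
  qed (use z_in in \<open>auto intro: open_Times\<close>)
  then have "touches_from_above X (\<phi> (U z - \<phi> 0 z)) u (t, x)" by (simp add: zt)
  moreover have "norm (g (t, x)) \<le> L + 1"
    unfolding g_def prod.case sn_def
    by (rule norm_triangle_le, rule add_mono)
       (use b L \<delta> norm_soft_norm_gradient_le[of b L x x1] norm_soft_norm_gradient_le[of 1 \<delta> x x1] in auto)
  ultimately have "\<tau> (t, x) \<le> C" by (rule sub[OF smooth t tx(3)])
  moreover have "0 < \<eta> * k * exp (k * (t - t1))" using \<eta> k by simp
  ultimately show False by (simp add: \<tau>_def)
qed

lemma barrier_below:
  fixes X :: "'a::euclidean_space set"
  assumes X: "closed X" and lip: "L-lipschitz_on UNIV u0"
    and gap: "bounded_gap X u0 u"
    and init: "\<And>x. x \<in> X \<Longrightarrow> ereal (u0 x) \<le> lsc_env ({0..} \<times> X) u (0, x)"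
    and super: "\<And>\<phi> \<tau> g t x. smooth_test \<phi> \<tau> g \<Longrightarrow> 0 < t \<Longrightarrow> x \<in> X \<Longrightarrow>
      touches_from_below X \<phi> u (t, x) \<Longrightarrow> norm (g (t, x)) \<le> L + 1 \<Longrightarrow> - C \<le> \<tau> (t, x)"
    and t1: "0 \<le> t1" and x1: "x1 \<in> X"
  shows "ereal (u0 x1 - C * t1) \<le> lsc_env ({0..} \<times> X) u (t1, x1)"
proof -
  have "usc_env ({0..} \<times> X) (\<lambda>w. - u w) (t1, x1) \<le> ereal (- u0 x1 + C * t1)"
  proof (rule barrier_above[OF X _ _ _ _ t1 x1])
    show "L-lipschitz_on UNIV (\<lambda>x. - u0 x)"
      using lip by (simp add: lipschitz_on_minus)
    show "bounded_gap X (\<lambda>x. - u0 x) (\<lambda>w. - u w)"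
      using gap unfolding bounded_gap_def by (simp add: abs_minus_commute)
    show "usc_env ({0..} \<times> X) (\<lambda>w. - u w) (0, x) \<le> ereal (- u0 x)" if "x \<in> X" for x
      using init[OF that] by (simp add: usc_env_uminus flip: uminus_ereal.simps(1))
    fix \<phi> \<tau> g t x assume *: "smooth_test \<phi> \<tau> g" "0 < t" "x \<in> X"
      "touches_from_above X \<phi> (\<lambda>w. - u w) (t, x)" "norm (g (t, x)) \<le> L + 1"
    from super[OF smooth_test_uminus[OF *(1)] *(2,3)] *(4,5)
    show "\<tau> (t, x) \<le> C" by (simp add: touches_from_above_uminus)
  qed
  then show ?thesis
    by (simp add: usc_env_uminus ereal_uminus_le_reorder)
qed

section \<open>Comparison principle in the whole space\<close>

lemma space_subsolutionD:
  assumes "space_subsolution Hbar v" "smooth_test \<phi> \<tau> g" "0 < t" "touches_from_above UNIV \<phi> v (t, x)"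
  shows "\<tau> (t, x) + Hbar (g (t, x)) \<le> 0"
proof -
  have "C1_on ({0<..} \<times> UNIV) \<phi> \<and> 0 < t \<and> touches_from_above UNIV \<phi> v (t, x)"
    using assms(3,4) smooth_test_C1_on[OF assms(2)] by simp
  with assms(1)[unfolded space_subsolution_def, rule_format]
  have "time_deriv \<phi> t x + Hbar (gradient (\<lambda>y. \<phi> (t, y)) x) \<le> 0" by blast
  then show ?thesis
    by (simp add: smooth_test_time_deriv[OF assms(2,3)] smooth_test_gradient[OF assms(2,3)])
qed

lemma space_supersolutionD:
  assumes "space_supersolution Hbar v" "smooth_test \<phi> \<tau> g" "0 < t" "touches_from_below UNIV \<phi> v (t, x)"
  shows "0 \<le> \<tau> (t, x) + Hbar (g (t, x))"
proof -
  have "C1_on ({0<..} \<times> UNIV) \<phi> \<and> 0 < t \<and> touches_from_below UNIV \<phi> v (t, x)"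
    using assms(3,4) smooth_test_C1_on[OF assms(2)] by simp
  with assms(1)[unfolded space_supersolution_def, rule_format]
  have "time_deriv \<phi> t x + Hbar (gradient (\<lambda>y. \<phi> (t, y)) x) \<ge> 0" by blast
  then show ?thesis
    by (simp add: smooth_test_time_deriv[OF assms(2,3)] smooth_test_gradient[OF assms(2,3)])
qed

text \<open>
  With \<open>r\<^sup>2 / (2 * \<alpha>)\<close> as penalty this means that half of the penalty absorbs a linear term \<open>c * r\<close>
  at the expense of \<open>\<alpha> * c\<^sup>2\<close>, while the other half remains to control \<open>r\<close>.
\<close>

lemma young_quarter:
  fixes \<alpha> :: real
  assumes "0 < \<alpha>"
  shows "c * r \<le> \<alpha> * c\<^sup>2 + r\<^sup>2 / (4 * \<alpha>)"
proof -
  have "0 \<le> (2 * \<alpha> * c - r)\<^sup>2 / (4 * \<alpha>)" using assms by simp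
  also have "\<dots> = \<alpha> * c\<^sup>2 + r\<^sup>2 / (4 * \<alpha>) - c * r"
    using assms by (simp add: field_simps power2_eq_square)
  finally show ?thesis by simp
qed

text \<open>
  Doubling of variables.  If \<open>v\<close> exceeds \<open>w\<close> by \<open>m > 0\<close> at \<open>(t1, x1)\<close>, one maximizes
  \<open>v (t, x) - w (s, y)\<close> minus the penalty \<open>((t - s)\<^sup>2 + (norm (x - y))\<^sup>2) / (2 * \<alpha>)\<close> and minus two
  terms in \<open>(t, x)\<close> as in the barriers above.  The parameter \<open>\<alpha>\<close> is chosen first, depending on \<open>m\<close>,
  \<open>L\<close> and \<open>C\<close> only.  The bounds \<open>v \<le> u0 + C * t\<close> and \<open>w \<ge> u0 - C * t\<close> then force
  positive times at the maximum point, and the slope \<open>(x - y) / \<alpha>\<close> remains in a ball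
  that does not depend on \<open>\<delta>\<close>.  As \<open>Hbar\<close> is uniformly continuous there, a small \<open>\<delta>\<close> makes the two
  viscosity inequalities contradict each other.
\<close>

lemma comparison_principle:
  fixes v w :: "real \<times> 'a::euclidean_space \<Rightarrow> real"
  assumes Hbar: "continuous_on UNIV Hbar"
    and sub: "space_subsolution Hbar v" and super: "space_supersolution Hbar w"
    and lip: "L-lipschitz_on UNIV u0"
    and v_le: "\<And>t x. 0 \<le> t \<Longrightarrow> usc_env ({0..} \<times> UNIV) v (t, x) \<le> ereal (u0 x + C * t)"
    and w_ge: "\<And>t x. 0 \<le> t \<Longrightarrow> ereal (u0 x - C * t) \<le> lsc_env ({0..} \<times> UNIV) w (t, x)"
    and t1: "0 \<le> t1"
  shows "v (t1, x1) \<le> w (t1, x1)"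
proof (rule ccontr)
  assume contra: "\<not> ?thesis"
  let ?D = "{0..} \<times> (UNIV :: 'a set)"
  define V where "V z = real_of_ereal (usc_env ?D v z)" for z
  define N where "N z = real_of_ereal (usc_env ?D (\<lambda>z. - w z) z)" for z
  define c where "c = \<bar>C\<bar> + 1"
  define l where "l = L + 1"
  have L: "0 \<le> L" using lip by (rule lipschitz_on_nonneg)
  have c: "0 < c" and l: "0 < l" using L by (auto simp: c_def l_def)
  have w_ge': "usc_env ?D (\<lambda>z. - w z) (t, x) \<le> ereal (- u0 x + C * t)" if "0 \<le> t" for t x
    using w_ge[OF that, of x] by (simp add: usc_env_uminus flip: uminus_ereal.simps(1))
      (metis ereal_minus_le_minus minus_diff_eq uminus_add_conv_diff uminus_ereal.simps(1))
  have V: "usc_env ?D v z = ereal (V z)" if "z \<in> ?D" for z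
    using that v_le[of "fst z" "snd z"] real_env_between[of ?D v z] by (auto simp: V_def)
  have N: "usc_env ?D (\<lambda>z. - w z) z = ereal (N z)" if "z \<in> ?D" for z
    using that w_ge'[of "fst z" "snd z"] real_env_between[of ?D "\<lambda>z. - w z" z] by (auto simp: N_def)
  have Ct: "C * t \<le> c * t" if "0 \<le> t" for t
    using that by (intro mult_right_mono) (auto simp: c_def)
  have V_le: "V (t, x) \<le> u0 x + c * t" if "0 \<le> t" for t x
    using v_le[OF that, of x] V[of "(t, x)"] Ct[OF that] that by simp
  have N_le: "N (t, x) \<le> - u0 x + c * t" if "0 \<le> t" for t x
    using w_ge'[OF that, of x] N[of "(t, x)"] Ct[OF that] that by simp
  have lip': "u0 x - u0 y \<le> l * norm (x - y)" for x y
  proof -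
    have "u0 x - u0 y \<le> L * norm (x - y)"
      using lipschitz_onD[OF lip, of x y] by (auto simp: dist_norm)
    also have "\<dots> \<le> l * norm (x - y)" by (intro mult_right_mono) (auto simp: l_def)
    finally show ?thesis .
  qed
  define m where "m = V (t1, x1) + N (t1, x1)"
  have m: "0 < m"
    using contra usc_env_upper[of "(t1, x1)" ?D v] usc_env_upper[of "(t1, x1)" ?D "\<lambda>z. - w z"]
      V[of "(t1, x1)"] N[of "(t1, x1)"] t1 by (simp add: m_def)
  define \<alpha> where "\<alpha> = m / (4 * (l\<^sup>2 + c\<^sup>2))"
  have \<alpha>: "0 < \<alpha>" "\<alpha> * l\<^sup>2 + \<alpha> * c\<^sup>2 = m / 4"
  proof -
    have "0 < l\<^sup>2 + c\<^sup>2" using l c by (simp add: add_pos_pos)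
    then show "0 < \<alpha>" using m by (simp add: \<alpha>_def)
    have "m / (4 * S) * S = m / 4" if "0 < S" for S :: real using that by simp
    from this[OF \<open>0 < l\<^sup>2 + c\<^sup>2\<close>] have "\<alpha> * (l\<^sup>2 + c\<^sup>2) = m / 4" unfolding \<alpha>_def .
    then show "\<alpha> * l\<^sup>2 + \<alpha> * c\<^sup>2 = m / 4" by (simp add: distrib_left)
  qed
  define T where "T = t1 + 1"
  have T: "0 < T" using t1 by (simp add: T_def)
  define \<eta> where "\<eta> = m / 4"
  have \<eta>: "0 < \<eta>" using m by (simp add: \<eta>_def)
  define k where "k = ln (2 * c * T / \<eta> + 1)"
  have k: "0 < k" "\<eta> * exp k = 2 * c * T + \<eta>"
    using c T \<eta> by (auto simp: k_def add_pos_pos field_simps)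
  define \<rho> where "\<rho> = sqrt (8 * \<alpha> * c * T)"
  have \<rho>: "0 < \<rho>" "\<rho>\<^sup>2 = 8 * \<alpha> * c * T" using \<alpha> c T by (auto simp: \<rho>_def)
  \<comment> \<open>\<open>\<kappa>\<close> bounds the time derivative of the exponential penalty from below for all \<open>t \<ge> 0\<close>; it is
     the strictness that the oscillation of \<open>Hbar\<close> has to stay under.\<close>
  define \<kappa> where "\<kappa> = \<eta> * k * exp (- k * t1)"
  have \<kappa>: "0 < \<kappa>" using \<eta> k by (simp add: \<kappa>_def)
  have "uniformly_continuous_on (cball 0 (\<rho> / \<alpha> + 1)) Hbar"
    using Hbar continuous_on_subset by (intro compact_uniformly_continuous) auto
  then obtain d where d: "0 < d" "\<And>p q. p \<in> cball 0 (\<rho> / \<alpha> + 1) \<Longrightarrow> q \<in> cball 0 (\<rho> / \<alpha> + 1) \<Longrightarrow>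
      dist q p < d \<Longrightarrow> dist (Hbar q) (Hbar p) < \<kappa>"
    using \<kappa> unfolding uniformly_continuous_on_def by metis
  define bn where "bn x = sqrt ((norm (x - 0))\<^sup>2 + 1\<^sup>2)" for x :: 'a
  have bn: "norm x \<le> bn x" "0 < bn x" for x
    by (auto simp: bn_def real_le_rsqrt add_nonneg_pos)
  define \<delta> where "\<delta> = min (min 1 (d / 2)) (m / (4 * bn x1))"
  have \<delta>: "0 < \<delta>" "\<delta> \<le> 1" "\<delta> < d" "\<delta> * bn x1 \<le> m / 4"
  proof -
    show "0 < \<delta>" "\<delta> \<le> 1" "\<delta> < d" using m d bn by (auto simp: \<delta>_def)
    have "\<delta> \<le> m / (4 * bn x1)" by (simp add: \<delta>_def)
    then show "\<delta> * bn x1 \<le> m / 4" using bn[of x1] by (simp add: field_simps)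
  qed
  define R where "R = 2 * c * T / \<delta> + 1 + norm x1"
  have R: "0 < R" using c T \<delta> by (auto simp: R_def intro!: add_pos_nonneg)
  define q where "q t x s y = ((t - s)\<^sup>2 + (norm (x - y))\<^sup>2) / (2 * \<alpha>)" for t s :: real and x y :: 'a
  have q_split: "q t x s y = (1 / (2 * \<alpha>)) * (t - s)\<^sup>2 + (1 / (2 * \<alpha>)) * (norm (x - y))\<^sup>2" for t x s y
    by (simp add: q_def add_divide_distrib)
  define E where "E t = \<eta> * exp (k * (t - t1))" for t
  have E: "0 < E t" for t using \<eta> by (simp add: E_def)
  define f where "f = (\<lambda>((t, x), (s, y)). V (t, x) + N (s, y) - (q t x s y + E t + \<delta> * bn x))"
  have base: "m / 2 \<le> f ((t1, x1), (t1, x1))"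
  proof -
    have "f ((t1, x1), (t1, x1)) = m - (\<eta> + \<delta> * bn x1)"
      by (simp add: f_def q_def E_def m_def)
    then show ?thesis using \<delta>(4) unfolding \<eta>_def by linarith
  qed
  \<comment> \<open>Where the doubled function is at least half of \<open>m\<close>, all variables are in the interior of the
     box over which it is maximized.\<close>
  have key: "0 < t \<and> t < T \<and> 0 < s \<and> s < T + \<rho> + 1 \<and> norm x < R \<and> norm y < R + \<rho> + 1 \<and> norm (x - y) \<le> \<rho>"
    if f: "m / 2 \<le> f ((t, x), (s, y))" and t: "0 \<le> t" "t \<le> T" and s: "0 \<le> s" for t x s y
  proof -
    define r z where "r = norm (x - y)" and "z = \<bar>t - s\<bar>"
    have q: "q t x s y = z\<^sup>2 / (2 * \<alpha>) + r\<^sup>2 / (2 * \<alpha>)"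
      by (simp add: q_def z_def r_def add_divide_distrib)
    have half: "a / (2 * \<alpha>) = a / (4 * \<alpha>) + a / (4 * \<alpha>)" for a
      using \<alpha> by (simp add: field_simps)
    have "V (t, x) + N (s, y) \<le> l * r + c * (t + s)"
      using V_le[OF t(1), of x] N_le[OF s, of y] lip'[of x y] by (simp add: r_def distrib_left)
    then have 1: "m / 4 + (z\<^sup>2 / (4 * \<alpha>) + r\<^sup>2 / (4 * \<alpha>)) + E t + \<delta> * bn x \<le> c * (t + s) - c * z"
    proof -
      have "m / 2 \<le> V (t, x) + N (s, y) - (q t x s y + E t + \<delta> * bn x)"
        using f by (simp only: f_def prod.case)
      moreover have "c * z \<le> \<alpha> * c\<^sup>2 + z\<^sup>2 / (4 * \<alpha>)" "l * r \<le> \<alpha> * l\<^sup>2 + r\<^sup>2 / (4 * \<alpha>)"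
        by (rule young_quarter[OF \<alpha>(1)])+
      ultimately show ?thesis
        using \<open>V (t, x) + N (s, y) \<le> l * r + c * (t + s)\<close> \<alpha>(2) half[of "z\<^sup>2"] half[of "r\<^sup>2"]
        unfolding q by linarith
    qed
    have 2: "c * (t + s) - c * z \<le> 2 * c * t" "c * (t + s) - c * z \<le> 2 * c * s"
    proof -
      have "c * (t + s - z) \<le> c * (2 * t)" "c * (t + s - z) \<le> c * (2 * s)"
        using c by (auto intro!: mult_left_mono simp: z_def)
      then show "c * (t + s) - c * z \<le> 2 * c * t" "c * (t + s) - c * z \<le> 2 * c * s"
        by (auto simp: algebra_simps)
    qed
    have pos: "0 \<le> z\<^sup>2 / (4 * \<alpha>)" "0 \<le> r\<^sup>2 / (4 * \<alpha>)" "0 < \<delta> * bn x"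
      using \<alpha> \<delta> bn[of x] by auto
    have "0 < c * t" "0 < c * s" using 1 2 pos E[of t] m by linarith+
    then have "0 < t" "0 < s" using c by (auto simp: zero_less_mult_iff)
    have cT: "2 * c * t \<le> 2 * c * T" using t c by simp
    have "t \<noteq> T"
    proof
      assume "t = T"
      then have "E t = 2 * c * T + \<eta>" using k by (simp add: E_def T_def)
      then show False using 1 2 pos m \<eta> cT by linarith
    qed
    have "z\<^sup>2 / (4 * \<alpha>) \<le> 2 * c * T" "r\<^sup>2 / (4 * \<alpha>) \<le> 2 * c * T" "\<delta> * bn x < 2 * c * T"
      using 1 2 pos E[of t] m cT by linarith+
    then have "z\<^sup>2 \<le> \<rho>\<^sup>2" "r\<^sup>2 \<le> \<rho>\<^sup>2" using \<alpha> by (auto simp: \<rho> field_simps)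
    then have z: "z \<le> \<rho>" and r: "r \<le> \<rho>"
      using \<rho>(1) by (auto intro: power2_le_imp_le)
    have "norm x < R"
    proof -
      have "bn x < 2 * c * T / \<delta>" using \<open>\<delta> * bn x < 2 * c * T\<close> \<delta> by (simp add: field_simps)
      also have "\<dots> \<le> R" by (simp add: R_def)
      finally show ?thesis using bn(1)[of x] by linarith
    qed
    moreover have "norm y \<le> norm x + r"
      unfolding r_def using norm_triangle_ineq2[of y x] by (simp add: norm_minus_commute)
    ultimately show ?thesis
      using \<open>0 < t\<close> \<open>0 < s\<close> \<open>t \<noteq> T\<close> t z r \<rho>(1) by (auto simp: z_def r_def)
  qed
  define Q1 where "Q1 = {0..T} \<times> cball (0 :: 'a) R"
  define Q2 where "Q2 = {0..T + \<rho> + 1} \<times> cball (0 :: 'a) (R + \<rho> + 1)"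
  define W1 where "W1 = {0<..<T} \<times> ball (0 :: 'a) R"
  define W2 where "W2 = {0<..<T + \<rho> + 1} \<times> ball (0 :: 'a) (R + \<rho> + 1)"
  have W: "open W1" "open W2" "W1 \<subseteq> Q1" "W2 \<subseteq> Q2"
    by (auto simp: W1_def W2_def Q1_def Q2_def intro!: open_Times)
  have "compact (Q1 \<times> Q2)"
    unfolding Q1_def Q2_def by (intro compact_Times compact_Icc compact_cball)
  note compact_Q = this
  have in_Q: "((t1, x1), (t1, x1)) \<in> Q1 \<times> Q2"
  proof -
    have "norm x1 \<le> R" using c T \<delta> by (simp add: R_def)
    then show ?thesis using t1 \<rho> by (auto simp: Q1_def Q2_def T_def)
  qed
  have usc_f: "usc_on (Q1 \<times> Q2) f"
  proof -
    have "usc_on Q1 V" by (rule usc_on_env[where E = ?D and u = v]) (use V in \<open>auto simp: Q1_def\<close>)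
    then have 1: "usc_on (Q1 \<times> Q2) (\<lambda>z. V (fst z))"
      by (rule usc_on_compose) (auto intro: continuous_intros)
    have "usc_on Q2 N" by (rule usc_on_env[where E = ?D and u = "\<lambda>z. - w z"]) (use N in \<open>auto simp: Q2_def\<close>)
    then have 2: "usc_on (Q1 \<times> Q2) (\<lambda>z. N (snd z))"
      by (rule usc_on_compose) (auto intro: continuous_intros)
    have 3: "continuous_on (Q1 \<times> Q2) (\<lambda>z. - (q (fst (fst z)) (snd (fst z)) (fst (snd z)) (snd (snd z))
        + E (fst (fst z)) + \<delta> * bn (snd (fst z))))"
      unfolding q_def E_def bn_def by (intro continuous_intros) (use \<alpha> in auto)
    have "usc_on (Q1 \<times> Q2) (\<lambda>z. (V (fst z) + N (snd z)) + - (q (fst (fst z)) (snd (fst z)) (fst (snd z)) (snd (snd z))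
        + E (fst (fst z)) + \<delta> * bn (snd (fst z))))"
      by (intro usc_on_add 1 2 usc_on_continuous 3)
    then show ?thesis by (simp only: f_def case_prod_unfold diff_conv_add_uminus prod.collapse)
  qed
  have "Q1 \<times> Q2 \<noteq> {}" using in_Q by (rule ex_in_conv[THEN iffD1, OF exI])
  from usc_on_attains_max[OF compact_Q this usc_f]
  obtain zz where zz: "zz \<in> Q1 \<times> Q2" "\<And>z. z \<in> Q1 \<times> Q2 \<Longrightarrow> f z \<le> f zz"
    by (elim bexE) (rule that, assumption, erule bspec, assumption)
  obtain t x s y where zz_eq: "zz = ((t, x), (s, y))" 
    by (rule that[of "fst (fst zz)" "snd (fst zz)" "fst (snd zz)" "snd (snd zz)"]) simp
  have f_max: "m / 2 \<le> f ((t, x), (s, y))"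
    using zz(2)[OF in_Q] base by (simp add: zz_eq)
  have txsy: "0 < t" "t < T" "0 < s" "s < T + \<rho> + 1" "norm x < R" "norm y < R + \<rho> + 1" "norm (x - y) \<le> \<rho>"
    using key[OF f_max] zz(1) by (auto simp: zz_eq Q1_def Q2_def)
  define M where "M = f ((t, x), (s, y))"
  have in_W: "(t, x) \<in> W1" "(s, y) \<in> W2" using txsy by (auto simp: W1_def W2_def)
  let ?p = "(1 / \<alpha>) *\<^sub>R (x - y)"
  have norm_p: "norm ?p \<le> \<rho> / \<alpha>" using txsy \<alpha> by (simp add: divide_right_mono)
  have sub_ineq: "(t - s) / \<alpha> + k * E t + Hbar (?p + (\<delta> / bn x) *\<^sub>R x) \<le> 0"
  proof -
    define \<phi> where "\<phi> = (\<lambda>(t, x). ((1 / (2 * \<alpha>)) * (t - s)\<^sup>2 + E t + (M - N (s, y))) +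
      ((1 / (2 * \<alpha>)) * (norm (x - y))\<^sup>2 + \<delta> * bn x))"
    define \<tau> where "\<tau> = (\<lambda>(t, x :: 'a). (t - s) / \<alpha> + k * E t)"
    define g where "g = (\<lambda>(t :: real, x). (2 * (1 / (2 * \<alpha>))) *\<^sub>R (x - y) + (\<delta> / bn x) *\<^sub>R (x - 0))"
    have "smooth_test \<phi> \<tau> g"
      unfolding \<phi>_def \<tau>_def g_def
    proof (rule smooth_test_separated)
      show "GDERIV (\<lambda>x. (1 / (2 * \<alpha>)) * (norm (x - y))\<^sup>2 + \<delta> * bn x) x :>
        (2 * (1 / (2 * \<alpha>))) *\<^sub>R (x - y) + (\<delta> / bn x) *\<^sub>R (x - 0)" for x
        unfolding bn_def by (intro GDERIV_add GDERIV_soft_norm GDERIV_quadratic) auto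
      show "continuous_on UNIV (\<lambda>x. (2 * (1 / (2 * \<alpha>))) *\<^sub>R (x - y) + (\<delta> / bn x) *\<^sub>R (x - 0))"
        unfolding bn_def by (intro continuous_on_add continuous_soft_norm_gradient) (auto intro!: continuous_intros)
    qed (use \<alpha>(1) in \<open>auto intro!: derivative_eq_intros continuous_intros
        simp: E_def diff_divide_distrib\<close>)
    moreover have "touches_from_above UNIV \<phi> v (t, x)"
    proof (rule touches_from_aboveI[OF _ W(1) in_W(1)])
      have f_eq: "\<phi> z = V z + (M - f (z, (s, y)))" for z
      proof -
        obtain t' x' where z: "z = (t', x')" by (cases z)
        show ?thesis unfolding z by (simp only: f_def \<phi>_def prod.case q_split)
      qed
      have "V (t, x) = \<phi> (t, x)" by (simp only: f_eq M_def)
      then show "usc_env ?D v (t, x) = ereal (\<phi> (t, x))" using V[of "(t, x)"] txsy by simp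
      fix z assume z: "z \<in> W1" "z \<in> {0<..} \<times> UNIV"
      have "f (z, (s, y)) \<le> M"
        using zz(2)[of "(z, (s, y))"] z in_W W unfolding M_def zz_eq by auto
      then show "usc_env ?D v z \<le> ereal (\<phi> z)" using V[of z] z f_eq by auto
    qed
    ultimately have "\<tau> (t, x) + Hbar (g (t, x)) \<le> 0"
      using space_subsolutionD[OF sub _ txsy(1)] by blast
    then show ?thesis by (simp add: \<tau>_def g_def)
  qed
  have super_ineq: "0 \<le> (t - s) / \<alpha> + Hbar ?p"
  proof -
    define \<phi> where "\<phi> = (\<lambda>(s, y). ((1 / (2 * \<alpha>)) * (s - t)\<^sup>2 + (M - V (t, x) + E t + \<delta> * bn x)) +
      ((1 / (2 * \<alpha>)) * (norm (y - x))\<^sup>2))"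
    define \<tau> where "\<tau> = (\<lambda>(s, y :: 'a). (s - t) / \<alpha>)"
    define g where "g = (\<lambda>(s :: real, y). (2 * (1 / (2 * \<alpha>))) *\<^sub>R (y - x))"
    have "smooth_test \<phi> \<tau> g"
      unfolding \<phi>_def \<tau>_def g_def
      by (rule smooth_test_separated[OF _ _ GDERIV_quadratic])
         (use \<alpha>(1) in \<open>auto intro!: derivative_eq_intros continuous_intros simp: diff_divide_distrib\<close>)
    then have smooth: "smooth_test (\<lambda>z. - \<phi> z) (\<lambda>z. - \<tau> z) (\<lambda>z. - g z)"
      by (rule smooth_test_uminus)
    have "touches_from_above UNIV \<phi> (\<lambda>z. - w z) (s, y)"
    proof (rule touches_from_aboveI[OF _ W(2) in_W(2)])
      have f_eq: "\<phi> z = N z + (M - f ((t, x), z))" for z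
      proof -
        obtain s' y' where z: "z = (s', y')" by (cases z)
        have "(s' - t)\<^sup>2 = (t - s')\<^sup>2" "norm (y' - x) = norm (x - y')"
          by (simp_all add: power2_commute norm_minus_commute)
        then show ?thesis unfolding z by (simp only: f_def \<phi>_def prod.case q_split)
      qed
      have "N (s, y) = \<phi> (s, y)" by (simp only: f_eq M_def)
      then show "usc_env ?D (\<lambda>z. - w z) (s, y) = ereal (\<phi> (s, y))" using N[of "(s, y)"] txsy by simp
      fix z assume z: "z \<in> W2" "z \<in> {0<..} \<times> UNIV"
      have "f ((t, x), z) \<le> M"
        using zz(2)[of "((t, x), z)"] z in_W W unfolding M_def zz_eq by auto
      then show "usc_env ?D (\<lambda>z. - w z) z \<le> ereal (\<phi> z)" using N[of z] z f_eq by auto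
    qed
    then have "touches_from_below UNIV (\<lambda>z. - \<phi> z) w (s, y)"
      by (simp add: touches_from_above_uminus)
    from space_supersolutionD[OF super smooth txsy(3) this]
    show ?thesis by (simp add: \<tau>_def g_def algebra_simps diff_divide_distrib)
  qed
  have norm_pert: "norm ((\<delta> / bn x) *\<^sub>R x) \<le> \<delta>"
    using norm_soft_norm_gradient_le[of 1 \<delta> x 0] \<delta> by (simp add: bn_def)
  have "dist (Hbar (?p + (\<delta> / bn x) *\<^sub>R x)) (Hbar ?p) < \<kappa>"
  proof (rule d(2))
    show "?p \<in> cball 0 (\<rho> / \<alpha> + 1)" using norm_p by simp
    show "?p + (\<delta> / bn x) *\<^sub>R x \<in> cball 0 (\<rho> / \<alpha> + 1)"
      using norm_triangle_mono[OF norm_p norm_pert] \<delta> by simp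
    show "dist (?p + (\<delta> / bn x) *\<^sub>R x) ?p < d" using norm_pert \<delta> by (simp add: dist_norm)
  qed
  moreover have "\<kappa> \<le> k * E t"
  proof -
    have "exp (- k * t1) \<le> exp (k * (t - t1))" using k txsy by (simp add: algebra_simps)
    then show ?thesis using \<eta> k by (simp add: \<kappa>_def E_def)
  qed
  ultimately show False using sub_ineq super_ineq by (simp add: dist_real_def)
qed

section \<open>Calculus on the network\<close>

lemma vertex_pt_nth [simp]: "vertex_pt \<epsilon> k $ j = \<epsilon> * of_int (k $ j)"
  by (simp add: vertex_pt_def)

lemma edge_pt_nth: "edge_pt \<epsilon> e s $ j = \<epsilon> * of_int (fst e $ j) + (if j = snd e then s else 0)"
  by (simp add: edge_pt_def edge_start_def edge_dir_def axis_def)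

lemma vertex_pt_edge_start: "vertex_pt \<epsilon> (edge_start e) = edge_pt \<epsilon> e 0"
  by (simp add: edge_pt_def)

lemma vertex_pt_edge_end: "vertex_pt \<epsilon> (edge_end e) = edge_pt \<epsilon> e \<epsilon>"
  by (simp add: vec_eq_iff edge_pt_nth edge_end_def axis_def distrib_left)

lemma edge_coord_edge_pt [simp]: "edge_coord \<epsilon> e (edge_pt \<epsilon> e s) = s"
  by (simp add: edge_coord_def edge_pt_def edge_dir_def inner_axis_axis)

lemma edge_pt_convex:
  "(1 - r) *\<^sub>R edge_pt \<epsilon> e 0 + r *\<^sub>R edge_pt \<epsilon> e \<epsilon> = edge_pt \<epsilon> e (r * \<epsilon>)"
  by (simp add: vec_eq_iff edge_pt_nth algebra_simps)

lemma edge_seg_eq: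
  assumes "0 < \<epsilon>"
  shows "edge_seg \<epsilon> e = edge_pt \<epsilon> e ` {0..\<epsilon>}"
proof -
  have "edge_seg \<epsilon> e = (\<lambda>r. edge_pt \<epsilon> e (r * \<epsilon>)) ` {0..1}"
    by (auto simp: edge_seg_def closed_segment_def vertex_pt_edge_start vertex_pt_edge_end edge_pt_convex)
  also have "\<dots> = edge_pt \<epsilon> e ` (\<lambda>r. r * \<epsilon>) ` {0..1}" by (simp add: image_image)
  also have "(\<lambda>r. r * \<epsilon>) ` {0..1} = {0..\<epsilon>}"
    using image_mult_atLeastAtMost[OF assms, of 0 1] by (simp add: mult.commute)
  finally show ?thesis .
qed

lemma edge_pt_in_open_edge_seg:
  assumes "0 < s" "s < \<epsilon>"
  shows "edge_pt \<epsilon> e s \<in> open_edge_seg \<epsilon> e"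
proof -
  have "edge_pt \<epsilon> e 0 $ snd e \<noteq> edge_pt \<epsilon> e \<epsilon> $ snd e"
    using assms by (simp add: edge_pt_nth)
  then have "edge_pt \<epsilon> e 0 \<noteq> edge_pt \<epsilon> e \<epsilon>" by metis
  moreover have "edge_pt \<epsilon> e s = (1 - s / \<epsilon>) *\<^sub>R edge_pt \<epsilon> e 0 + (s / \<epsilon>) *\<^sub>R edge_pt \<epsilon> e \<epsilon>"
    unfolding edge_pt_convex using assms by simp
  ultimately show ?thesis
    unfolding open_edge_seg_def vertex_pt_edge_start vertex_pt_edge_end in_segment
    using assms by (intro conjI exI[of _ "s / \<epsilon>"]) auto
qed

lemma network_cases:
  assumes "0 < \<epsilon>" "x \<in> network \<epsilon>"
  obtains e s where "0 < s" "s < \<epsilon>" "x = edge_pt \<epsilon> e s" | y where "x = vertex_pt \<epsilon> y"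
proof -
  obtain e s where es: "0 \<le> s" "s \<le> \<epsilon>" "x = edge_pt \<epsilon> e s"
    using assms by (auto simp: network_def edge_seg_eq)
  consider "s = 0" | "s = \<epsilon>" | "0 < s" "s < \<epsilon>" using es by linarith
  then show thesis
  proof cases
    case 1
    then show ?thesis using that(2)[of "edge_start e"] es by (simp add: vertex_pt_edge_start)
  next
    case 2
    then show ?thesis using that(2)[of "edge_end e"] es by (simp add: vertex_pt_edge_end)
  next
    case 3
    then show ?thesis using that(1) es by blast
  qed
qed

lemma network_iff:
  assumes "0 < \<epsilon>"
  shows "x \<in> network \<epsilon> \<longleftrightarrow> (\<exists>i. \<forall>j. j \<noteq> i \<longrightarrow> x $ j / \<epsilon> \<in> \<int>)"
proof
  assume "x \<in> network \<epsilon>"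
  then obtain e s where es: "x = edge_pt \<epsilon> e s"
    using assms by (auto simp: network_def edge_seg_eq)
  then have "\<forall>j. j \<noteq> snd e \<longrightarrow> x $ j / \<epsilon> \<in> \<int>"
    using assms by (auto simp: edge_pt_nth)
  then show "\<exists>i. \<forall>j. j \<noteq> i \<longrightarrow> x $ j / \<epsilon> \<in> \<int>" by blast
next
  assume "\<exists>i. \<forall>j. j \<noteq> i \<longrightarrow> x $ j / \<epsilon> \<in> \<int>"
  then obtain i where i: "\<And>j. j \<noteq> i \<Longrightarrow> x $ j / \<epsilon> \<in> \<int>" by blast
  define e where "e = ((\<chi> j. \<lfloor>x $ j / \<epsilon>\<rfloor>) :: int^'a, i)"
  define s where "s = x $ i - \<epsilon> * of_int \<lfloor>x $ i / \<epsilon>\<rfloor>"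
  have "of_int \<lfloor>x $ i / \<epsilon>\<rfloor> \<le> x $ i / \<epsilon>" "x $ i / \<epsilon> \<le> of_int \<lfloor>x $ i / \<epsilon>\<rfloor> + 1" by linarith+
  then have "of_int \<lfloor>x $ i / \<epsilon>\<rfloor> * \<epsilon> \<le> x $ i" "x $ i \<le> (of_int \<lfloor>x $ i / \<epsilon>\<rfloor> + 1) * \<epsilon>"
    using assms by (simp_all only: pos_le_divide_eq pos_divide_le_eq)
  then have "0 \<le> s" "s \<le> \<epsilon>" by (simp_all add: s_def algebra_simps)
  moreover have "x = edge_pt \<epsilon> e s"
    unfolding vec_eq_iff edge_pt_nth
    using i assms by (auto simp: e_def s_def elim!: Ints_cases)
  ultimately have "x \<in> edge_seg \<epsilon> e" using assms by (auto simp: edge_seg_eq)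
  then show "x \<in> network \<epsilon>" unfolding network_def by blast
qed

lemma closed_network:
  assumes "0 < \<epsilon>"
  shows "closed (network \<epsilon>)"
proof -
  have "network \<epsilon> = (\<Union>i. \<Inter>j\<in>-{i}. (\<lambda>x. x $ j / \<epsilon>) -` \<int>)"
    by (rule set_eqI) (simp add: network_iff[OF assms], simp add: Ball_def)
  also have "closed \<dots>"
    by (intro closed_UN finite closed_INT ballI closed_vimage closed_Ints continuous_intros) (use assms in auto)
  finally show ?thesis .
qed

lemma vertex_pt_in_network:
  assumes "0 < \<epsilon>"
  shows "vertex_pt \<epsilon> k \<in> network \<epsilon>"
  using assms by (simp add: network_iff)

text \<open>\<open>\<kappa> e\<close> is the slope along the edge \<open>e\<close>.\<close>

text \<open>
  Adding such a function to a smooth test function changes the slopes at a vertex edge by edge and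
  leaves an admissible test function on the network; \<open>\<kappa> e\<close> is the change on the edge \<open>e\<close>.
\<close>

definition edgewise_affine :: "real \<Rightarrow> (real^'d::finite \<Rightarrow> real) \<Rightarrow> ('d edge \<Rightarrow> real) \<Rightarrow> bool" where
  "edgewise_affine \<epsilon> \<psi> \<kappa> \<longleftrightarrow>
     continuous_on UNIV \<psi> \<and> (\<forall>e. \<forall>s\<in>{0..\<epsilon>}. \<psi> (edge_pt \<epsilon> e s) = \<psi> (edge_pt \<epsilon> e 0) + \<kappa> e * s)"

lemma edgewise_affineD:
  "edgewise_affine \<epsilon> \<psi> \<kappa> \<Longrightarrow> s \<in> {0..\<epsilon>} \<Longrightarrow> \<psi> (edge_pt \<epsilon> e s) = \<psi> (edge_pt \<epsilon> e 0) + \<kappa> e * s"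
  unfolding edgewise_affine_def by blast

lemma edgewise_affine_zero: "edgewise_affine \<epsilon> (\<lambda>_. 0) (\<lambda>_. 0)"
  by (simp add: edgewise_affine_def)

text \<open>
  The coordinate \<open>x $ j\<close> varies only along the edges of direction \<open>j\<close>, and each of these lies on one
  side of the hyperplane \<open>x $ j = \<epsilon> * of_int (k $ j)\<close>, so that the absolute value is affine on it.
\<close>

lemma edgewise_affine_cone:
  fixes k :: "int^'d::finite"
  assumes "0 < \<epsilon>" "0 \<le> K"
  obtains \<kappa> where "edgewise_affine \<epsilon> (\<lambda>x. K * (\<Sum>j\<in>J. \<bar>x $ j - \<epsilon> * of_int (k $ j)\<bar>)) \<kappa>"
    and "\<And>e. snd e \<notin> J \<Longrightarrow> \<kappa> e = 0" and "\<And>e. snd e \<in> J \<Longrightarrow> \<bar>\<kappa> e\<bar> = K"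
proof -
  let ?\<psi> = "\<lambda>x. K * (\<Sum>j\<in>J. \<bar>x $ j - \<epsilon> * of_int (k $ j)\<bar>)"
  define \<kappa> :: "'d edge \<Rightarrow> real" where
    "\<kappa> e = (if snd e \<in> J then if k $ snd e \<le> fst e $ snd e then K else - K else 0)" for e
  have one: "\<bar>\<epsilon> * of_int (fst e $ j) + s - \<epsilon> * of_int (k $ j)\<bar> =
      \<bar>\<epsilon> * of_int (fst e $ j) - \<epsilon> * of_int (k $ j)\<bar> + (if k $ j \<le> fst e $ j then s else - s)"
    if "s \<in> {0..\<epsilon>}" for e :: "'d edge" and j s
  proof (cases "k $ j \<le> fst e $ j")
    case True
    then have "\<epsilon> * of_int (k $ j) \<le> \<epsilon> * of_int (fst e $ j)" using assms by simp
    then show ?thesis using True that by simp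
  next
    case False
    then have "real_of_int (fst e $ j) + 1 \<le> of_int (k $ j)" by linarith
    then have "\<epsilon> * (real_of_int (fst e $ j) + 1) \<le> \<epsilon> * of_int (k $ j)"
      using assms by (intro mult_left_mono) auto
    then show ?thesis using False that by (simp add: distrib_left)
  qed
  have "?\<psi> (edge_pt \<epsilon> e s) = ?\<psi> (edge_pt \<epsilon> e 0) + \<kappa> e * s" if s: "s \<in> {0..\<epsilon>}" for e s
  proof -
    define \<sigma> where "\<sigma> = (if k $ snd e \<le> fst e $ snd e then s else - s)"
    have "(\<Sum>j\<in>J. \<bar>edge_pt \<epsilon> e s $ j - \<epsilon> * of_int (k $ j)\<bar>) =
      (\<Sum>j\<in>J. \<bar>edge_pt \<epsilon> e 0 $ j - \<epsilon> * of_int (k $ j)\<bar> + (if j = snd e then \<sigma> else 0))"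
    proof (rule sum.cong[OF refl])
      fix j
      show "\<bar>edge_pt \<epsilon> e s $ j - \<epsilon> * of_int (k $ j)\<bar> =
        \<bar>edge_pt \<epsilon> e 0 $ j - \<epsilon> * of_int (k $ j)\<bar> + (if j = snd e then \<sigma> else 0)"
        using one[OF s, of e j] by (cases "j = snd e") (simp_all add: edge_pt_nth \<sigma>_def)
    qed
    also have "\<dots> = (\<Sum>j\<in>J. \<bar>edge_pt \<epsilon> e 0 $ j - \<epsilon> * of_int (k $ j)\<bar>) + (if snd e \<in> J then \<sigma> else 0)"
      by (simp add: sum.distrib)
    finally show ?thesis by (simp add: \<kappa>_def \<sigma>_def distrib_left)
  qed
  moreover have "continuous_on UNIV ?\<psi>" by (intro continuous_intros)
  ultimately have "edgewise_affine \<epsilon> ?\<psi> \<kappa>" unfolding edgewise_affine_def by (intro conjI allI ballI)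
  then show thesis by (rule that) (use assms in \<open>auto simp: \<kappa>_def\<close>)
qed

lemma edge_restriction_derivative:
  assumes \<phi>: "smooth_test \<phi> \<tau> g" and \<psi>: "edgewise_affine \<epsilon> \<psi> \<kappa>" and t: "0 < t" and s: "s \<in> {0..\<epsilon>}"
  shows "((\<lambda>(t, s). \<phi> (t, edge_pt \<epsilon> e s) + \<psi> (edge_pt \<epsilon> e s)) has_derivative
     (\<lambda>(a, h). \<tau> (t, edge_pt \<epsilon> e s) * a + (g (t, edge_pt \<epsilon> e s) $ snd e + \<kappa> e) * h))
     (at (t, s) within {0<..} \<times> {0..\<epsilon>})"
proof (rule has_derivative_transform)
  let ?S = "{0<..} \<times> {0..\<epsilon>}"
  show "(t, s) \<in> ?S" using t s by simp
  show "(\<lambda>(t, s). \<phi> (t, edge_pt \<epsilon> e s) + \<psi> (edge_pt \<epsilon> e s)) z =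
     \<phi> (fst z, edge_pt \<epsilon> e (snd z)) + (\<psi> (edge_pt \<epsilon> e 0) + \<kappa> e * snd z)" if "z \<in> ?S" for z
    using that edgewise_affineD[OF \<psi>, of "snd z" e] by (auto simp: case_prod_unfold)
  have pt: "((\<lambda>z. (fst z, edge_pt \<epsilon> e (snd z))) has_derivative (\<lambda>z. (fst z, snd z *\<^sub>R edge_dir e))) (at (t, s) within ?S)"
    unfolding edge_pt_def by (auto intro!: derivative_eq_intros)
  have "((\<lambda>z. \<phi> (fst z, edge_pt \<epsilon> e (snd z))) has_derivative
      (\<lambda>z. (\<lambda>(a, h). \<tau> (t, edge_pt \<epsilon> e s) * a + g (t, edge_pt \<epsilon> e s) \<bullet> h) (fst z, snd z *\<^sub>R edge_dir e))) (at (t, s) within ?S)"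
    by (rule has_derivative_compose[OF pt]) (use smooth_test_derivative[OF \<phi> t] in simp)
  moreover have "((\<lambda>z. \<psi> (edge_pt \<epsilon> e 0) + \<kappa> e * snd z) has_derivative (\<lambda>z. \<kappa> e * snd z)) (at (t, s) within ?S)"
    by (auto intro!: derivative_eq_intros)
  ultimately have "((\<lambda>z. \<phi> (fst z, edge_pt \<epsilon> e (snd z)) + (\<psi> (edge_pt \<epsilon> e 0) + \<kappa> e * snd z)) has_derivative
      (\<lambda>z. (\<lambda>(a, h). \<tau> (t, edge_pt \<epsilon> e s) * a + g (t, edge_pt \<epsilon> e s) \<bullet> h) (fst z, snd z *\<^sub>R edge_dir e) + \<kappa> e * snd z))
      (at (t, s) within ?S)"
    by (rule has_derivative_add)
  then show "((\<lambda>z. \<phi> (fst z, edge_pt \<epsilon> e (snd z)) + (\<psi> (edge_pt \<epsilon> e 0) + \<kappa> e * snd z)) has_derivative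
     (\<lambda>(a, h). \<tau> (t, edge_pt \<epsilon> e s) * a + (g (t, edge_pt \<epsilon> e s) $ snd e + \<kappa> e) * h)) (at (t, s) within ?S)"
    by (rule has_derivative_eq_rhs)
       (auto simp: fun_eq_iff edge_dir_def inner_axis algebra_simps)
qed

lemma network_test_smooth:
  assumes \<phi>: "smooth_test \<phi> \<tau> g" and \<psi>: "edgewise_affine \<epsilon> \<psi> \<kappa>"
  shows "network_test \<epsilon> (\<lambda>(t, x). \<phi> (t, x) + \<psi> x)"
  unfolding network_test_def
proof (intro conjI allI)
  have "continuous_on UNIV \<psi>" using \<psi> by (simp add: edgewise_affine_def)
  then have "continuous_on ({0<..} \<times> network \<epsilon>) (\<lambda>z. \<psi> (snd z))"
    by (rule continuous_on_compose2) (auto intro: continuous_on_snd continuous_on_id)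
  moreover have "continuous_on ({0<..} \<times> network \<epsilon>) \<phi>"
    by (rule smooth_test_continuous_on[OF \<phi>]) auto
  ultimately have "continuous_on ({0<..} \<times> network \<epsilon>) (\<lambda>z. \<phi> z + \<psi> (snd z))"
    by (intro continuous_on_add)
  then show "continuous_on ({0<..} \<times> network \<epsilon>) (\<lambda>(t, x). \<phi> (t, x) + \<psi> x)"
    by (simp add: case_prod_unfold)
  fix e
  let ?S = "{0<..} \<times> {0..\<epsilon>}"
  let ?\<tau> = "\<lambda>z. \<tau> (fst z, edge_pt \<epsilon> e (snd z))"
  let ?g = "\<lambda>z. g (fst z, edge_pt \<epsilon> e (snd z)) $ snd e + \<kappa> e"
  have pt: "continuous_on ?S (\<lambda>z. (fst z, edge_pt \<epsilon> e (snd z)))"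
    unfolding edge_pt_def by (intro continuous_intros)
  have into: "(\<lambda>z. (fst z, edge_pt \<epsilon> e (snd z))) ` ?S \<subseteq> {0<..} \<times> UNIV" by auto
  have "continuous_on ?S ?\<tau>"
    by (rule continuous_on_compose2[OF smooth_test_continuous_on(2)[OF \<phi> order_refl] pt into])
  have "continuous_on ?S (\<lambda>z. g (fst z, edge_pt \<epsilon> e (snd z)))"
    by (rule continuous_on_compose2[OF smooth_test_continuous_on(3)[OF \<phi> order_refl] pt into])
  then have "continuous_on ?S ?g" by (intro continuous_intros)
  obtain f' :: "real \<times> real \<Rightarrow> (real \<times> real) \<Rightarrow>\<^sub>L real"
    where f': "\<And>z. blinfun_apply (f' z) = (\<lambda>(a, h). ?\<tau> z * a + ?g z \<bullet> h)"
      "\<And>S. continuous_on S ?\<tau> \<Longrightarrow> continuous_on S ?g \<Longrightarrow> continuous_on S f'"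
    by (rule smooth_test_blinfun[of ?\<tau> ?g]) (rule that, assumption+)
  have "continuous_on ?S f'" by (rule f'(2)) fact+
  moreover have "((\<lambda>(t, s). \<phi> (t, edge_pt \<epsilon> e s) + \<psi> (edge_pt \<epsilon> e s)) has_derivative blinfun_apply (f' z)) (at z within ?S)"
    if z: "z \<in> ?S" for z
    using edge_restriction_derivative[OF \<phi> \<psi>, of "fst z" "snd z" e] z by (auto simp: f')
  ultimately show "C1_on ?S (\<lambda>(t, s). case (t, edge_pt \<epsilon> e s) of (t, x) \<Rightarrow> \<phi> (t, x) + \<psi> x)"
    unfolding C1_on_def prod.case by blast
qed

lemma edge_deriv_smooth:
  assumes \<phi>: "smooth_test \<phi> \<tau> g" and \<psi>: "edgewise_affine \<epsilon> \<psi> \<kappa>" and t: "0 < t"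
    and \<epsilon>: "0 < \<epsilon>" and s: "s \<in> {0..\<epsilon>}"
  shows "edge_deriv \<epsilon> e (\<lambda>x. \<phi> (t, x) + \<psi> x) (edge_pt \<epsilon> e s) = g (t, edge_pt \<epsilon> e s) $ snd e + \<kappa> e"
proof -
  let ?x = "edge_pt \<epsilon> e s"
  have "((\<lambda>r. (\<lambda>(t, s). \<phi> (t, edge_pt \<epsilon> e s) + \<psi> (edge_pt \<epsilon> e s)) (t, r)) has_derivative
      (\<lambda>h. (\<lambda>(a, h). \<tau> (t, ?x) * a + (g (t, ?x) $ snd e + \<kappa> e) * h) (0, h))) (at s within {0..\<epsilon>})"
  proof (rule has_derivative_in_compose[where f = "Pair t" and f' = "Pair 0"
        and g = "\<lambda>(t, s). \<phi> (t, edge_pt \<epsilon> e s) + \<psi> (edge_pt \<epsilon> e s)"])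
    show "(Pair t has_derivative Pair 0) (at s within {0..\<epsilon>})"
      by (auto intro!: derivative_eq_intros)
    show "((\<lambda>(t, s). \<phi> (t, edge_pt \<epsilon> e s) + \<psi> (edge_pt \<epsilon> e s)) has_derivative
       (\<lambda>(a, h). \<tau> (t, ?x) * a + (g (t, ?x) $ snd e + \<kappa> e) * h)) (at (t, s) within Pair t ` {0..\<epsilon>})"
      by (rule has_derivative_subset[OF edge_restriction_derivative[OF \<phi> \<psi> t s]]) (use t in auto)
  qed
  then have "((\<lambda>s. \<phi> (t, edge_pt \<epsilon> e s) + \<psi> (edge_pt \<epsilon> e s)) has_vector_derivative (g (t, ?x) $ snd e + \<kappa> e))
      (at s within {0..\<epsilon>})"
    by (simp add: has_vector_derivative_def mult.commute)
  then show ?thesis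
    unfolding edge_deriv_def edge_coord_edge_pt
    by (rule vector_derivative_within_closed_interval[OF \<epsilon> s])
qed

lemma time_deriv_smooth:
  assumes \<phi>: "smooth_test \<phi> \<tau> g" and t: "0 < t"
  shows "time_deriv (\<lambda>(t, x). \<phi> (t, x) + \<psi> x) t x = \<tau> (t, x)"
  using smooth_test_time_deriv[OF smooth_test_add[OF \<phi> smooth_test_const[of "\<psi> x"]] t, of x]
  by (simp add: time_deriv_def)

lemma F_lim_cong:
  assumes "\<And>e. e \<in> edges_starting y \<union> edges_ending y \<Longrightarrow> p e = q e"
  shows "F_lim A H p0 y p = F_lim A H p0 y q"
proof -
  have "(\<lambda>e. H_minus (H e) (p0 e) (p e)) ` edges_starting y = (\<lambda>e. H_minus (H e) (p0 e) (q e)) ` edges_starting y"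
    "(\<lambda>e. H_plus (H e) (p0 e) (p e)) ` edges_ending y = (\<lambda>e. H_plus (H e) (p0 e) (q e)) ` edges_ending y"
    using assms by (auto intro!: image_cong)
  then show ?thesis by (simp only: F_lim_def)
qed

lemma vertex_edge_deriv:
  assumes \<phi>: "smooth_test \<phi> \<tau> g" and \<psi>: "edgewise_affine \<epsilon> \<psi> \<kappa>" and t: "0 < t" and \<epsilon>: "0 < \<epsilon>"
    and e: "e \<in> edges_starting y \<union> edges_ending y"
  shows "edge_deriv \<epsilon> e (\<lambda>x. \<phi> (t, x) + \<psi> x) (vertex_pt \<epsilon> y) = g (t, vertex_pt \<epsilon> y) $ snd e + \<kappa> e"
proof -
  have "vertex_pt \<epsilon> y = edge_pt \<epsilon> e 0 \<or> vertex_pt \<epsilon> y = edge_pt \<epsilon> e \<epsilon>"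
    using e by (auto simp: edges_starting_def edges_ending_def simp flip: vertex_pt_edge_start vertex_pt_edge_end)
  then show ?thesis
    using edge_deriv_smooth[OF \<phi> \<psi> t \<epsilon>, of 0 e] edge_deriv_smooth[OF \<phi> \<psi> t \<epsilon>, of \<epsilon> e] \<epsilon> by auto
qed

lemma network_subsolution_edge:
  assumes "network_subsolution \<epsilon> H F u" "network_test \<epsilon> \<phi>" "0 < t" "x \<in> open_edge_seg \<epsilon> e"
    and "touches_from_above (network \<epsilon>) \<phi> u (t, x)"
  shows "time_deriv \<phi> t x + H e (edge_deriv \<epsilon> e (\<lambda>y. \<phi> (t, y)) x) \<le> 0"
  using assms unfolding network_subsolution_def by blast

lemma network_subsolution_vertex:
  assumes "network_subsolution \<epsilon> H F u" "network_test \<epsilon> \<phi>" "0 < t"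
    and "touches_from_above (network \<epsilon>) \<phi> u (t, vertex_pt \<epsilon> y)"
  shows "time_deriv \<phi> t (vertex_pt \<epsilon> y) + F y (\<lambda>e. edge_deriv \<epsilon> e (\<lambda>x. \<phi> (t, x)) (vertex_pt \<epsilon> y)) \<le> 0"
  using assms unfolding network_subsolution_def by blast

text \<open>
  In terms of the gradient \<open>g\<close> of the smooth part, the slope along an edge \<open>e\<close> is
  \<open>g $ snd e + \<kappa> e\<close>, both in the interior of \<open>e\<close> and, one-sided, at its two end points.
\<close>

lemma network_subsolutionD:
  assumes u: "network_subsolution \<epsilon> H (F_lim A H p0) u" and \<epsilon>: "0 < \<epsilon>"
    and \<phi>: "smooth_test \<phi> \<tau> g" and \<psi>: "edgewise_affine \<epsilon> \<psi> \<kappa>" and t: "0 < t" and x: "x \<in> network \<epsilon>"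
    and touch: "touches_from_above (network \<epsilon>) (\<lambda>(t, x). \<phi> (t, x) + \<psi> x) u (t, x)"
  obtains (edge) e where "\<tau> (t, x) + H e (g (t, x) $ snd e + \<kappa> e) \<le> 0"
  | (vertex) y where "\<tau> (t, x) + F_lim A H p0 y (\<lambda>e. g (t, x) $ snd e + \<kappa> e) \<le> 0"
  using \<epsilon> x
proof (cases rule: network_cases)
  case (1 e s)
  have "edge_deriv \<epsilon> e (\<lambda>y. \<phi> (t, y) + \<psi> y) x = g (t, x) $ snd e + \<kappa> e"
    using edge_deriv_smooth[OF \<phi> \<psi> t \<epsilon>, of s e] 1 by simp
  moreover have "x \<in> open_edge_seg \<epsilon> e" using 1 edge_pt_in_open_edge_seg by blast
  ultimately have "\<tau> (t, x) + H e (g (t, x) $ snd e + \<kappa> e) \<le> 0"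
    using network_subsolution_edge[OF u network_test_smooth[OF \<phi> \<psi>] t _ touch, of e]
    by (simp add: time_deriv_smooth[OF \<phi> t])
  then show thesis by (rule edge)
next
  case (2 y)
  have "F_lim A H p0 y (\<lambda>e. edge_deriv \<epsilon> e (\<lambda>y. \<phi> (t, y) + \<psi> y) x) =
      F_lim A H p0 y (\<lambda>e. g (t, x) $ snd e + \<kappa> e)"
    unfolding 2 by (intro F_lim_cong vertex_edge_deriv[OF \<phi> \<psi> t \<epsilon>])
  then have "\<tau> (t, x) + F_lim A H p0 y (\<lambda>e. g (t, x) $ snd e + \<kappa> e) \<le> 0"
    using network_subsolution_vertex[OF u network_test_smooth[OF \<phi> \<psi>] t touch[unfolded 2]] 2
    by (simp add: time_deriv_smooth[OF \<phi> t])
  then show thesis by (rule vertex)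
qed

lemma network_supersolution_edge:
  assumes "network_supersolution \<epsilon> H F u" "network_test \<epsilon> \<phi>" "0 < t" "x \<in> open_edge_seg \<epsilon> e"
    and "touches_from_below (network \<epsilon>) \<phi> u (t, x)"
  shows "time_deriv \<phi> t x + H e (edge_deriv \<epsilon> e (\<lambda>y. \<phi> (t, y)) x) \<ge> 0"
  using assms unfolding network_supersolution_def by blast

lemma network_supersolution_vertex:
  assumes "network_supersolution \<epsilon> H F u" "network_test \<epsilon> \<phi>" "0 < t"
    and "touches_from_below (network \<epsilon>) \<phi> u (t, vertex_pt \<epsilon> y)"
  shows "time_deriv \<phi> t (vertex_pt \<epsilon> y) + F y (\<lambda>e. edge_deriv \<epsilon> e (\<lambda>x. \<phi> (t, x)) (vertex_pt \<epsilon> y)) \<ge> 0"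
  using assms unfolding network_supersolution_def by blast

lemma network_supersolutionD:
  assumes u: "network_supersolution \<epsilon> H (F_lim A H p0) u" and \<epsilon>: "0 < \<epsilon>"
    and \<phi>: "smooth_test \<phi> \<tau> g" and t: "0 < t" and x: "x \<in> network \<epsilon>"
    and touch: "touches_from_below (network \<epsilon>) \<phi> u (t, x)"
  obtains (edge) e where "0 \<le> \<tau> (t, x) + H e (g (t, x) $ snd e)"
  | (vertex) y where "0 \<le> \<tau> (t, x) + F_lim A H p0 y (\<lambda>e. g (t, x) $ snd e)"
proof -
  have test: "network_test \<epsilon> \<phi>"
    using network_test_smooth[OF \<phi> edgewise_affine_zero] by simp
  from \<epsilon> x show thesis
  proof (cases rule: network_cases)
    case (1 e s)
    have "edge_deriv \<epsilon> e (\<lambda>y. \<phi> (t, y)) x = g (t, x) $ snd e"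
      using edge_deriv_smooth[OF \<phi> edgewise_affine_zero t \<epsilon>, of s e] 1 by simp
    moreover have "x \<in> open_edge_seg \<epsilon> e" using 1 edge_pt_in_open_edge_seg by blast
    ultimately have "0 \<le> \<tau> (t, x) + H e (g (t, x) $ snd e)"
      using network_supersolution_edge[OF u test t _ touch, of e]
      by (simp add: smooth_test_time_deriv[OF \<phi> t])
    then show thesis by (rule edge)
  next
    case (2 y)
    have "F_lim A H p0 y (\<lambda>e. edge_deriv \<epsilon> e (\<lambda>y. \<phi> (t, y)) x) = F_lim A H p0 y (\<lambda>e. g (t, x) $ snd e)"
    proof (rule F_lim_cong)
      fix e assume "e \<in> edges_starting y \<union> edges_ending y"
      from vertex_edge_deriv[OF \<phi> edgewise_affine_zero t \<epsilon> this]
      show "edge_deriv \<epsilon> e (\<lambda>y. \<phi> (t, y)) x = g (t, x) $ snd e" unfolding 2 by simp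
    qed
    then have "0 \<le> \<tau> (t, x) + F_lim A H p0 y (\<lambda>e. g (t, x) $ snd e)"
      using network_supersolution_vertex[OF u test t touch[unfolded 2]] 2
      by (simp add: smooth_test_time_deriv[OF \<phi> t])
    then show thesis by (rule vertex)
  qed
qed

section \<open>Half-relaxed limits\<close>

text \<open>
  The upper half-relaxed limit of \<open>u \<epsilon>\<close> at \<open>(t, x)\<close> is the upper envelope, relative to this set, of
  \<open>(\<epsilon>, z) \<mapsto> u \<epsilon> z\<close> at the point \<open>(0, t, x)\<close>.  In this form the lemmas on envelopes apply to it.
\<close>

definition relaxed_domain :: "(real \<Rightarrow> 'a set) \<Rightarrow> (real \<times> real \<times> 'a) set" where
  "relaxed_domain X = {(\<epsilon>, s, y). 0 < \<epsilon> \<and> 0 \<le> s \<and> y \<in> X \<epsilon>}"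

lemma usc_env_slice:
  fixes u :: "real \<Rightarrow> real \<times> 'a::topological_space \<Rightarrow> real"
  assumes "0 < \<epsilon>"
  shows "usc_env ({0..} \<times> X \<epsilon>) (u \<epsilon>) z \<le> usc_env (relaxed_domain X) (\<lambda>(\<epsilon>, z). u \<epsilon> z) (\<epsilon>, z)"
proof (rule ccontr)
  assume "\<not> ?thesis"
  then obtain c where c: "usc_env (relaxed_domain X) (\<lambda>(\<epsilon>, z). u \<epsilon> z) (\<epsilon>, z) < ereal c"
    "ereal c < usc_env ({0..} \<times> X \<epsilon>) (u \<epsilon>) z"
    using ereal_dense2 by (metis not_le)
  have "filterlim (\<lambda>w. (\<epsilon>, w)) (nhds (\<epsilon>, z)) (nhds z)"
    by (intro tendsto_Pair tendsto_const tendsto_ident_at filterlim_ident)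
  from eventually_compose_filterlim[OF usc_env_lessD[OF c(1)] this]
  have "\<forall>\<^sub>F w in nhds z. w \<in> {0..} \<times> X \<epsilon> \<longrightarrow> u \<epsilon> w \<le> c"
    by eventually_elim (use assms in \<open>auto simp: relaxed_domain_def\<close>)
  from usc_env_le[OF this] c(2) show False by simp
qed

text \<open>
  The function \<open>\<Phi>\<close> touches the half-relaxed limit from above at \<open>z0\<close> with a quadratic margin.  On the
  sphere around \<open>z0\<close> this margin persists for all small \<open>\<epsilon>\<close> by compactness, whereas some values of
  \<open>u \<epsilon>\<close> near \<open>z0\<close> come close to \<open>\<Phi> z0\<close>.  A perturbation \<open>b \<epsilon>\<close> of size \<open>O(\<epsilon>)\<close> is too small to
  spoil this, and the maximum over the closed ball is attained in its interior.
\<close>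

lemma relaxed_limit_local_max:
  fixes u :: "real \<Rightarrow> real \<times> 'a::euclidean_space \<Rightarrow> real"
  assumes X: "\<And>\<epsilon>. 0 < \<epsilon> \<Longrightarrow> closed (X \<epsilon>)"
    and finite_env: "\<And>\<epsilon> z. 0 < \<epsilon> \<Longrightarrow> z \<in> {0..} \<times> X \<epsilon> \<Longrightarrow> \<exists>c. usc_env ({0..} \<times> X \<epsilon>) (u \<epsilon>) z \<le> ereal c"
    and r: "0 < r" "cball z0 r \<subseteq> {0<..} \<times> UNIV"
    and \<Phi>: "continuous_on (cball z0 r) \<Phi>"
    and top: "usc_env (relaxed_domain X) (\<lambda>(\<epsilon>, z). u \<epsilon> z) (0, z0) = ereal (\<Phi> z0)"
    and below: "\<And>z. z \<in> cball z0 r \<Longrightarrow>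
      usc_env (relaxed_domain X) (\<lambda>(\<epsilon>, z). u \<epsilon> z) (0, z) \<le> ereal (\<Phi> z - (dist z z0)\<^sup>2)"
    and b: "\<And>\<epsilon>. 0 < \<epsilon> \<Longrightarrow> continuous_on (cball z0 r) (b \<epsilon>)"
    and b_bound: "\<And>\<epsilon> z. 0 < \<epsilon> \<Longrightarrow> 0 \<le> b \<epsilon> z \<and> b \<epsilon> z \<le> M * \<epsilon>"
  obtains \<epsilon> z m where "0 < \<epsilon>" "z \<in> ball z0 r" "z \<in> {0<..} \<times> X \<epsilon>"
    "usc_env ({0..} \<times> X \<epsilon>) (u \<epsilon>) z = ereal (\<Phi> z + b \<epsilon> z + m)"
    "\<And>w. w \<in> ball z0 r \<Longrightarrow> w \<in> {0<..} \<times> X \<epsilon> \<Longrightarrow>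
       usc_env ({0..} \<times> X \<epsilon>) (u \<epsilon>) w \<le> ereal (\<Phi> w + b \<epsilon> w + m)"
proof -
  define S where "S = relaxed_domain X"
  define W where "W = (\<lambda>(\<epsilon>, z). u \<epsilon> z)"
  define D where "D \<epsilon> = {0 :: real..} \<times> X \<epsilon>" for \<epsilon>
  define G where "G = {p. snd p \<in> cball z0 r \<longrightarrow> usc_env S W p < ereal (\<Phi> (snd p) - r\<^sup>2 / 2)}"
  have r2: "0 < r\<^sup>2" using r by simp
  have near: "\<forall>\<^sub>F p in nhds (0 :: real, z). snd p \<in> cball z0 r \<longrightarrow> \<bar>\<Phi> (snd p) - \<Phi> z\<bar> < h"
    if z: "z \<in> cball z0 r" and h: "0 < h" for z h
  proof -
    have "\<forall>\<^sub>F w in at z within cball z0 r. dist (\<Phi> w) (\<Phi> z) < h"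
      using \<Phi> z h unfolding continuous_on_def by (blast intro: tendstoD)
    then have "\<forall>\<^sub>F w in nhds z. w \<in> cball z0 r \<longrightarrow> \<bar>\<Phi> w - \<Phi> z\<bar> < h"
      unfolding eventually_at_filter dist_real_def by (rule eventually_mono) (use h in auto)
    moreover have "filterlim snd (nhds z) (nhds (0 :: real, z))"
      using tendsto_snd[OF filterlim_ident, of "(0 :: real, z)"] by simp
    ultimately show ?thesis by (rule eventually_compose_filterlim)
  qed
  have "{0} \<times> sphere z0 r \<subseteq> interior G"
  proof (rule subsetI, elim SigmaE singletonE, hypsubst)
    fix z' assume "z' \<in> sphere z0 r"
    then have z: "dist z0 z' = r" by simp
    let ?z = z'
    have zc: "?z \<in> cball z0 r" using z by simp
    have "usc_env S W (0, ?z) \<le> ereal (\<Phi> ?z - r\<^sup>2)"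
      using below[OF zc] z by (simp add: S_def W_def dist_commute)
    also have "\<dots> < ereal (\<Phi> ?z - 3 * r\<^sup>2 / 4)" using r2 by simp
    finally have "\<forall>\<^sub>F p in nhds (0, ?z). usc_env S W p < ereal (\<Phi> ?z - 3 * r\<^sup>2 / 4)"
      by (rule eventually_usc_env_less)
    moreover have "\<forall>\<^sub>F p in nhds (0 :: real, ?z). snd p \<in> cball z0 r \<longrightarrow> \<bar>\<Phi> (snd p) - \<Phi> ?z\<bar> < r\<^sup>2 / 4"
      by (rule near[OF zc]) (use r2 in simp)
    ultimately have "\<forall>\<^sub>F p in nhds (0, ?z). p \<in> G"
    proof eventually_elim
      case (elim p)
      show ?case unfolding G_def
      proof clarify
        assume "snd p \<in> cball z0 r"
        with elim(2) have "\<bar>\<Phi> (snd p) - \<Phi> ?z\<bar> < r\<^sup>2 / 4" by blast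
        then have "\<Phi> ?z - 3 * r\<^sup>2 / 4 \<le> \<Phi> (snd p) - r\<^sup>2 / 2"
          unfolding abs_less_iff by linarith
        with elim(1) show "usc_env S W p < ereal (\<Phi> (snd p) - r\<^sup>2 / 2)"
          by (meson ereal_less_eq(3) less_le_trans)
      qed
    qed
    then show "(0, ?z) \<in> interior G"
      unfolding eventually_nhds by (auto intro: interiorI)
  qed
  \<comment> \<open>The margin at \<open>\<epsilon> = 0\<close> holds on the compact sphere, hence on the sphere for all \<open>\<epsilon>\<close> near \<open>0\<close>.\<close>
  from Elementary_Topology.tube_lemma[OF compact_sphere open_interior this]
  obtain E where E: "0 \<in> E" "open E" "E \<times> sphere z0 r \<subseteq> interior G" by blast
  have sphere: "usc_env (D \<epsilon>) (u \<epsilon>) z < ereal (\<Phi> z - r\<^sup>2 / 2)"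
    if "\<epsilon> \<in> E" "0 < \<epsilon>" "z \<in> sphere z0 r" for \<epsilon> z
  proof -
    have "(\<epsilon>, z) \<in> G" using E(3) interior_subset that by blast
    moreover have "z \<in> cball z0 r" using that by simp
    ultimately have "usc_env S W (\<epsilon>, z) < ereal (\<Phi> z - r\<^sup>2 / 2)" by (simp add: G_def)
    then show ?thesis
      using usc_env_slice[OF that(2), of X u z] unfolding S_def W_def D_def by (rule le_less_trans[rotated])
  qed
  define c where "c = r\<^sup>2 / 8"
  have c: "0 < c" using r2 by (simp add: c_def)
  have "\<exists>\<^sub>F p in nhds (0, z0). p \<in> S \<and> \<Phi> z0 - c < W p"
    by (rule usc_env_frequently) (use top c in \<open>simp add: S_def W_def\<close>)
  moreover have "\<forall>\<^sub>F p in nhds (0 :: real, z0). p \<in> (E \<inter> (\<lambda>\<epsilon>. M * \<epsilon>) -` {..<c}) \<times> ball z0 r"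
  proof (rule eventually_nhds_in_open)
    have "open ((\<lambda>\<epsilon>. M * \<epsilon>) -` {..<c})" by (intro open_vimage open_lessThan continuous_intros)
    with E show "open ((E \<inter> (\<lambda>\<epsilon>. M * \<epsilon>) -` {..<c}) \<times> ball z0 r)" by (intro open_Times open_Int) auto
    show "(0, z0) \<in> (E \<inter> (\<lambda>\<epsilon>. M * \<epsilon>) -` {..<c}) \<times> ball z0 r" using E c r by simp
  qed
  moreover have "\<forall>\<^sub>F p in nhds (0 :: real, z0). snd p \<in> cball z0 r \<longrightarrow> \<bar>\<Phi> (snd p) - \<Phi> z0\<bar> < c"
    by (rule near) (use r c in auto)
  ultimately have "\<exists>\<^sub>F p in nhds (0, z0). p \<in> S \<and> \<Phi> z0 - c < W p \<and>
      p \<in> (E \<inter> (\<lambda>\<epsilon>. M * \<epsilon>) -` {..<c}) \<times> ball z0 r \<and>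
      (snd p \<in> cball z0 r \<longrightarrow> \<bar>\<Phi> (snd p) - \<Phi> z0\<bar> < c)"
    by (auto elim!: frequently_rev_mp elim: eventually_elim2)
  then obtain p where p: "p \<in> S" "\<Phi> z0 - c < W p" "p \<in> (E \<inter> (\<lambda>\<epsilon>. M * \<epsilon>) -` {..<c}) \<times> ball z0 r"
      "snd p \<in> cball z0 r \<longrightarrow> \<bar>\<Phi> (snd p) - \<Phi> z0\<bar> < c"
    by (blast dest: frequently_ex)
  define \<epsilon> where "\<epsilon> = fst p"
  define z1 where "z1 = snd p"
  have p_eq: "p = (\<epsilon>, z1)" by (simp add: \<epsilon>_def z1_def)
  have \<epsilon>: "0 < \<epsilon>" "\<epsilon> \<in> E" "M * \<epsilon> < c" and z1: "z1 \<in> D \<epsilon>" "z1 \<in> ball z0 r" "\<Phi> z0 - c < u \<epsilon> z1"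
    using p by (auto simp: p_eq S_def relaxed_domain_def D_def W_def)
  have z1': "\<Phi> z1 < \<Phi> z0 + c" using p(4) z1(2) by (auto simp: p_eq)
  define U where "U z = real_of_ereal (usc_env (D \<epsilon>) (u \<epsilon>) z)" for z
  have U: "usc_env (D \<epsilon>) (u \<epsilon>) z = ereal (U z)" if "z \<in> D \<epsilon>" for z
    using finite_env[OF \<epsilon>(1), of z] that real_env_between[of "D \<epsilon>" "u \<epsilon>" z] unfolding U_def D_def by blast
  let ?Q = "cball z0 r \<inter> D \<epsilon>"
  let ?f = "\<lambda>z. U z + - (\<Phi> z + b \<epsilon> z)"
  have "compact ?Q"
    unfolding D_def by (intro compact_Int_closed compact_cball closed_Times X \<epsilon> closed_atLeast)
  moreover have z1_Q: "z1 \<in> ?Q" using z1 by auto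
  then have "?Q \<noteq> {}" by blast
  moreover have "usc_on ?Q ?f"
  proof (rule usc_on_add[OF _ usc_on_continuous])
    show "usc_on ?Q U" by (rule usc_on_env[where E = "D \<epsilon>" and u = "u \<epsilon>"]) (use U in auto)
    have "continuous_on (cball z0 r) (\<lambda>z. - (\<Phi> z + b \<epsilon> z))" by (intro continuous_intros \<Phi> b \<epsilon>)
    then show "continuous_on ?Q (\<lambda>z. - (\<Phi> z + b \<epsilon> z))" by (rule continuous_on_subset) simp
  qed
  ultimately have "\<exists>z\<in>?Q. \<forall>w\<in>?Q. ?f w \<le> ?f z" by (rule usc_on_attains_max)
  then obtain z where z: "z \<in> ?Q" "\<forall>w\<in>?Q. ?f w \<le> ?f z" by (elim bexE)
  define m where "m = ?f z"
  have "\<Phi> z0 - c < U z1"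
    using usc_env_upper[OF z1(1), of "u \<epsilon>"] U[OF z1(1)] z1(3) by simp
  moreover have "?f z1 \<le> ?f z" using z(2) z1_Q by (rule bspec)
  ultimately have m: "- (3 * c) < m" using z1' b_bound[OF \<epsilon>(1), of z1] \<epsilon>(3) by (simp add: m_def)
  have z_ball: "z \<in> ball z0 r"
  proof (rule ccontr)
    assume "z \<notin> ball z0 r"
    then have "z \<in> sphere z0 r" using z(1) by auto
    from sphere[OF \<epsilon>(2,1) this] have "U z < \<Phi> z - r\<^sup>2 / 2" using U z(1) by simp
    then show False using m b_bound[OF \<epsilon>(1), of z] r2 by (simp add: m_def c_def)
  qed
  have "cball z0 r \<inter> D \<epsilon> \<subseteq> {0<..} \<times> X \<epsilon>" using r(2) by (auto simp: D_def)
  with z(1) have z_pos: "z \<in> {0<..} \<times> X \<epsilon>" by blast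
  show thesis
  proof (rule that[OF \<epsilon>(1) z_ball z_pos, of m])
    show "usc_env ({0..} \<times> X \<epsilon>) (u \<epsilon>) z = ereal (\<Phi> z + b \<epsilon> z + m)"
      using U[of z] z(1) by (simp add: m_def D_def)
    fix w assume w: "w \<in> ball z0 r" "w \<in> {0<..} \<times> X \<epsilon>"
    then have "w \<in> ?Q" by (auto simp: D_def)
    with z(2) have "?f w \<le> ?f z" by (rule bspec)
    then show "usc_env ({0..} \<times> X \<epsilon>) (u \<epsilon>) w \<le> ereal (\<Phi> w + b \<epsilon> w + m)"
      using U[of w] \<open>w \<in> ?Q\<close> by (simp add: m_def D_def)
  qed
qed

text \<open>
  Makes the contact at \<open>z0\<close> strict and leaves the derivatives at \<open>z0\<close> unchanged.
\<close>

lemma smooth_test_add_squared_dist: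
  fixes z0 :: "real \<times> 'a::euclidean_space"
  assumes "smooth_test \<phi> \<tau> g"
  shows "smooth_test (\<lambda>z. \<phi> z + ((dist z z0)\<^sup>2 + m)) (\<lambda>z. \<tau> z + 2 * (fst z - fst z0))
    (\<lambda>z. g z + 2 *\<^sub>R (snd z - snd z0))"
proof -
  have "smooth_test (\<lambda>(t, x). ((t - fst z0)\<^sup>2 + m) + 1 * (norm (x - snd z0))\<^sup>2)
      (\<lambda>(t, x). 2 * (t - fst z0)) (\<lambda>(t, x). (2 * 1) *\<^sub>R (x - snd z0))"
    by (rule smooth_test_separated[OF _ _ GDERIV_quadratic])
       (auto intro!: derivative_eq_intros continuous_intros)
  moreover have "(dist z z0)\<^sup>2 + m = ((fst z - fst z0)\<^sup>2 + m) + (norm (snd z - snd z0))\<^sup>2"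
    for z :: "real \<times> 'a"
    by (simp add: dist_prod_def dist_norm)
  ultimately have "smooth_test (\<lambda>z. (dist z z0)\<^sup>2 + m) (\<lambda>z. 2 * (fst z - fst z0)) (\<lambda>z. 2 *\<^sub>R (snd z - snd z0))"
    by (simp only: case_prod_unfold mult_1 mult_1_right)
  from smooth_test_add[OF assms this] show ?thesis .
qed

section \<open>The effective Hamiltonian\<close>

text \<open>
  Here \<open>h i\<close> is the Hamiltonian shared by all edges of direction \<open>i\<close>.
\<close>

definition effective_hamiltonian :: "real \<Rightarrow> ('d::finite \<Rightarrow> real \<Rightarrow> real) \<Rightarrow> real^'d \<Rightarrow> real" where
  "effective_hamiltonian A h p = Max (insert A (range (\<lambda>i. h i (p $ i))))"

lemma effective_hamiltonian_ge: "A \<le> effective_hamiltonian A h p" "h i (p $ i) \<le> effective_hamiltonian A h p"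
  unfolding effective_hamiltonian_def by (rule Max_ge; simp)+

lemma effective_hamiltonian_le:
  assumes "A \<le> c" "\<And>i. h i (p $ i) \<le> c"
  shows "effective_hamiltonian A h p \<le> c"
  using assms by (auto simp: effective_hamiltonian_def)

lemma effective_hamiltonian_attained:
  "effective_hamiltonian A h p = A \<or> (\<exists>i. effective_hamiltonian A h p = h i (p $ i))"
proof -
  have "effective_hamiltonian A h p \<in> insert A (range (\<lambda>i. h i (p $ i)))"
    unfolding effective_hamiltonian_def by (intro Max_in) auto
  then show ?thesis by blast
qed

lemma continuous_effective_hamiltonian:
  fixes h :: "'d::finite \<Rightarrow> real \<Rightarrow> real"
  assumes "\<And>i. continuous_on UNIV (h i)"
  shows "continuous_on UNIV (effective_hamiltonian A h)"
proof -
  have "continuous_on UNIV (\<lambda>p :: real^'d. Max (insert A ((\<lambda>i. h i (p $ i)) ` I)))" for I :: "'d set"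
  proof (induction I rule: finite_induct[OF finite])
    case (2 i I)
    have "continuous_on UNIV (\<lambda>p :: real^'d. h i (p $ i))"
      by (rule continuous_on_compose2[OF assms]) (auto intro!: continuous_intros)
    moreover have "Max (insert A ((\<lambda>i. h i (p $ i)) ` insert i I)) =
        max (h i (p $ i)) (Max (insert A ((\<lambda>i. h i (p $ i)) ` I)))" for p :: "real^'d"
      by (simp only: image_insert insert_commute[of A]) (rule Max_insert, auto)
    ultimately show ?case using 2 by (simp only:) (intro continuous_on_max)
  qed simp
  then show ?thesis unfolding effective_hamiltonian_def .
qed

lemma finite_edges: "finite (edges_starting (y :: int^'d::finite))" "finite (edges_ending y)"
proof -
  have "edges_starting y \<subseteq> range (\<lambda>i. (y, i))"
    by (auto simp: edges_starting_def edge_start_def)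
  then show "finite (edges_starting y)" by (rule finite_subset) simp
  have "edges_ending y \<subseteq> range (\<lambda>i. (y - axis i 1, i))"
    by (auto simp: edges_ending_def edge_end_def)
  then show "finite (edges_ending y)" by (rule finite_subset) simp
qed

lemma F_lim_ge:
  shows "A \<le> F_lim A H p0 y p"
    and "e \<in> edges_starting y \<Longrightarrow> H_minus (H e) (p0 e) (p e) \<le> F_lim A H p0 y p"
    and "e \<in> edges_ending y \<Longrightarrow> H_plus (H e) (p0 e) (p e) \<le> F_lim A H p0 y p"
  unfolding F_lim_def by (auto intro!: Max_ge simp: finite_edges)

text \<open>
  The decreasing and increasing parts of a quasi-convex function lie below it.
\<close>

lemma F_lim_le_effective_hamiltonian:
  assumes H: "\<And>e. H e = h (snd e)"
    and mono: "\<And>e. antimono_on {..p0 e} (H e) \<and> mono_on {p0 e..} (H e)"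
  shows "F_lim A H p0 y (\<lambda>e. q $ snd e) \<le> effective_hamiltonian A h q"
proof -
  have "H e (p0 e) \<le> H e r" if "p0 e < r" for e r
    by (rule monotone_onD[of "{p0 e..}" "(\<le>)" "(\<le>)"]) (use mono that in auto)
  moreover have "H e (p0 e) \<le> H e r" if "r \<le> p0 e" for e r
    using monotone_onD[of "{..p0 e}" "(\<le>)" "(\<ge>)" "H e" r "p0 e"] mono that by auto
  ultimately have "H_minus (H e) (p0 e) r \<le> H e r" "H_plus (H e) (p0 e) r \<le> H e r" for e r
    by (auto simp: H_minus_def H_plus_def)
  moreover have "H e (q $ snd e) \<le> effective_hamiltonian A h q" for e
    unfolding H by (rule effective_hamiltonian_ge)
  ultimately have "H_minus (H e) (p0 e) (q $ snd e) \<le> effective_hamiltonian A h q"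
    "H_plus (H e) (p0 e) (q $ snd e) \<le> effective_hamiltonian A h q" for e
    by (meson order_trans)+
  then show ?thesis
    unfolding F_lim_def using effective_hamiltonian_ge(1)[of A h q]
    by (intro Max.boundedI) (auto simp: finite_edges)
qed

text \<open>
  If the edges of direction \<open>i\<close> through a vertex carry the same slope, one of \<open>H\<^sup>-\<close> on the starting
  edge and \<open>H\<^sup>+\<close> on the ending edge is the full \<open>h i\<close>.  When the two edges come with different
  points \<open>p0\<close>, both are minimizers of \<open>h i\<close>, and \<open>h i\<close> is constant in between.
\<close>

lemma F_lim_ge_straight:
  assumes H: "\<And>e. H e = h (snd e)"
    and mono: "\<And>e. antimono_on {..p0 e} (H e) \<and> mono_on {p0 e..} (H e)"
    and p: "\<And>e. snd e = i \<Longrightarrow> p e = r"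
  shows "h i r \<le> F_lim A H p0 y p"
proof -
  define e1 where "e1 = (y, i)"
  define e2 where "e2 = (y - axis i 1, i)"
  have e1: "e1 \<in> edges_starting y" "H e1 = h i" "p e1 = r"
    using p[of e1] by (auto simp: e1_def edges_starting_def edge_start_def H)
  have e2: "e2 \<in> edges_ending y" "H e2 = h i" "p e2 = r"
    using p[of e2] by (auto simp: e2_def edges_ending_def edge_end_def H)
  consider "r \<le> p0 e1" | "p0 e2 < r" | "p0 e1 < r" "r \<le> p0 e2" by linarith
  then show ?thesis
  proof cases
    case 1
    then have "h i r = H_minus (H e1) (p0 e1) (p e1)" using e1 by (simp add: H_minus_def)
    then show ?thesis using F_lim_ge(2)[OF e1(1), of H p0 p A] by simp
  next
    case 2
    then have "h i r = H_plus (H e2) (p0 e2) (p e2)" using e2 by (simp add: H_plus_def)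
    then show ?thesis using F_lim_ge(3)[OF e2(1), of H p0 p A] by simp
  next
    case 3
    have "mono_on {p0 e1..} (H e1)" using mono by blast
    then have "h i r \<le> h i (p0 e2)"
      using monotone_onD[of "{p0 e1..}" "(\<le>)" "(\<le>)" "H e1" r "p0 e2"] 3 e1 by simp
    also have "\<dots> = H_plus (H e2) (p0 e2) (p e2)" using 3 e2 by (simp add: H_plus_def)
    finally show ?thesis using F_lim_ge(3)[OF e2(1), of H p0 p A] by simp
  qed
qed

lemma uniform_bound:
  fixes B :: "'i::finite \<Rightarrow> real \<Rightarrow> bool"
  assumes "\<And>i. \<exists>c. B i c" "\<And>i c d. B i c \<Longrightarrow> c \<le> d \<Longrightarrow> B i d"
  obtains c where "0 \<le> c" "\<And>i. B i c"
proof -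
  obtain c where c: "\<And>i. B i (c i)" using assms(1) by metis
  show thesis
  proof (rule that[of "\<Sum>i\<in>UNIV. \<bar>c i\<bar>"])
    fix i
    have "c i \<le> \<bar>c i\<bar>" by simp
    also have "\<dots> \<le> (\<Sum>i\<in>UNIV. \<bar>c i\<bar>)" by (rule member_le_sum) auto
    finally show "B i (\<Sum>i\<in>UNIV. \<bar>c i\<bar>)" by (rule assms(2)[OF c])
  qed (rule sum_nonneg, simp)
qed

section \<open>The limit equation\<close>

text \<open>
  The penalty that drives maximum points away from the edges of direction \<open>j \<in> J\<close>: its slope along them
  is \<open>1\<close> or \<open>-1\<close> except for a concave kink at the midpoint, it vanishes along the other edges, and it
  is only of size \<open>O(\<epsilon>)\<close>.
\<close>

definition lattice_gap :: "real \<Rightarrow> 'd::finite set \<Rightarrow> real^'d \<Rightarrow> real" where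
  "lattice_gap \<epsilon> J x = (\<Sum>j\<in>J. \<epsilon> * infdist (x $ j / \<epsilon>) \<int>)"

lemma infdist_Ints_round: "infdist (z :: real) \<int> = \<bar>z - of_int (round z)\<bar>"
proof (rule antisym)
  show "infdist z \<int> \<le> \<bar>z - of_int (round z)\<bar>"
    using infdist_le[of "of_int (round z)" \<int> z] by (simp add: dist_real_def)
  show "\<bar>z - of_int (round z)\<bar> \<le> infdist z \<int>"
  proof -
    have "(\<int> :: real set) \<noteq> {}" using Ints_0 by blast
    then show ?thesis
      unfolding infdist_notempty[OF \<open>(\<int> :: real set) \<noteq> {}\<close>]
      by (rule cINF_greatest) (auto simp: dist_real_def elim!: Ints_cases intro: round_diff_minimal)
  qed
qed

text \<open>
  The penalty has kinks inside edges and is not itself a test function.  It lies below the cone of each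
  vertex, and at a given point it meets the cone of the nearest vertex, which is a test function.
\<close>

lemma lattice_gap_le_cone:
  assumes "0 < \<epsilon>"
  shows "lattice_gap \<epsilon> J x \<le> (\<Sum>j\<in>J. \<bar>x $ j - \<epsilon> * of_int (k $ j)\<bar>)"
  unfolding lattice_gap_def
proof (rule sum_mono)
  fix j
  have "infdist (x $ j / \<epsilon>) \<int> \<le> \<bar>x $ j / \<epsilon> - of_int (k $ j)\<bar>"
    unfolding infdist_Ints_round by (rule round_diff_minimal)
  then have "\<epsilon> * infdist (x $ j / \<epsilon>) \<int> \<le> \<epsilon> * \<bar>x $ j / \<epsilon> - of_int (k $ j)\<bar>"
    using assms by (intro mult_left_mono) auto
  also have "\<dots> = \<bar>\<epsilon> * (x $ j / \<epsilon> - of_int (k $ j))\<bar>" using assms by (simp add: abs_mult)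
  finally show "\<epsilon> * infdist (x $ j / \<epsilon>) \<int> \<le> \<bar>x $ j - \<epsilon> * of_int (k $ j)\<bar>"
    using assms by (simp add: right_diff_distrib)
qed

lemma lattice_gap_eq_cone:
  assumes "0 < \<epsilon>"
  shows "lattice_gap \<epsilon> J x = (\<Sum>j\<in>J. \<bar>x $ j - \<epsilon> * of_int ((\<chi> j. round (x $ j / \<epsilon>)) $ j)\<bar>)"
  unfolding lattice_gap_def
proof (rule sum.cong[OF refl])
  fix j
  have "\<epsilon> * \<bar>x $ j / \<epsilon> - of_int (round (x $ j / \<epsilon>))\<bar> = \<bar>\<epsilon> * (x $ j / \<epsilon> - of_int (round (x $ j / \<epsilon>)))\<bar>"
    using assms by (simp add: abs_mult)
  then show "\<epsilon> * infdist (x $ j / \<epsilon>) \<int> = \<bar>x $ j - \<epsilon> * of_int ((\<chi> j. round (x $ j / \<epsilon>)) $ j)\<bar>"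
    using assms by (simp add: infdist_Ints_round right_diff_distrib)
qed

lemma lattice_gap_bounds:
  assumes "0 < \<epsilon>"
  shows "0 \<le> lattice_gap \<epsilon> J x" "lattice_gap \<epsilon> J x \<le> real (card J) * \<epsilon>"
proof -
  have "0 \<le> \<epsilon> * infdist (x $ j / \<epsilon>) \<int>" "\<epsilon> * infdist (x $ j / \<epsilon>) \<int> \<le> \<epsilon>" for j
  proof -
    have "infdist (x $ j / \<epsilon>) \<int> \<le> 1"
      using of_int_round_abs_le[of "x $ j / \<epsilon>"] by (simp add: infdist_Ints_round abs_minus_commute)
    then show "\<epsilon> * infdist (x $ j / \<epsilon>) \<int> \<le> \<epsilon>" using assms by simp
    show "0 \<le> \<epsilon> * infdist (x $ j / \<epsilon>) \<int>" using assms by (simp add: infdist_nonneg)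
  qed
  then show "0 \<le> lattice_gap \<epsilon> J x" "lattice_gap \<epsilon> J x \<le> real (card J) * \<epsilon>"
    unfolding lattice_gap_def by (auto intro: sum_nonneg sum_bounded_above)
qed

lemma tendsto_nhds_smooth:
  fixes f :: "real \<times> 'a::euclidean_space \<Rightarrow> 'b::topological_space"
  assumes "continuous_on ({0<..} \<times> UNIV) f" "z \<in> {0<..} \<times> UNIV"
  shows "(f \<longlongrightarrow> f z) (nhds z)"
  using assms open_future[where 'a = 'a] by (metis continuous_on_eq_continuous_at isCont_def tendsto_at_iff_tendsto_nhds)

text \<open>
  Let \<open>\<phi>\<close> touch the limit from above at \<open>z0\<close>, put \<open>p = g z0\<close>, and suppose that the inequality fails.
  For the directions \<open>j\<close> with \<open>h j (p $ j) < Hbar p\<close>, collected in \<open>J\<close>, the inequality on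
  edges would give too little, and these edges have to be avoided.  With the
  penalty \<open>K * lattice_gap\<close> the slope along them is changed by \<open>K\<close> or \<open>-K\<close>, and for large \<open>K\<close>
  coercivity rules out a maximum point in their interior.  On the other edges the slope is close to \<open>p $ i\<close>
  with \<open>h i (p $ i) = Hbar p\<close>, and at a vertex \<open>F_lim\<close> is at least \<open>A\<close> and at least
  \<open>h i\<close> of the slope for \<open>i \<notin> J\<close>, one of which is close to \<open>Hbar p\<close>.  Each case contradicts the
  inequality for \<open>u \<epsilon>\<close>.
\<close>

lemma relaxed_limsup_subsolution:
  fixes h :: "'d::finite \<Rightarrow> real \<Rightarrow> real"
  assumes H: "\<And>e. H e = h (snd e)"
    and mono: "\<And>e. antimono_on {..p0 e} (H e) \<and> mono_on {p0 e..} (H e)"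
    and cont: "\<And>i. continuous_on UNIV (h i)"
    and coercive: "\<And>c. \<exists>R. \<forall>i q. R \<le> \<bar>q\<bar> \<longrightarrow> c < h i q"
    and sub: "\<And>\<epsilon>. 0 < \<epsilon> \<Longrightarrow> network_subsolution \<epsilon> H (F_lim A H p0) (u \<epsilon>)"
    and finite_env: "\<And>\<epsilon> z. 0 < \<epsilon> \<Longrightarrow> z \<in> {0..} \<times> network \<epsilon> \<Longrightarrow>
      \<exists>c. usc_env ({0..} \<times> network \<epsilon>) (u \<epsilon>) z \<le> ereal c"
    and v: "\<And>z. z \<in> {0..} \<times> UNIV \<Longrightarrow>
      usc_env (relaxed_domain network) (\<lambda>(\<epsilon>, z). u \<epsilon> z) (0, z) = ereal (v z)"
  shows "space_subsolution (effective_hamiltonian A h) v"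
  unfolding space_subsolution_def
proof (intro allI impI, elim conjE)
  fix \<phi> t0 x0
  assume C1: "C1_on ({0<..} \<times> UNIV) \<phi>" and t0: "0 < t0"
    and touch: "touches_from_above UNIV \<phi> v (t0, x0)"
  let ?H = "effective_hamiltonian A h"
  define z0 where "z0 = (t0, x0)"
  obtain \<tau> g where \<phi>: "smooth_test \<phi> \<tau> g" using C1_on_smooth_test[OF C1] .
  have v_usc: "usc_env ({0..} \<times> UNIV) v z = ereal (v z)" if z: "z \<in> {0..} \<times> UNIV" for z
  proof (rule usc_env_of_usc_on[OF _ z])
    have "usc_on ({0 :: real} \<times> {0..} \<times> UNIV) (\<lambda>p. v (snd p))"
      by (rule usc_on_env[where E = "relaxed_domain network" and u = "\<lambda>(\<epsilon>, z). u \<epsilon> z"]) (use v in auto)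
    then have "usc_on ({0..} \<times> UNIV) (\<lambda>z. (\<lambda>p. v (snd p)) (0 :: real, z))"
      by (rule usc_on_compose) (auto intro!: continuous_intros)
    then show "usc_on ({0..} \<times> UNIV) v" by simp
  qed
  have "\<tau> z0 + ?H (g z0) \<le> 0"
  proof (rule ccontr)
    assume "\<not> ?thesis"
    then have \<theta>: "0 < \<tau> z0 + ?H (g z0)" by simp
    define J where "J = {j. h j (g z0 $ j) < ?H (g z0)}"
    obtain R where R: "\<And>i q. R \<le> \<bar>q\<bar> \<Longrightarrow> 1 - \<tau> z0 < h i q" using coercive by blast
    \<comment> \<open>The gradient stays within \<open>norm (g z0) + 1\<close> near \<open>z0\<close>, so a slope changed by \<open>K\<close> or \<open>-K\<close> is at
       least \<open>R\<close> in modulus.\<close>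
    define K where "K = \<bar>R\<bar> + norm (g z0) + 1"
    have K: "0 \<le> K" by (simp add: K_def add_nonneg_nonneg)
    let ?\<tau> = "\<lambda>z. \<tau> z + 2 * (fst z - fst z0)"
    let ?g = "\<lambda>z. g z + 2 *\<^sub>R (snd z - snd z0)"
    let ?\<Phi> = "\<lambda>m z. \<phi> z + ((dist z z0)\<^sup>2 + m)"
    have smooth: "smooth_test (?\<Phi> m) ?\<tau> ?g" for m by (rule smooth_test_add_squared_dist[OF \<phi>])
    have z0: "z0 \<in> {0<..} \<times> UNIV" using t0 by (simp add: z0_def)
    have lim_\<tau>: "(?\<tau> \<longlongrightarrow> \<tau> z0) (nhds z0)" and lim_g: "(?g \<longlongrightarrow> g z0) (nhds z0)"
      using tendsto_nhds_smooth[OF smooth_test_continuous_on(2)[OF smooth[of 0] order_refl] z0]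
        tendsto_nhds_smooth[OF smooth_test_continuous_on(3)[OF smooth[of 0] order_refl] z0] by simp_all
    have lim_gi: "((\<lambda>z. ?g z $ i) \<longlongrightarrow> g z0 $ i) (nhds z0)" for i by (rule tendsto_vec_nth[OF lim_g])
    have lim_h: "((\<lambda>z. h i (?g z $ i)) \<longlongrightarrow> h i (g z0 $ i)) (nhds z0)" for i
      using continuous_on_tendsto_compose[OF cont lim_gi] by simp
    have ev_time: "\<forall>\<^sub>F z in nhds z0. \<tau> z0 - 1 < ?\<tau> z"
      by (rule order_tendstoD(1)[OF lim_\<tau>]) simp
    have ev_A: "\<forall>\<^sub>F z in nhds z0. ?H (g z0) = A \<longrightarrow> 0 < ?\<tau> z + A"
    proof (cases "?H (g z0) = A")
      case True
      then have "\<forall>\<^sub>F z in nhds z0. - A < ?\<tau> z"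
        by (intro order_tendstoD(1)[OF lim_\<tau>]) (use \<theta> in simp)
      then show ?thesis by eventually_elim simp
    qed simp
    have ev_h: "\<forall>\<^sub>F z in nhds z0. \<forall>i. i \<notin> J \<longrightarrow> 0 < ?\<tau> z + h i (?g z $ i)"
    proof (intro eventually_all_finite)
      fix i
      show "\<forall>\<^sub>F z in nhds z0. i \<notin> J \<longrightarrow> 0 < ?\<tau> z + h i (?g z $ i)"
      proof (cases "i \<in> J")
        case False
        then have "0 < \<tau> z0 + h i (g z0 $ i)"
          using \<theta> effective_hamiltonian_ge(2)[of h i "g z0" A] by (simp add: J_def)
        then have "\<forall>\<^sub>F z in nhds z0. 0 < ?\<tau> z + h i (?g z $ i)"
          by (rule order_tendstoD(1)[OF tendsto_add[OF lim_\<tau> lim_h]])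
        then show ?thesis by eventually_elim simp
      qed simp
    qed
    have ev_g: "\<forall>\<^sub>F z in nhds z0. norm (?g z) < norm (g z0) + 1"
      by (rule order_tendstoD(2)[OF tendsto_norm[OF lim_g]]) simp
    have ev_pos: "\<forall>\<^sub>F z in nhds z0. z \<in> {0<..} \<times> UNIV"
      by (rule eventually_nhds_in_open[OF open_future z0])
    have ev_touch: "\<forall>\<^sub>F z in nhds z0. z \<in> {0<..} \<times> UNIV \<longrightarrow> v z \<le> \<phi> z"
    proof -
      have "\<forall>\<^sub>F z in nhds z0. z \<noteq> z0 \<longrightarrow> z \<in> {0<..} \<times> UNIV \<longrightarrow> usc_env ({0..} \<times> UNIV) v z \<le> ereal (\<phi> z)"
        using touch unfolding touches_from_above_def eventually_at_filter z0_def by blast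
      then show ?thesis
      proof eventually_elim
        case (elim z)
        show ?case
        proof
          assume z: "z \<in> {0<..} \<times> UNIV"
          then have "usc_env ({0..} \<times> UNIV) v z = ereal (v z)" by (intro v_usc) auto
          then show "v z \<le> \<phi> z"
            using elim z touch by (cases "z = z0") (auto simp: touches_from_above_def z0_def)
        qed
      qed
    qed
    from ev_time ev_A ev_h ev_g ev_pos ev_touch
    have "\<forall>\<^sub>F z in nhds z0. \<tau> z0 - 1 < ?\<tau> z \<and> (?H (g z0) = A \<longrightarrow> 0 < ?\<tau> z + A) \<and>
      (\<forall>i. i \<notin> J \<longrightarrow> 0 < ?\<tau> z + h i (?g z $ i)) \<and> norm (?g z) < norm (g z0) + 1 \<and>
      z \<in> {0<..} \<times> UNIV \<and> v z \<le> \<phi> z"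
      by eventually_elim blast
    then obtain r where r: "0 < r" and near: "\<And>z. dist z z0 \<le> r \<Longrightarrow> \<tau> z0 - 1 < ?\<tau> z \<and>
      (?H (g z0) = A \<longrightarrow> 0 < ?\<tau> z + A) \<and> (\<forall>i. i \<notin> J \<longrightarrow> 0 < ?\<tau> z + h i (?g z $ i)) \<and>
      norm (?g z) < norm (g z0) + 1 \<and> z \<in> {0<..} \<times> UNIV \<and> v z \<le> \<phi> z"
      unfolding eventually_nhds_metric_le by blast
    have cball_pos: "cball z0 r \<subseteq> {0<..} \<times> UNIV" using near by (auto simp: dist_commute)
    have vz0: "v z0 = \<phi> z0"
      using touch v_usc[of z0] t0 by (simp add: touches_from_above_def z0_def)
    have v0: "usc_env (relaxed_domain network) (\<lambda>(\<epsilon>, z). u \<epsilon> z) (0, z) = ereal (v z)" if "z \<in> cball z0 r" for z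
      by (rule v) (use cball_pos that in force)
    obtain \<epsilon> z m where \<epsilon>: "0 < \<epsilon>" and z: "z \<in> ball z0 r" "z \<in> {0<..} \<times> network \<epsilon>"
      and z_eq: "usc_env ({0..} \<times> network \<epsilon>) (u \<epsilon>) z = ereal (?\<Phi> 0 z + K * lattice_gap \<epsilon> J (snd z) + m)"
      and z_max: "\<And>w. w \<in> ball z0 r \<Longrightarrow> w \<in> {0<..} \<times> network \<epsilon> \<Longrightarrow>
        usc_env ({0..} \<times> network \<epsilon>) (u \<epsilon>) w \<le> ereal (?\<Phi> 0 w + K * lattice_gap \<epsilon> J (snd w) + m)"
    proof (rule relaxed_limit_local_max[of network u r z0 "?\<Phi> 0" "\<lambda>\<epsilon> z. K * lattice_gap \<epsilon> J (snd z)" "K * real (card J)"])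
      show "continuous_on (cball z0 r) (?\<Phi> 0)"
        by (rule smooth_test_continuous_on(1)[OF smooth cball_pos])
      show "usc_env (relaxed_domain network) (\<lambda>(\<epsilon>, z). u \<epsilon> z) (0, z0) = ereal (?\<Phi> 0 z0)"
        using v0[of z0] r vz0 by simp
      show "usc_env (relaxed_domain network) (\<lambda>(\<epsilon>, z). u \<epsilon> z) (0, z) \<le> ereal (?\<Phi> 0 z - (dist z z0)\<^sup>2)"
        if "z \<in> cball z0 r" for z
        using v0[OF that] near[of z] that by (simp add: dist_commute)
      show "continuous_on (cball z0 r) (\<lambda>z. K * lattice_gap \<epsilon> J (snd z))" if "0 < \<epsilon>" for \<epsilon>
        unfolding lattice_gap_def using that by (intro continuous_intros) auto
      show "0 \<le> K * lattice_gap \<epsilon> J (snd z) \<and> K * lattice_gap \<epsilon> J (snd z) \<le> K * real (card J) * \<epsilon>"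
        if "0 < \<epsilon>" for \<epsilon> z
        using lattice_gap_bounds[OF that, of J "snd z"] K by (simp add: mult_left_mono mult.assoc)
    qed (use r cball_pos closed_network finite_env in auto)
    obtain t x where tx: "z = (t, x)" by (cases z)
    have t: "0 < t" and x: "x \<in> network \<epsilon>" using z(2) by (auto simp: tx)
    define k where "k = (\<chi> j. round (x $ j / \<epsilon>))"
    obtain \<kappa> where \<kappa>: "edgewise_affine \<epsilon> (\<lambda>x. K * (\<Sum>j\<in>J. \<bar>x $ j - \<epsilon> * of_int (k $ j)\<bar>)) \<kappa>"
      and \<kappa>_J: "\<And>e. snd e \<notin> J \<Longrightarrow> \<kappa> e = 0" "\<And>e. snd e \<in> J \<Longrightarrow> \<bar>\<kappa> e\<bar> = K"
      using edgewise_affine_cone[OF \<epsilon> K, of k J] by blast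
    have "touches_from_above (network \<epsilon>)
      (\<lambda>(t, x). ?\<Phi> m (t, x) + K * (\<Sum>j\<in>J. \<bar>x $ j - \<epsilon> * of_int (k $ j)\<bar>)) (u \<epsilon>) z"
    proof (rule touches_from_aboveI[OF _ open_ball z(1)])
      show "usc_env ({0..} \<times> network \<epsilon>) (u \<epsilon>) z =
        ereal ((\<lambda>(t, x). ?\<Phi> m (t, x) + K * (\<Sum>j\<in>J. \<bar>x $ j - \<epsilon> * of_int (k $ j)\<bar>)) z)"
        unfolding z_eq using lattice_gap_eq_cone[OF \<epsilon>, of J x] by (simp add: tx k_def)
      fix w assume w: "w \<in> ball z0 r" "w \<in> {0<..} \<times> network \<epsilon>"
      have "K * lattice_gap \<epsilon> J (snd w) \<le> K * (\<Sum>j\<in>J. \<bar>snd w $ j - \<epsilon> * of_int (k $ j)\<bar>)"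
        by (intro mult_left_mono lattice_gap_le_cone \<epsilon> K)
      then have "ereal (?\<Phi> 0 w + K * lattice_gap \<epsilon> J (snd w) + m) \<le>
          ereal ((\<lambda>(t, x). ?\<Phi> m (t, x) + K * (\<Sum>j\<in>J. \<bar>x $ j - \<epsilon> * of_int (k $ j)\<bar>)) w)"
        by (simp add: case_prod_unfold)
      with z_max[OF w] show "usc_env ({0..} \<times> network \<epsilon>) (u \<epsilon>) w \<le>
          ereal ((\<lambda>(t, x). ?\<Phi> m (t, x) + K * (\<Sum>j\<in>J. \<bar>x $ j - \<epsilon> * of_int (k $ j)\<bar>)) w)"
        by (rule order_trans)
    qed
    then have touch': "touches_from_above (network \<epsilon>)
      (\<lambda>(t, x). ?\<Phi> m (t, x) + K * (\<Sum>j\<in>J. \<bar>x $ j - \<epsilon> * of_int (k $ j)\<bar>)) (u \<epsilon>) (t, x)"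
      by (simp only: tx)
    have near_z: "\<tau> z0 - 1 < ?\<tau> z" "?H (g z0) = A \<Longrightarrow> 0 < ?\<tau> z + A"
      "\<And>i. i \<notin> J \<Longrightarrow> 0 < ?\<tau> z + h i (?g z $ i)" "norm (?g z) < norm (g z0) + 1"
      using near[of z] z(1) by (auto simp: dist_commute)
    from network_subsolutionD[OF sub[OF \<epsilon>] \<epsilon> smooth \<kappa> t x touch'] show False
    proof cases
      case (1 e)
      then have e: "?\<tau> z + h (snd e) (?g z $ snd e + \<kappa> e) \<le> 0" by (simp only: tx H)
      show False
      proof (cases "snd e \<in> J")
        case True
        have "\<bar>?g z $ snd e\<bar> < norm (g z0) + 1"
          using component_le_norm_cart[of "?g z" "snd e"] near_z(4) by linarith
        then have "R \<le> \<bar>?g z $ snd e + \<kappa> e\<bar>"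
          using \<kappa>_J(2)[OF True] by (simp add: K_def)
        from R[OF this, of "snd e"] e near_z(1) show False by linarith
      next
        case False
        from near_z(3)[OF this] e \<kappa>_J(1)[OF False] show False by simp
      qed
    next
      case (2 y)
      then have y: "?\<tau> z + F_lim A H p0 y (\<lambda>e. ?g z $ snd e + \<kappa> e) \<le> 0" by (simp only: tx)
      show False
      proof (cases "?H (g z0) = A")
        case True
        from near_z(2)[OF True] y F_lim_ge(1)[of A H p0 y "\<lambda>e. ?g z $ snd e + \<kappa> e"] show False by linarith
      next
        case False
        then obtain i where i: "?H (g z0) = h i (g z0 $ i)"
          using effective_hamiltonian_attained[of A h "g z0"] by blast
        then have "i \<notin> J" by (simp add: J_def)
        have "h i (?g z $ i) \<le> F_lim A H p0 y (\<lambda>e. ?g z $ snd e + \<kappa> e)"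
          by (rule F_lim_ge_straight[of H h p0, OF H mono]) (use \<open>i \<notin> J\<close> \<kappa>_J(1) in auto)
        with near_z(3)[OF \<open>i \<notin> J\<close>] y show False by linarith
      qed
    qed
  qed
  then show "time_deriv \<phi> t0 x0 + ?H (gradient (\<lambda>y. \<phi> (t0, y)) x0) \<le> 0"
    by (simp add: smooth_test_time_deriv[OF \<phi> t0] smooth_test_gradient[OF \<phi> t0] z0_def)
qed

lemma usc_env_relaxed_uminus:
  "usc_env S (\<lambda>(\<epsilon>, z). - u \<epsilon> z) p = - lsc_env S (\<lambda>(\<epsilon>, z). u \<epsilon> z) p"
  by (simp add: lsc_env_uminus case_prod_unfold)

text \<open>
  A smooth function has equal slopes on both sides of a vertex, so on edges and at vertices
  alike the network equation for it carries a Hamiltonian that is at most \<open>Hbar\<close> of its gradient.  The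
  inequality for \<open>u \<epsilon>\<close> therefore passes to the limit directly.
\<close>

lemma relaxed_liminf_supersolution:
  fixes h :: "'d::finite \<Rightarrow> real \<Rightarrow> real"
  assumes H: "\<And>e. H e = h (snd e)"
    and mono: "\<And>e. antimono_on {..p0 e} (H e) \<and> mono_on {p0 e..} (H e)"
    and cont: "\<And>i. continuous_on UNIV (h i)"
    and super: "\<And>\<epsilon>. 0 < \<epsilon> \<Longrightarrow> network_supersolution \<epsilon> H (F_lim A H p0) (u \<epsilon>)"
    and finite_env: "\<And>\<epsilon> z. 0 < \<epsilon> \<Longrightarrow> z \<in> {0..} \<times> network \<epsilon> \<Longrightarrow>
      \<exists>c. ereal c \<le> lsc_env ({0..} \<times> network \<epsilon>) (u \<epsilon>) z"
    and v: "\<And>z. z \<in> {0..} \<times> UNIV \<Longrightarrow>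
      lsc_env (relaxed_domain network) (\<lambda>(\<epsilon>, z). u \<epsilon> z) (0, z) = ereal (v z)"
  shows "space_supersolution (effective_hamiltonian A h) v"
  unfolding space_supersolution_def
proof (intro allI impI, elim conjE)
  fix \<phi> t0 x0
  assume C1: "C1_on ({0<..} \<times> UNIV) \<phi>" and t0: "0 < t0"
    and touch: "touches_from_below UNIV \<phi> v (t0, x0)"
  let ?H = "effective_hamiltonian A h"
  define z0 where "z0 = (t0, x0)"
  obtain \<tau> g where \<phi>: "smooth_test \<phi> \<tau> g" using C1_on_smooth_test[OF C1] .
  have v': "usc_env (relaxed_domain network) (\<lambda>(\<epsilon>, z). - u \<epsilon> z) (0, z) = ereal (- v z)"
    if "z \<in> {0..} \<times> UNIV" for z
    using v[OF that] by (simp add: usc_env_relaxed_uminus)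
  have v_lsc: "lsc_env ({0..} \<times> UNIV) v z = ereal (v z)" if z: "z \<in> {0..} \<times> UNIV" for z
  proof -
    have "usc_on ({0 :: real} \<times> {0..} \<times> UNIV) (\<lambda>p. - v (snd p))"
      by (rule usc_on_env[where E = "relaxed_domain network" and u = "\<lambda>(\<epsilon>, z). - u \<epsilon> z"]) (use v' in auto)
    then have "usc_on ({0..} \<times> UNIV) (\<lambda>z. (\<lambda>p. - v (snd p)) (0 :: real, z))"
      by (rule usc_on_compose) (auto intro!: continuous_intros)
    then have "usc_env ({0..} \<times> UNIV) (\<lambda>z. - v z) z = ereal (- v z)"
      by (intro usc_env_of_usc_on[OF _ z]) simp
    then show ?thesis by (simp add: lsc_env_uminus)
  qed
  have "0 \<le> \<tau> z0 + ?H (g z0)"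
  proof (rule ccontr)
    assume "\<not> ?thesis"
    then have \<theta>: "\<tau> z0 + ?H (g z0) < 0" by simp
    let ?\<tau> = "\<lambda>z. - (- \<tau> z + 2 * (fst z - fst z0))"
    let ?g = "\<lambda>z. - (- g z + 2 *\<^sub>R (snd z - snd z0))"
    let ?\<Phi> = "\<lambda>m z. - \<phi> z + ((dist z z0)\<^sup>2 + m)"
    have smooth: "smooth_test (?\<Phi> m) (\<lambda>z. - \<tau> z + 2 * (fst z - fst z0)) (\<lambda>z. - g z + 2 *\<^sub>R (snd z - snd z0))" for m
      by (rule smooth_test_add_squared_dist[OF smooth_test_uminus[OF \<phi>]])
    have smooth': "smooth_test (\<lambda>z. - ?\<Phi> m z) ?\<tau> ?g" for m
      by (rule smooth_test_uminus[OF smooth])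
    have z0: "z0 \<in> {0<..} \<times> UNIV" using t0 by (simp add: z0_def)
    have lim_\<tau>: "(?\<tau> \<longlongrightarrow> \<tau> z0) (nhds z0)" and lim_g: "(?g \<longlongrightarrow> g z0) (nhds z0)"
      using tendsto_nhds_smooth[OF smooth_test_continuous_on(2)[OF smooth'[of 0] order_refl] z0]
        tendsto_nhds_smooth[OF smooth_test_continuous_on(3)[OF smooth'[of 0] order_refl] z0] by simp_all
    have "((\<lambda>z. ?H (?g z)) \<longlongrightarrow> ?H (g z0)) (nhds z0)"
      using continuous_on_tendsto_compose[OF continuous_effective_hamiltonian[OF cont] lim_g] by simp
    from order_tendstoD(2)[OF tendsto_add[OF lim_\<tau> this] \<theta>]
    have ev_H: "\<forall>\<^sub>F z in nhds z0. ?\<tau> z + ?H (?g z) < 0" .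
    have ev_pos: "\<forall>\<^sub>F z in nhds z0. z \<in> {0<..} \<times> UNIV"
      by (rule eventually_nhds_in_open[OF open_future z0])
    have ev_touch: "\<forall>\<^sub>F z in nhds z0. z \<in> {0<..} \<times> UNIV \<longrightarrow> \<phi> z \<le> v z"
    proof -
      have "\<forall>\<^sub>F z in nhds z0. z \<noteq> z0 \<longrightarrow> z \<in> {0<..} \<times> UNIV \<longrightarrow> ereal (\<phi> z) \<le> lsc_env ({0..} \<times> UNIV) v z"
        using touch unfolding touches_from_below_def eventually_at_filter z0_def by blast
      then show ?thesis
      proof eventually_elim
        case (elim z)
        show ?case
        proof
          assume z: "z \<in> {0<..} \<times> UNIV"
          then have "lsc_env ({0..} \<times> UNIV) v z = ereal (v z)" by (intro v_lsc) auto
          then show "\<phi> z \<le> v z"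
            using elim z touch by (cases "z = z0") (auto simp: touches_from_below_def z0_def)
        qed
      qed
    qed
    from ev_H ev_pos ev_touch
    have "\<forall>\<^sub>F z in nhds z0. ?\<tau> z + ?H (?g z) < 0 \<and> z \<in> {0<..} \<times> UNIV \<and> \<phi> z \<le> v z"
      by eventually_elim blast
    then obtain r where r: "0 < r" and near: "\<And>z. dist z z0 \<le> r \<Longrightarrow>
      ?\<tau> z + ?H (?g z) < 0 \<and> z \<in> {0<..} \<times> UNIV \<and> \<phi> z \<le> v z"
      unfolding eventually_nhds_metric_le by blast
    have cball_pos: "cball z0 r \<subseteq> {0<..} \<times> UNIV" using near by (auto simp: dist_commute)
    have vz0: "v z0 = \<phi> z0"
      using touch v_lsc[of z0] t0 by (simp add: touches_from_below_def z0_def)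
    have v0: "usc_env (relaxed_domain network) (\<lambda>(\<epsilon>, z). - u \<epsilon> z) (0, z) = ereal (- v z)" if "z \<in> cball z0 r" for z
      by (rule v') (use cball_pos that in force)
    obtain \<epsilon> z m where \<epsilon>: "0 < \<epsilon>" and z: "z \<in> ball z0 r" "z \<in> {0<..} \<times> network \<epsilon>"
      and z_eq: "usc_env ({0..} \<times> network \<epsilon>) (\<lambda>z. - u \<epsilon> z) z = ereal (?\<Phi> 0 z + 0 + m)"
      and z_max: "\<And>w. w \<in> ball z0 r \<Longrightarrow> w \<in> {0<..} \<times> network \<epsilon> \<Longrightarrow>
        usc_env ({0..} \<times> network \<epsilon>) (\<lambda>z. - u \<epsilon> z) w \<le> ereal (?\<Phi> 0 w + 0 + m)"
    proof (rule relaxed_limit_local_max[of network "\<lambda>\<epsilon> z. - u \<epsilon> z" r z0 "?\<Phi> 0" "\<lambda>_ _. 0" 0])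
      show "continuous_on (cball z0 r) (?\<Phi> 0)"
        by (rule smooth_test_continuous_on(1)[OF smooth cball_pos])
      show "usc_env (relaxed_domain network) (\<lambda>(\<epsilon>, z). - u \<epsilon> z) (0, z0) = ereal (?\<Phi> 0 z0)"
        using v0[of z0] r vz0 by simp
      show "usc_env (relaxed_domain network) (\<lambda>(\<epsilon>, z). - u \<epsilon> z) (0, z) \<le> ereal (?\<Phi> 0 z - (dist z z0)\<^sup>2)"
        if "z \<in> cball z0 r" for z
        using v0[OF that] near[of z] that by (simp add: dist_commute)
      show "\<exists>c. usc_env ({0..} \<times> network \<epsilon>) (\<lambda>z. - u \<epsilon> z) z \<le> ereal c"
        if "0 < \<epsilon>" "z \<in> {0..} \<times> network \<epsilon>" for \<epsilon> z
      proof -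
        obtain c where "ereal c \<le> lsc_env ({0..} \<times> network \<epsilon>) (u \<epsilon>) z" using finite_env \<open>0 < \<epsilon>\<close> \<open>z \<in> {0..} \<times> network \<epsilon>\<close> by blast
        then show ?thesis
          by (intro exI[of _ "- c"]) (simp add: usc_env_uminus flip: uminus_ereal.simps(1))
      qed
    qed (use r cball_pos closed_network in auto)
    obtain t x where tx: "z = (t, x)" by (cases z)
    have t: "0 < t" and x: "x \<in> network \<epsilon>" using z(2) by (auto simp: tx)
    have "touches_from_above (network \<epsilon>) (?\<Phi> m) (\<lambda>z. - u \<epsilon> z) z"
    proof (rule touches_from_aboveI[OF _ open_ball z(1)])
      show "usc_env ({0..} \<times> network \<epsilon>) (\<lambda>z. - u \<epsilon> z) z = ereal (?\<Phi> m z)"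
        using z_eq by simp
      fix w assume w: "w \<in> ball z0 r" "w \<in> {0<..} \<times> network \<epsilon>"
      from z_max[OF this]
      show "usc_env ({0..} \<times> network \<epsilon>) (\<lambda>z. - u \<epsilon> z) w \<le> ereal (?\<Phi> m w)"
        by (simp add: algebra_simps)
    qed
    then have touch': "touches_from_below (network \<epsilon>) (\<lambda>z. - ?\<Phi> m z) (u \<epsilon>) (t, x)"
      unfolding touches_from_above_uminus tx .
    have near_z: "?\<tau> z + ?H (?g z) < 0"
      using near[of z] z(1) by (auto simp: dist_commute)
    from network_supersolutionD[OF super[OF \<epsilon>] \<epsilon> smooth' t x touch'] show False
    proof cases
      case (1 e)
      then have "0 \<le> ?\<tau> z + h (snd e) (?g z $ snd e)" by (simp only: tx H)
      with effective_hamiltonian_ge(2)[of h "snd e" "?g z" A] near_z show False by linarith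
    next
      case (2 y)
      then have "0 \<le> ?\<tau> z + F_lim A H p0 y (\<lambda>e. ?g z $ snd e)" by (simp only: tx)
      with F_lim_le_effective_hamiltonian[of H h p0 A y "?g z", OF H mono] near_z show False by linarith
    qed
  qed
  then show "0 \<le> time_deriv \<phi> t0 x0 + ?H (gradient (\<lambda>y. \<phi> (t0, y)) x0)"
    by (simp add: smooth_test_time_deriv[OF \<phi> t0] smooth_test_gradient[OF \<phi> t0] z0_def)
qed

lemma tendsto_vertex_floor:
  fixes x :: "real^'d::finite"
  shows "((\<lambda>\<epsilon>. vertex_pt \<epsilon> (\<chi> j. \<lfloor>x $ j / \<epsilon>\<rfloor>)) \<longlongrightarrow> x) (at_right 0)"
proof (rule vec_tendstoI)
  fix j
  have "\<bar>vertex_pt \<epsilon> (\<chi> j. \<lfloor>x $ j / \<epsilon>\<rfloor>) $ j - x $ j\<bar> \<le> \<epsilon>" if "0 < \<epsilon>" for \<epsilon>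
  proof -
    have "\<bar>of_int \<lfloor>x $ j / \<epsilon>\<rfloor> - x $ j / \<epsilon>\<bar> \<le> 1" by linarith
    then have "\<epsilon> * \<bar>of_int \<lfloor>x $ j / \<epsilon>\<rfloor> - x $ j / \<epsilon>\<bar> \<le> \<epsilon> * 1"
      by (rule mult_left_mono) (use that in simp)
    also have "\<epsilon> * \<bar>of_int \<lfloor>x $ j / \<epsilon>\<rfloor> - x $ j / \<epsilon>\<bar> = \<bar>\<epsilon> * (of_int \<lfloor>x $ j / \<epsilon>\<rfloor> - x $ j / \<epsilon>)\<bar>"
      using that by (simp add: abs_mult)
    finally show ?thesis using that by (simp add: right_diff_distrib)
  qed
  then have "\<forall>\<^sub>F \<epsilon> in at_right 0. norm (vertex_pt \<epsilon> (\<chi> j. \<lfloor>x $ j / \<epsilon>\<rfloor>) $ j - x $ j) \<le> \<epsilon>"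
    unfolding real_norm_def by (intro eventually_at_right_less[THEN eventually_mono]) 
  then have "((\<lambda>\<epsilon>. vertex_pt \<epsilon> (\<chi> j. \<lfloor>x $ j / \<epsilon>\<rfloor>) $ j - x $ j) \<longlongrightarrow> 0) (at_right 0)"
    by (rule Lim_null_comparison) (rule tendsto_ident_at)
  then show "((\<lambda>\<epsilon>. vertex_pt \<epsilon> (\<chi> j. \<lfloor>x $ j / \<epsilon>\<rfloor>) $ j) \<longlongrightarrow> x $ j) (at_right 0)"
    by (simp only: LIM_zero_iff)
qed

text \<open>
  The vertices obtained from \<open>x\<close> by rounding down in the mesh converge to \<open>x\<close>.
\<close>

lemma relaxed_domain_accumulates:
  fixes x :: "real^'d::finite"
  assumes "0 \<le> t"
  shows "inf (nhds (0, t, x)) (principal (relaxed_domain network)) \<noteq> bot"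
proof
  let ?p = "\<lambda>\<epsilon>. (\<epsilon>, t, vertex_pt \<epsilon> (\<chi> j. \<lfloor>x $ j / \<epsilon>\<rfloor>))"
  assume "inf (nhds (0, t, x)) (principal (relaxed_domain network)) = bot"
  then have "\<forall>\<^sub>F p in nhds (0, t, x). p \<notin> relaxed_domain network"
    unfolding trivial_limit_def eventually_inf_principal by (auto elim: eventually_mono)
  moreover have "filterlim ?p (nhds (0, t, x)) (at_right 0)"
    by (intro tendsto_Pair tendsto_const tendsto_ident_at tendsto_vertex_floor)
  ultimately have "\<forall>\<^sub>F \<epsilon> in at_right 0. ?p \<epsilon> \<notin> relaxed_domain network"
    by (rule eventually_compose_filterlim)
  moreover have "\<forall>\<^sub>F \<epsilon> :: real in at_right 0. 0 < \<epsilon>" by (rule eventually_at_right_less)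
  ultimately have "\<forall>\<^sub>F \<epsilon> :: real in at_right 0. False"
    by eventually_elim (use assms vertex_pt_in_network in \<open>auto simp: relaxed_domain_def\<close>)
  then show False by simp
qed

section \<open>Homogenization\<close>

theorem theorem8p2:
  fixes A :: real
    and H :: "'d::finite edge \<Rightarrow> real \<Rightarrow> real"
    and p0 :: "'d edge \<Rightarrow> real"
    and u0 :: "real^'d \<Rightarrow> real"
    and u :: "real \<Rightarrow> real \<times> (real^'d) \<Rightarrow> real"
  assumes H0: "\<And>e. continuous_on UNIV (H e)"
    and H1: "\<And>e. Liminf at_infinity (\<lambda>q. ereal (H e q)) = \<infinity>"
    and H2: "\<And>e. antimono_on {..p0 e} (H e) \<and> mono_on {p0 e..} (H e)"
    and H3: "\<And>e m. H (shift_edge m e) = H e"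
    and u0_Lipschitz: "\<exists>L. L-lipschitz_on UNIV u0"
    and u_solution: "\<And>\<epsilon>. 0 < \<epsilon> \<Longrightarrow> network_solution \<epsilon> H (F_lim A H p0) u0 (u \<epsilon>)"
  shows "\<exists>Hbar :: real^'d \<Rightarrow> real. continuous_on UNIV Hbar \<and>
    (\<exists>ubar. unique_space_solution Hbar u0 ubar \<and>
      (\<forall>t\<ge>0. \<forall>x.
        ((\<lambda>(\<epsilon>, s, y). u \<epsilon> (s, y)) \<longlongrightarrow> ubar (t, x))
          (at (0, t, x) within {(\<epsilon>, s, y). 0 < \<epsilon> \<and> 0 \<le> s \<and> y \<in> network \<epsilon>})))"
proof -
  define h where "h i = H (0, i)" for i
  have H: "H e = h (snd e)" for e
    using H3[of "fst e" "(0, snd e)"] by (simp add: h_def shift_edge_def)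
  have cont: "continuous_on UNIV (h i)" for i unfolding h_def by (rule H0)
  let ?H = "effective_hamiltonian A h"
  have H_cont: "continuous_on UNIV ?H" by (rule continuous_effective_hamiltonian[OF cont])
  have coercive: "\<exists>R. \<forall>i q. R \<le> \<bar>q\<bar> \<longrightarrow> c < h i q" for c
  proof -
    have "\<exists>R. \<forall>q. R \<le> \<bar>q\<bar> \<longrightarrow> c < h i q" for i
    proof -
      have "ereal c < Liminf at_infinity (\<lambda>q. ereal (h i q))" unfolding h_def H1 by simp
      from less_LiminfD[OF this] show ?thesis by (simp add: eventually_at_infinity)
    qed
    then obtain R where "\<And>i. \<forall>q. R \<le> \<bar>q\<bar> \<longrightarrow> c < h i q"
      by (rule uniform_bound[of "\<lambda>i R. \<forall>q. R \<le> \<bar>q\<bar> \<longrightarrow> c < h i q"]) auto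
    then show ?thesis by blast
  qed
  obtain L where lip: "L-lipschitz_on UNIV u0" using u0_Lipschitz by blast
  obtain C1 where C1: "0 \<le> C1" "\<And>i q. - C1 \<le> h i q"
  proof (rule uniform_bound[of "\<lambda>i c. \<forall>q. - c \<le> h i q"])
    fix i
    have "h i (p0 (0, i)) \<le> h i q" for q
      using monotone_onD[of "{..p0 (0, i)}" "(\<le>)" "(\<ge>)" "h i" q "p0 (0, i)"]
        monotone_onD[of "{p0 (0, i)..}" "(\<le>)" "(\<le>)" "h i" "p0 (0, i)" q] H2[of "(0, i)"]
      by (cases "q \<le> p0 (0, i)") (auto simp: h_def)
    then show "\<exists>c. \<forall>q. - c \<le> h i q" by (intro exI[of _ "- h i (p0 (0, i))"]) simp
  next
    show "\<forall>q. - d \<le> h i q" if "\<forall>q. - c \<le> h i q" "c \<le> d" for i and c d :: real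
      using that by (meson neg_le_iff_le order_trans)
  qed blast
  obtain C2 where C2: "0 \<le> C2" "\<And>i q. \<bar>q\<bar> \<le> L + 1 \<Longrightarrow> h i q \<le> C2"
  proof (rule uniform_bound[of "\<lambda>i c. \<forall>q. \<bar>q\<bar> \<le> L + 1 \<longrightarrow> h i q \<le> c"])
    fix i
    have "compact (h i ` {- (L + 1)..L + 1})"
      by (intro compact_continuous_image continuous_on_subset[OF cont] compact_Icc) auto
    then have "bdd_above (h i ` {- (L + 1)..L + 1})"
      by (intro bounded_imp_bdd_above compact_imp_bounded)
    then obtain c where "\<forall>r \<in> h i ` {- (L + 1)..L + 1}. r \<le> c" unfolding bdd_above_def by blast
    then have "h i q \<le> c" if "\<bar>q\<bar> \<le> L + 1" for q using that by (simp add: abs_le_iff)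
    then show "\<exists>c. \<forall>q. \<bar>q\<bar> \<le> L + 1 \<longrightarrow> h i q \<le> c" by blast
  next
    show "\<forall>q. \<bar>q\<bar> \<le> L + 1 \<longrightarrow> h i q \<le> d" if "\<forall>q. \<bar>q\<bar> \<le> L + 1 \<longrightarrow> h i q \<le> c" "c \<le> d" for i c d
      using that by (meson order_trans)
  qed blast
  define C where "C = \<bar>A\<bar> + C1 + C2"
  have C: "0 \<le> C" "- A \<le> C" "A \<le> C" "C1 \<le> C" "C2 \<le> C" using C1 C2 by (auto simp: C_def)
  have H_le: "?H q \<le> C" if "norm q \<le> L + 1" for q
  proof (rule effective_hamiltonian_le[OF C(3)])
    fix i
    have "\<bar>q $ i\<bar> \<le> L + 1" using component_le_norm_cart[of q i] that by linarith
    from C2(2)[OF this] C show "h i (q $ i) \<le> C" by (meson order_trans)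
  qed

  \<comment> \<open>Bounds on \<open>u \<epsilon> - u0\<close> that do not depend on \<open>\<epsilon>\<close>.\<close>
  have above: "usc_env ({0..} \<times> network \<epsilon>) (u \<epsilon>) (t, x) \<le> ereal (u0 x + C * t)"
    if \<epsilon>: "0 < \<epsilon>" and tx: "0 \<le> t" "x \<in> network \<epsilon>" for \<epsilon> t x
  proof (rule barrier_above[OF closed_network[OF \<epsilon>] lip _ _ _ tx])
    show "bounded_gap (network \<epsilon>) u0 (u \<epsilon>)"
      using u_solution[OF \<epsilon>] by (simp add: network_solution_def)
    show "usc_env ({0..} \<times> network \<epsilon>) (u \<epsilon>) (0, x) \<le> ereal (u0 x)" if "x \<in> network \<epsilon>" for x
      using u_solution[OF \<epsilon>] that by (simp add: network_solution_def attains_initial_def)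
    fix \<phi> \<tau> g t x
    assume \<phi>: "smooth_test \<phi> \<tau> g" and t: "0 < t" and x: "x \<in> network \<epsilon>"
      and touch: "touches_from_above (network \<epsilon>) \<phi> (u \<epsilon>) (t, x)"
    have sub: "network_subsolution \<epsilon> H (F_lim A H p0) (u \<epsilon>)"
      using u_solution[OF \<epsilon>] by (simp add: network_solution_def)
    have "touches_from_above (network \<epsilon>) (\<lambda>(t, x). \<phi> (t, x) + 0) (u \<epsilon>) (t, x)" using touch by simp
    from network_subsolutionD[OF sub \<epsilon> \<phi> edgewise_affine_zero t x this]
    show "\<tau> (t, x) \<le> C"
    proof cases
      case (1 e)
      with C1(2)[of "snd e" "g (t, x) $ snd e + 0"] C show ?thesis by (simp add: H)
    next
      case (2 y)
      with F_lim_ge(1)[of A H p0 y "\<lambda>e. g (t, x) $ snd e + 0"] C show ?thesis by simp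
    qed
  qed
  have below: "ereal (u0 x - C * t) \<le> lsc_env ({0..} \<times> network \<epsilon>) (u \<epsilon>) (t, x)"
    if \<epsilon>: "0 < \<epsilon>" and tx: "0 \<le> t" "x \<in> network \<epsilon>" for \<epsilon> t x
  proof (rule barrier_below[OF closed_network[OF \<epsilon>] lip _ _ _ tx])
    show "bounded_gap (network \<epsilon>) u0 (u \<epsilon>)"
      using u_solution[OF \<epsilon>] by (simp add: network_solution_def)
    show "ereal (u0 x) \<le> lsc_env ({0..} \<times> network \<epsilon>) (u \<epsilon>) (0, x)" if "x \<in> network \<epsilon>" for x
      using u_solution[OF \<epsilon>] that by (simp add: network_solution_def attains_initial_def)
    fix \<phi> \<tau> g t x
    assume \<phi>: "smooth_test \<phi> \<tau> g" and t: "0 < t" and x: "x \<in> network \<epsilon>"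
      and touch: "touches_from_below (network \<epsilon>) \<phi> (u \<epsilon>) (t, x)" and g: "norm (g (t, x)) \<le> L + 1"
    have super: "network_supersolution \<epsilon> H (F_lim A H p0) (u \<epsilon>)"
      using u_solution[OF \<epsilon>] by (simp add: network_solution_def)
    from network_supersolutionD[OF super \<epsilon> \<phi> t x touch]
    show "- C \<le> \<tau> (t, x)"
    proof cases
      case (1 e)
      with effective_hamiltonian_ge(2)[of h "snd e" "g (t, x)" A] H_le[OF g] show ?thesis by (simp add: H)
    next
      case (2 y)
      with F_lim_le_effective_hamiltonian[of H h p0 A y "g (t, x)", OF H H2] H_le[OF g] show ?thesis by simp
    qed
  qed

  let ?S = "relaxed_domain (network :: real \<Rightarrow> (real^'d) set)"
  let ?W = "\<lambda>(\<epsilon>, z). u \<epsilon> z"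
  have u_le: "u \<epsilon> (t, x) \<le> u0 x + C * t" and u_ge: "u0 x - C * t \<le> u \<epsilon> (t, x)"
    if "0 < \<epsilon>" "0 \<le> t" "x \<in> network \<epsilon>" for \<epsilon> t x
    using order_trans[OF usc_env_upper above[OF that]] order_trans[OF below[OF that] lsc_env_lower] that
    by auto
  have u0_cont: "continuous_on UNIV u0" by (rule lipschitz_on_continuous_on[OF lip])
  have u0_cont': "continuous_on UNIV (\<lambda>p :: real \<times> real \<times> (real^'d). u0 (snd (snd p)))"
    by (rule continuous_on_compose2[OF u0_cont]) (auto intro!: continuous_intros)
  have upper: "usc_env ?S ?W (0, t, x) \<le> ereal (u0 x + C * t)" for t x
  proof -
    have "usc_env ?S ?W (0, t, x) \<le> ereal ((\<lambda>p. u0 (snd (snd p)) + C * fst (snd p)) (0 :: real, t, x))"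
      by (rule usc_env_le_of_bound[where b = "\<lambda>p :: real \<times> real \<times> (real^'d). u0 (snd (snd p)) + C * fst (snd p)" and E = UNIV])
         (auto simp: relaxed_domain_def u_le intro!: always_eventually continuous_intros u0_cont')
    then show ?thesis by simp
  qed
  have lower: "ereal (u0 x - C * t) \<le> lsc_env ?S ?W (0, t, x)" for t x
  proof -
    have "usc_env ?S (\<lambda>(\<epsilon>, z). - u \<epsilon> z) (0, t, x) \<le> ereal ((\<lambda>p. - u0 (snd (snd p)) + C * fst (snd p)) (0 :: real, t, x))"
    proof (rule usc_env_le_of_bound[where b = "\<lambda>p :: real \<times> real \<times> (real^'d). - u0 (snd (snd p)) + C * fst (snd p)" and E = UNIV])
      have "- u \<epsilon> (s, y) \<le> - u0 y + C * s" if "0 < \<epsilon>" "0 \<le> s" "y \<in> network \<epsilon>" for \<epsilon> s y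
        using u_ge[OF that] by simp
      then show "\<forall>\<^sub>F p in nhds (0, t, x). p \<in> ?S \<longrightarrow> (\<lambda>(\<epsilon>, z). - u \<epsilon> z) p \<le> - u0 (snd (snd p)) + C * fst (snd p)"
        by (auto simp: relaxed_domain_def intro!: always_eventually)
    qed (auto intro!: continuous_intros u0_cont')
    then have "- lsc_env ?S ?W (0, t, x) \<le> - ereal (u0 x - C * t)"
      by (simp add: usc_env_relaxed_uminus)
    then show ?thesis by (simp only: ereal_minus_le_minus)
  qed
  have lower_upper: "lsc_env ?S ?W (0, t, x) \<le> usc_env ?S ?W (0, t, x)" if "0 \<le> t" for t x
    unfolding lsc_env_def usc_env_def by (rule Liminf_le_Limsup[OF relaxed_domain_accumulates[OF that]])
  \<comment> \<open>The two half-relaxed limits; the comparison principle will identify them.\<close>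
  define ubar where "ubar z = real_of_ereal (usc_env ?S ?W (0, z))" for z
  define ulow where "ulow z = real_of_ereal (lsc_env ?S ?W (0, z))" for z
  have ubar_eq: "usc_env ?S ?W (0, z) = ereal (ubar z)" and ulow_eq: "lsc_env ?S ?W (0, z) = ereal (ulow z)"
    if zD: "z \<in> {0..} \<times> UNIV" for z
  proof -
    obtain t x where z: "z = (t, x)" "0 \<le> t" using zD by (cases z) auto
    have "ereal (u0 x - C * t) \<le> lsc_env ?S ?W (0, z)" "lsc_env ?S ?W (0, z) \<le> usc_env ?S ?W (0, z)"
      "usc_env ?S ?W (0, z) \<le> ereal (u0 x + C * t)"
      using lower upper lower_upper z by auto
    then show "usc_env ?S ?W (0, z) = ereal (ubar z)" "lsc_env ?S ?W (0, z) = ereal (ulow z)"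
      unfolding ubar_def ulow_def
      by (cases "usc_env ?S ?W (0, z)"; cases "lsc_env ?S ?W (0, z)"; simp)+
  qed
  have sub: "space_subsolution ?H ubar"
  proof (rule relaxed_limsup_subsolution[of H h p0 A u ubar, OF H H2 cont coercive _ _ ubar_eq])
    show "network_subsolution \<epsilon> H (F_lim A H p0) (u \<epsilon>)" if "0 < \<epsilon>" for \<epsilon>
      using u_solution[OF that] by (simp add: network_solution_def)
    show "\<exists>c. usc_env ({0..} \<times> network \<epsilon>) (u \<epsilon>) z \<le> ereal c" if "0 < \<epsilon>" "z \<in> {0..} \<times> network \<epsilon>" for \<epsilon> z
      using above[OF that(1)] that(2) by (elim SigmaE) auto
  qed
  have super: "space_supersolution ?H v"
    if "\<And>z. z \<in> {0..} \<times> UNIV \<Longrightarrow> lsc_env ?S ?W (0, z) = ereal (v z)" for v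
  proof (rule relaxed_liminf_supersolution[of H h p0 A u v, OF H H2 cont _ _ that])
    show "network_supersolution \<epsilon> H (F_lim A H p0) (u \<epsilon>)" if "0 < \<epsilon>" for \<epsilon>
      using u_solution[OF that] by (simp add: network_solution_def)
    show "\<exists>c. ereal c \<le> lsc_env ({0..} \<times> network \<epsilon>) (u \<epsilon>) z" if "0 < \<epsilon>" "z \<in> {0..} \<times> network \<epsilon>" for \<epsilon> z
      using below[OF that(1)] that(2) by (elim SigmaE) auto
  qed
  have env_le: "usc_env ({0..} \<times> UNIV) v (t, x) \<le> ereal (u0 x + C * t)"
    if "\<And>s y. 0 \<le> s \<Longrightarrow> v (s, y) \<le> u0 y + C * s" and t: "0 \<le> t" for v t x
  proof -
    have "usc_env ({0..} \<times> UNIV) v (t, x) \<le> ereal ((\<lambda>z. u0 (snd z) + C * fst z) (t, x))"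
      by (rule usc_env_le_of_bound[where b = "\<lambda>z. u0 (snd z) + C * fst z", OF _ _ order_refl])
         (use that in \<open>auto intro!: always_eventually continuous_intros continuous_on_compose2[OF u0_cont]\<close>)
    then show ?thesis by simp
  qed
  have env_ge: "ereal (u0 x - C * t) \<le> lsc_env ({0..} \<times> UNIV) v (t, x)"
    if ge: "\<And>s y. 0 \<le> s \<Longrightarrow> u0 y - C * s \<le> v (s, y)" and t: "0 \<le> t" for v t x
  proof -
    have "- v w \<le> - u0 (snd w) + C * fst w" if "w \<in> {0..} \<times> UNIV" for w
      using ge[of "fst w" "snd w"] that by (auto simp: mem_Times_iff)
    then have "usc_env ({0..} \<times> UNIV) (\<lambda>z. - v z) (t, x) \<le> ereal ((\<lambda>z. - u0 (snd z) + C * fst z) (t, x))"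
      by (intro usc_env_le_of_bound[where b = "\<lambda>z. - u0 (snd z) + C * fst z", OF _ _ order_refl])
         (use t in \<open>auto intro!: always_eventually continuous_intros continuous_on_compose2[OF u0_cont]\<close>)
    then have "- lsc_env ({0..} \<times> UNIV) v (t, x) \<le> - ereal (u0 x - C * t)"
      by (simp add: usc_env_uminus)
    then show ?thesis by (simp only: ereal_minus_le_minus)
  qed
  have ubar_le: "ubar (t, x) \<le> u0 x + C * t" and ulow_ge: "u0 x - C * t \<le> ulow (t, x)"
    and ulow_ubar: "ulow (t, x) \<le> ubar (t, x)" if "0 \<le> t" for t x
    using upper[of t x] lower[of x t] lower_upper[OF that, of x] ubar_eq[of "(t, x)"] ulow_eq[of "(t, x)"] that
    by auto
  have "ubar (t, x) \<le> ulow (t, x)" if "0 \<le> t" for t x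
    by (rule comparison_principle[OF H_cont sub super[OF ulow_eq] lip env_le[OF ubar_le] env_ge[OF ulow_ge] that])
  then have eq: "ulow (t, x) = ubar (t, x)" if "0 \<le> t" for t x
    using ulow_ubar[OF that, of x] that by (intro antisym) auto
  have low_eq: "lsc_env ?S ?W (0, z) = ereal (ubar z)" if "z \<in> {0..} \<times> UNIV" for z
    using ulow_eq[OF that] eq[of "fst z" "snd z"] that by (auto simp: mem_Times_iff)
  have ubar_ge: "u0 x - C * t \<le> ubar (t, x)" if "0 \<le> t" for t x
    using ulow_ge[OF that, of x] eq[OF that, of x] by simp
  have super_ubar: "space_supersolution ?H ubar" by (rule super[OF low_eq])

  have "space_solution ?H u0 ubar"
    unfolding space_solution_def
  proof (intro conjI sub super_ubar)
    show "attains_initial UNIV u0 ubar"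
      unfolding attains_initial_def
      using env_le[OF ubar_le, of 0] env_ge[OF ubar_ge, of 0] by simp
    show "bounded_gap UNIV u0 ubar"
      unfolding bounded_gap_def
    proof (intro allI impI)
      fix T :: real
      have "\<bar>ubar (t, x) - u0 x\<bar> \<le> C * T" if "0 \<le> t" "t < T" for t x
      proof -
        have "C * t \<le> C * T" using that C by (intro mult_left_mono) auto
        then show ?thesis using ubar_le[OF that(1), of x] ubar_ge[OF that(1), of x] by (simp add: abs_le_iff)
      qed
      then show "\<exists>c. \<forall>t\<in>{0..<T}. \<forall>x\<in>UNIV. \<bar>ubar (t, x) - u0 x\<bar> \<le> c"
        by (intro exI[of _ "C * T"]) auto
    qed
  qed
  \<comment> \<open>Another solution obeys the same barriers, so comparison applies in both directions.\<close>
  moreover have "v (t, x) = ubar (t, x)" if v: "space_solution ?H u0 v" and t: "0 \<le> t" for v t x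
  proof (rule antisym)
    have v_sub: "space_subsolution ?H v" and v_super: "space_supersolution ?H v"
      and v_init: "attains_initial UNIV u0 v" and v_gap: "bounded_gap UNIV u0 v"
      using v by (auto simp: space_solution_def)
    have v_le: "usc_env ({0..} \<times> UNIV) v (s, y) \<le> ereal (u0 y + C * s)" if "0 \<le> s" for s y
    proof (rule barrier_above[OF closed_UNIV lip v_gap _ _ that UNIV_I])
      fix \<phi> \<tau> g t x
      assume "smooth_test \<phi> \<tau> g" "0 < t" "touches_from_above UNIV \<phi> v (t, x)"
      from space_subsolutionD[OF v_sub this] effective_hamiltonian_ge(1)[of A h "g (t, x)"] C(2)
      show "\<tau> (t, x) \<le> C" by linarith
    qed (use v_init in \<open>simp add: attains_initial_def\<close>)
    have v_ge: "ereal (u0 y - C * s) \<le> lsc_env ({0..} \<times> UNIV) v (s, y)" if "0 \<le> s" for s y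
    proof (rule barrier_below[OF closed_UNIV lip v_gap _ _ that UNIV_I])
      fix \<phi> \<tau> g t x
      assume *: "smooth_test \<phi> \<tau> g" "0 < t" "touches_from_below UNIV \<phi> v (t, x)" and g: "norm (g (t, x)) \<le> L + 1"
      from space_supersolutionD[OF v_super *] H_le[OF g] show "- C \<le> \<tau> (t, x)" by linarith
    qed (use v_init in \<open>simp add: attains_initial_def\<close>)
    show "v (t, x) \<le> ubar (t, x)"
      by (rule comparison_principle[OF H_cont v_sub super_ubar lip v_le env_ge[OF ubar_ge] t])
    show "ubar (t, x) \<le> v (t, x)"
      by (rule comparison_principle[OF H_cont sub v_super lip env_le[OF ubar_le] v_ge t])
  qed
  ultimately have unique: "unique_space_solution ?H u0 ubar"
    unfolding unique_space_solution_def by blast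
  have limit: "((\<lambda>(\<epsilon>, s, y). u \<epsilon> (s, y)) \<longlongrightarrow> ubar (t, x))
      (at (0, t, x) within {(\<epsilon>, s, y). 0 < \<epsilon> \<and> 0 \<le> s \<and> y \<in> network \<epsilon>})" if t: "0 \<le> t" for t x
  proof -
    \<comment> \<open>Since \<open>\<epsilon> > 0\<close> on the domain, the punctured filter is the one that defines the envelopes.\<close>
    have "(0, t, x) \<notin> ?S" by (simp add: relaxed_domain_def)
    then have filter: "at (0, t, x) within ?S = inf (nhds (0, t, x)) (principal ?S)"
      by (simp add: at_within_def)
    have "((\<lambda>p. ereal (?W p)) \<longlongrightarrow> ereal (ubar (t, x))) (inf (nhds (0, t, x)) (principal ?S))"
      using low_eq[of "(t, x)"] ubar_eq[of "(t, x)"] t unfolding lsc_env_def usc_env_def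
      by (intro Liminf_eq_Limsup[OF relaxed_domain_accumulates[OF t]]) auto
    then have "(?W \<longlongrightarrow> ubar (t, x)) (at (0, t, x) within ?S)" by (simp add: filter)
    moreover have "?W = (\<lambda>(\<epsilon>, s, y). u \<epsilon> (s, y))" by (simp add: fun_eq_iff)
    ultimately show ?thesis by (simp only: relaxed_domain_def)
  qed
  show ?thesis using H_cont unique limit by blast
qed

end
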